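(* Assume $n r_n^d\to 0$ as $n\to\infty$ and let $1\le k\le d$. Then \[ \lim_{n\to\infty}\big(n^{k+1}r_n^{dk}\big)^{-1}\mathrm{Var}\{N_{k,n}\}=\mu_k \quad\text{and}\quad \lim_{n\to\infty}\big(n^{k+1}r_n^{dk}\big)^{-1}\mathrm{Var}\{\widehat N_{k,n}\}=\mu_k, \] where \[ \mu_k=\frac{1}{(k+1)!}\int_{\mathbb{R}^d}f^{k+1}(x)\,dx\int_{(\mathbb{R}^d)^k}h_1(0,\mathbf{y})\,d\mathbf{y}. \]
   Context: Fix $d\ge1$. Let $f$ be a bounded probability density on $\mathbb{R}^d$. For each $n$, $\mathcal{X}_n=\{X_1,\dots,X_n\}$ where $X_1,X_2,\dots$ are i.i.d. with density $f$, and $\mathcal{P}_n$ is a Poisson point process on $\mathbb{R}^d$ with intensity function $nf$. $(r_n)_{n\ge1}$ is a sequence of positive numbers with $r_n\to0$. For a finite set $\mathcal{P}\subset\mathbb{R}^d$ let $d_{\mathcal{P}}(x)=\min_{p\in\mathcal{P}}\|x-p\|$. For a set $\mathcal{Y}$ of $k+1$ affinely independent points of $\mathbb{R}^d$, $C(\mathcal{Y})$ is the center and $R(\mathcal{Y})$ the radius of the unique $(k-1)$-dimensional sphere containing $\mathcal{Y}$, and $\mathrm{conv}^\circ(\mathcal{Y})$ is the interior of the convex hull of $\mathcal{Y}$ (an open $k$-simplex). For $1\le k\le d$, a point $c\in\mathbb{R}^d$ is a critical point of index $k$ of $d_{\mathcal{P}}$ if there is a subset $\mathcal{Y}\subset\mathcal{P}$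 of $k+1$ affinely independent points with $\|c-y\|=d_{\mathcal{P}}(c)$ for all $y\in\mathcal{Y}$, $\|c-p\|>d_{\mathcal{P}}(c)$ for all $p\in\mathcal{P}\setminus\mathcal{Y}$, and $c\in\mathrm{conv}^\circ(\mathcal{Y})$. $N_{k,n}$ is the number of critical points $c$ of index $k$ of $d_{\mathcal{X}_n}$ with $d_{\mathcal{X}_n}(c)\le r_n$, and $\widehat N_{k,n}$ is the number of critical points $c$ of index $k$ of $d_{\mathcal{P}_n}$ with $d_{\mathcal{P}_n}(c)\le r_n$. For $\mathbf{y}=(y_1,\dots,y_k)\in(\mathbb{R}^d)^k$, $h_1(0,\mathbf{y})=1$ if $\{0,y_1,\dots,y_k\}$ consists of $k+1$ affinely independent points $\mathcal{Y}$ with $C(\mathcal{Y})\in\mathrm{conv}^\circ(\mathcal{Y})$ and $R(\mathcal{Y})\le 1$, and $h_1(0,\mathbf{y})=0$ otherwise. *)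

theory Defs
  imports "HOL-Probability.Probability"
begin

definition dist_fun :: "'a::euclidean_space set \<Rightarrow> 'a \<Rightarrow> real" where
  "dist_fun P x = infdist x P"

definition is_critical :: "nat \<Rightarrow> 'a::euclidean_space set \<Rightarrow> 'a \<Rightarrow> bool" where
  "is_critical k P c \<longleftrightarrow>
     (\<exists>Y. Y \<subseteq> P \<and> card Y = k + 1 \<and> finite Y \<and> \<not> affine_dependent Y \<and>
          (\<forall>y\<in>Y. dist c y = dist_fun P c) \<and>
          (\<forall>p\<in>P - Y. dist c p > dist_fun P c) \<and>
          c \<in> rel_interior (convex hull Y))"

definition crit_count :: "nat \<Rightarrow> real \<Rightarrow> 'a::euclidean_space set \<Rightarrow> real" where
  "crit_count k r P = real (card {c. is_critical k P c \<and> dist_fun P c \<le> r})"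

definition circ_center :: "'a::euclidean_space set \<Rightarrow> 'a" where
  "circ_center Y = (THE c. c \<in> affine hull Y \<and> (\<exists>\<rho>. \<forall>y\<in>Y. dist c y = \<rho>))"

definition circ_radius :: "'a::euclidean_space set \<Rightarrow> real" where
  "circ_radius Y = dist (circ_center Y) (SOME y. y \<in> Y)"

definition h1 :: "nat \<Rightarrow> (nat \<Rightarrow> 'a::euclidean_space) \<Rightarrow> real" where
  "h1 k y = (let Y = insert 0 (y ` {..<k}) in
     if card Y = k + 1 \<and> \<not> affine_dependent Y \<and>
        circ_center Y \<in> rel_interior (convex hull Y) \<and> circ_radius Y \<le> 1
     then 1 else 0)"

text \<open>Probability space for sample size n: an independent pair (M, (X_i)_i) with
  M ~ Poisson(n) and X_1, X_2, ... i.i.d. with density f.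
  X_n = {X_i | i < n}; the Poisson process with intensity n f is {X_i | i < M}.\<close>
definition sample_space :: "('a::euclidean_space \<Rightarrow> real) \<Rightarrow> nat \<Rightarrow> (nat \<times> (nat \<Rightarrow> 'a)) measure" where
  "sample_space f n = measure_pmf (poisson_pmf (real n)) \<Otimes>\<^sub>M
                      (\<Pi>\<^sub>M i\<in>(UNIV::nat set). density lborel (\<lambda>x. ennreal (f x)))"

definition binomial_sample :: "nat \<Rightarrow> nat \<times> (nat \<Rightarrow> 'a) \<Rightarrow> 'a set" where
  "binomial_sample n \<omega> = (snd \<omega>) ` {..<n}"

definition poisson_sample :: "nat \<times> (nat \<Rightarrow> 'a) \<Rightarrow> 'a set" where
  "poisson_sample \<omega> = (snd \<omega>) ` {..<fst \<omega>}"

definition Var :: "'b measure \<Rightarrow> ('b \<Rightarrow> real) \<Rightarrow> real" where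
  "Var M X = (\<integral>\<omega>. (X \<omega> - (\<integral>\<omega>'. X \<omega>' \<partial>M))\<^sup>2 \<partial>M)"

definition mu_const :: "('a::euclidean_space \<Rightarrow> real) \<Rightarrow> nat \<Rightarrow> real" where
  "mu_const f k = 1 / fact (k + 1) * (\<integral>x. f x ^ (k + 1) \<partial>lborel) *
      (\<integral>y. h1 k y \<partial>(\<Pi>\<^sub>M i\<in>{..<k}. (lborel :: 'a measure)))"

end

theory Submission
  imports Defs
begin

text \<open>
  A critical point of index \<open>k\<close> is the circumcentre of a \<open>k\<close>-simplex of sample points that contains
  its circumcentre and whose closed circumball contains no further sample point. Hence the count is
  \<open>N = S - T\<close>, where the U-statistic \<open>S\<close> counts all such simplices of radius at most \<open>r\<close> and \<open>T\<close>
  counts those blocked by a further point. Write \<open>a = n^(k+1) r^(dk)\<close> and \<open>x = n r^d\<close>.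

  In the second moment of \<open>S\<close>, a pair of simplices spanned by \<open>s\<close> points in total contributes
  \<open>O(n^s r^(d(s-1)))\<close> if the simplices share a vertex, which is \<open>o(a)\<close> unless they coincide; pairs
  without a common vertex are cancelled by the squared mean up to \<open>o(a)\<close>. So the variance of \<open>S\<close> is
  asymptotic to its mean, which after rescaling converges by the continuity of translations in \<open>L^1\<close>.

  For \<open>T\<close> such a cancellation is not available; its variance is bounded by the Efron-Stein inequality
  instead. Removing a point changes \<open>T\<close> by at most \<open>k + 2\<close> times the number of \<open>(k+1)\<close>-subsets of the
  points within distance \<open>2r\<close>, so the variance of \<open>T\<close> is \<open>O(n x^(k+1)) = o(a)\<close>, and the variances
  of \<open>N\<close> and \<open>S\<close> agree to leading order. Both sampling schemes are the case of a random number
  \<open>M\<close> of i.i.d. points, with \<open>M\<close> constant or Poisson. The conditional mean of \<open>T\<close> given \<open>M\<close> has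
  increments \<open>O(x^(k+1))\<close>, and \<open>M\<close> fluctuates by \<open>sqrt n\<close>, so randomising \<open>M\<close> adds only \<open>o(a)\<close>.
\<close>

subsection \<open>Circumcentres and critical simplices\<close>

text \<open>Since a = n x^k, each error term divided by a is bounded by positive powers of x:
  overlapping distinct simplices spanning s points give x^(s-1-k), disjoint pairs at most x^k, and
  the variance of T gives x to leading order. For disjoint pairs, the expected number of ordered
  pairs of disjoint (k+1)-subsets is compared with the square of the expected number of
  (k+1)-subsets. With M = n these differ by O(n^(2k+1)); with M Poisson they agree exactly, because
  the factorial moments of M are powers of n. Efron-Stein requires a fixed number of coordinates, so
  it is applied conditionally on M, and the drift of the conditional mean is treated separately. The
  probabilistic part sees the geometry only through the interface \<open>local_count\<close>:
  vertices and blocking points of one simplex are within 2r of each other as needed, a ball of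
  radius 2r has mass at most c r^d, and the events are measurable. Measurability is a genuine
  obstacle, as circumcentres are given by a description operator; it is obtained by projecting
  closed sets along compact ones.\<close>

definition critical_simplex :: "nat \<Rightarrow> real \<Rightarrow> 'a::euclidean_space set \<Rightarrow> bool" where
  "critical_simplex k r Y \<longleftrightarrow> card Y = k + 1 \<and> \<not> affine_dependent Y \<and>
     circ_center Y \<in> rel_interior (convex hull Y) \<and> circ_radius Y \<le> r"

definition encloses :: "'a::euclidean_space set \<Rightarrow> 'a \<Rightarrow> bool" where
  "encloses Y p \<longleftrightarrow> dist (circ_center Y) p \<le> circ_radius Y"

text \<open>With \<open>y0\<close> as origin, equidistance from the vertices is the linear system b
  . v = |b|^2 / 2 over the independent difference vectors b in \<open>B\<close>. Independence gives
  a linear functional with these values, hence a representing vector \<open>w\<close>; its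
  projection to the span of \<open>B\<close> is a solution inside the affine hull. Two solutions
  differ by a vector of the span orthogonal to \<open>B\<close>, which is zero.\<close>

lemma circumcenter_ex1:
  fixes Y :: "'a::euclidean_space set"
  assumes "\<not> affine_dependent Y" "Y \<noteq> {}"
  shows "\<exists>!c. c \<in> affine hull Y \<and> (\<exists>\<rho>. \<forall>y\<in>Y. dist c y = \<rho>)"
proof -
  obtain y0 where y0: "y0 \<in> Y" using assms by auto
  define B where "B = (\<lambda>x. -y0 + x) ` (Y - {y0})"
  have indep: "independent B"
    using affine_dependent_iff_dependent2[OF y0] assms unfolding B_def by auto
  have hull: "affine hull Y = {y0 + v | v. v \<in> span B}"
    unfolding B_def affine_hull_span2[OF y0] by auto
  have Y_eq: "y = y0 \<or> (\<exists>b\<in>B. y = y0 + b)" if "y \<in> Y" for y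
    using that unfolding B_def by force
  have equi: "(\<forall>b\<in>B. b \<bullet> v = (b \<bullet> b) / 2) \<longleftrightarrow> (\<exists>\<rho>. \<forall>y\<in>Y. dist (y0 + v) y = \<rho>)" for v
  proof -
    have d: "dist (y0 + v) (y0 + b) = norm v \<longleftrightarrow> b \<bullet> v = (b \<bullet> b) / 2" for b
    proof -
      have "dist (y0 + v) (y0 + b) = norm (v - b)" by (simp add: dist_norm)
      then show ?thesis
        unfolding norm_eq_sqrt_inner by (auto simp: inner_diff inner_commute algebra_simps)
    qed
    have "(\<exists>\<rho>. \<forall>y\<in>Y. dist (y0 + v) y = \<rho>) \<longleftrightarrow> (\<forall>y\<in>Y. dist (y0 + v) y = norm v)"
      using y0 by (metis add.right_neutral dist_add_cancel dist_0_norm dist_commute)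
    also have "\<dots> \<longleftrightarrow> (\<forall>b\<in>B. dist (y0 + v) (y0 + b) = norm v)"
    proof -
      have "norm (y0 + v - y) = norm (v - (- y0 + y))" for y by (simp add: algebra_simps)
      then show ?thesis unfolding B_def by (auto simp: dist_norm)
    qed
    finally show ?thesis using d by simp
  qed
  obtain g :: "'a \<Rightarrow> real" where g: "linear g" "\<forall>b\<in>B. g b = (b \<bullet> b) / 2"
    using linear_independent_extend[OF indep, of "\<lambda>b. (b \<bullet> b) / 2"] by auto
  define w where "w = adjoint g 1"
  have gw: "g x = x \<bullet> w" for x
    using adjoint_works[OF g(1), of x 1] by (simp add: w_def)
  obtain v z where v: "v \<in> span B" "\<And>u. u \<in> span B \<Longrightarrow> orthogonal z u" "w = v + z"
    using orthogonal_subspace_decomp_exists[of B w] by blast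
  have bv: "b \<bullet> v = (b \<bullet> b) / 2" if "b \<in> B" for b
  proof -
    have "b \<bullet> z = 0" using v(2)[OF span_base[OF that]] by (simp add: orthogonal_def inner_commute)
    moreover have "b \<bullet> w = (b \<bullet> b) / 2" using g(2) gw that by auto
    ultimately show ?thesis using v(3) by (simp add: inner_add_right)
  qed
  show ?thesis
  proof (rule ex1I[of _ "y0 + v"])
    show "y0 + v \<in> affine hull Y \<and> (\<exists>\<rho>. \<forall>y\<in>Y. dist (y0 + v) y = \<rho>)"
      using v(1) hull equi bv by blast
    fix c assume c: "c \<in> affine hull Y \<and> (\<exists>\<rho>. \<forall>y\<in>Y. dist c y = \<rho>)"
    then obtain u where u: "c = y0 + u" "u \<in> span B" using hull by auto
    have bu: "\<forall>b\<in>B. b \<bullet> u = (b \<bullet> b) / 2" using c u equi by blast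
    have "orthogonal (u - v) b" if "b \<in> B" for b
    proof -
      have "b \<bullet> (u - v) = 0" using bspec[OF bu that] bv[OF that] by (simp add: inner_diff_right)
      then show ?thesis by (metis inner_commute orthogonal_def)
    qed
    then have "orthogonal (u - v) (u - v)"
      by (intro orthogonal_to_span[OF span_diff[OF u(2) v(1)]]) auto
    then show "c = y0 + v" using u by (simp add: orthogonal_def)
  qed
qed

lemma circ_center_eqI:
  fixes Y :: "'a::euclidean_space set"
  assumes "\<not> affine_dependent Y" "c \<in> affine hull Y" "\<And>y. y \<in> Y \<Longrightarrow> dist c y = \<rho>"
  shows "circ_center Y = c"
proof -
  have "Y \<noteq> {}" using assms(2) by auto
  from circumcenter_ex1[OF assms(1) this] show ?thesis
    unfolding circ_center_def using assms by (intro the1_equality) auto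
qed

lemma dist_circ_center:
  fixes Y :: "'a::euclidean_space set"
  assumes "\<not> affine_dependent Y" "Y \<noteq> {}" "y \<in> Y"
  shows "dist (circ_center Y) y = circ_radius Y"
proof -
  have *: "\<exists>\<rho>. \<forall>y\<in>Y. dist (circ_center Y) y = \<rho>"
    unfolding circ_center_def using theI'[OF circumcenter_ex1[OF assms(1,2)]] by blast
  have "(SOME y. y \<in> Y) \<in> Y" using assms(2) some_in_eq by blast
  then show ?thesis
    unfolding circ_radius_def using * assms(3) by metis
qed

lemma rel_interior_convex_hull_subset_affine_hull:
  "rel_interior (convex hull Y) \<subseteq> affine hull (Y :: 'a::euclidean_space set)"
  using rel_interior_subset convex_hull_subset_affine_hull by blast

text \<open>By uniqueness of the circumcentre, any point of the open simplex equidistant from the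
  vertices is the circumcentre. This removes the description and choice operators and leaves a form
  suited to translation, scaling and measurability arguments.\<close>

lemma critical_simplex_iff:
  "critical_simplex k r Y \<longleftrightarrow> card Y = k + 1 \<and> \<not> affine_dependent Y \<and>
     (\<exists>c \<in> rel_interior (convex hull Y). \<exists>\<rho> \<le> r. \<forall>y\<in>Y. dist c y = \<rho>)" (is "?L \<longleftrightarrow> ?R")
proof
  assume ?L
  then have "Y \<noteq> {}" by (auto simp: critical_simplex_def)
  then show ?R
    using \<open>?L\<close> dist_circ_center[of Y] unfolding critical_simplex_def by blast
next
  assume R: ?R
  then obtain c \<rho> where c: "c \<in> rel_interior (convex hull Y)" "\<rho> \<le> r" "\<forall>y\<in>Y. dist c y = \<rho>" by blast
  have ne: "Y \<noteq> {}" using R by auto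
  have "circ_center Y = c"
    using R c subsetD[OF rel_interior_convex_hull_subset_affine_hull] by (intro circ_center_eqI) auto
  moreover from this have "circ_radius Y = \<rho>"
    using dist_circ_center[of Y] R ne c by (metis all_not_in_conv)
  ultimately show ?L using R c by (auto simp: critical_simplex_def)
qed

lemma critical_simplex_dist_le:
  assumes "critical_simplex k r Y" "x \<in> Y" "y \<in> Y"
  shows "dist x y \<le> 2 * r"
proof -
  have "Y \<noteq> {}" using assms by auto
  then have "dist (circ_center Y) x \<le> r" "dist (circ_center Y) y \<le> r"
    using assms dist_circ_center[of Y x] dist_circ_center[of Y y] by (auto simp: critical_simplex_def)
  then show ?thesis by (metis add_mono dist_commute dist_triangle_le mult_2)
qed

lemma encloses_dist_le:
  assumes "critical_simplex k r Y" "encloses Y p" "y \<in> Y"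
  shows "dist p y \<le> 2 * r"
proof -
  have "Y \<noteq> {}" using assms by auto
  then have "dist (circ_center Y) p \<le> r" "dist (circ_center Y) y \<le> r"
    using assms dist_circ_center[of Y y] by (auto simp: critical_simplex_def encloses_def)
  then show ?thesis by (metis add_mono dist_commute dist_triangle_le mult_2)
qed

lemma critical_simplex_translate:
  "critical_simplex k r ((+) a ` Y) = critical_simplex k r Y"
proof -
  have "card ((+) a ` Y) = card Y" by (simp add: card_image)
  moreover have "affine_dependent ((+) a ` Y) = affine_dependent Y"
    using affine_dependent_translation_eq[of Y a] by simp
  moreover have "rel_interior (convex hull ((+) a ` Y)) = (+) a ` rel_interior (convex hull Y)"
    using convex_hull_translation[of a Y] rel_interior_translation[of a] by simp
  ultimately show ?thesis unfolding critical_simplex_iff by simp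
qed

lemma critical_simplex_scale:
  fixes Y :: "'a::euclidean_space set"
  assumes "0 < s"
  shows "critical_simplex k (s * r) ((*\<^sub>R) s ` Y) = critical_simplex k r Y"
proof -
  have inj: "inj ((*\<^sub>R) s :: 'a \<Rightarrow> 'a)" using assms by (simp add: inj_on_def)
  have card: "card ((*\<^sub>R) s ` Y) = card Y" by (metis card_image inj inj_on_subset subset_UNIV)
  have dep: "affine_dependent ((*\<^sub>R) s ` Y) = affine_dependent Y"
  proof -
    have "(\<exists>x\<in>(*\<^sub>R) s ` Y. x \<in> affine hull ((*\<^sub>R) s ` Y - {x})) \<longleftrightarrow> (\<exists>x\<in>Y. x \<in> affine hull (Y - {x}))"
    proof -
      have "(*\<^sub>R) s ` Y - {s *\<^sub>R x} = (*\<^sub>R) s ` (Y - {x})" for x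
        using inj by (auto simp: inj_def)
      moreover have "affine hull ((*\<^sub>R) s ` Z) = (*\<^sub>R) s ` (affine hull Z)" for Z :: "'a set"
        by (rule affine_hull_linear_image[symmetric]) (rule bounded_linear_scaleR_right)
      ultimately show ?thesis using inj by (auto simp: inj_image_mem_iff)
    qed
    then show ?thesis by (simp add: affine_dependent_def)
  qed
  have rel: "rel_interior (convex hull ((*\<^sub>R) s ` Y)) = (*\<^sub>R) s ` rel_interior (convex hull Y)"
    by (metis convex_hull_scaling inj rel_interior_injective_linear_image bounded_linear_scaleR_right)
  have ex: "(\<exists>\<rho>\<le>s * r. \<forall>y\<in>Y. s * dist c y = \<rho>) \<longleftrightarrow> (\<exists>\<rho>\<le>r. \<forall>y\<in>Y. dist c y = \<rho>)" for c
  proof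
    assume "\<exists>\<rho>\<le>s * r. \<forall>y\<in>Y. s * dist c y = \<rho>"
    then obtain \<rho> where "\<rho> \<le> s * r" "\<forall>y\<in>Y. s * dist c y = \<rho>" by blast
    then show "\<exists>\<rho>\<le>r. \<forall>y\<in>Y. dist c y = \<rho>"
      using assms by (intro exI[of _ "\<rho> / s"]) (auto simp: field_simps)
  next
    assume "\<exists>\<rho>\<le>r. \<forall>y\<in>Y. dist c y = \<rho>"
    then obtain \<rho> where "\<rho> \<le> r" "\<forall>y\<in>Y. dist c y = \<rho>" by blast
    then show "\<exists>\<rho>\<le>s * r. \<forall>y\<in>Y. s * dist c y = \<rho>"
      using assms by (intro exI[of _ "s * \<rho>"]) auto
  qed
  have d: "dist (s *\<^sub>R x) (s *\<^sub>R y) = s * dist x y" for x y :: 'a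
    using assms by (simp add: dist_norm flip: scaleR_diff_right)
  show ?thesis unfolding critical_simplex_iff card dep rel using ex by (simp add: d)
qed

lemma critical_simplex_affine_image:
  fixes Y :: "'a::euclidean_space set"
  assumes "0 < s"
  shows "critical_simplex k s ((\<lambda>y. x + s *\<^sub>R y) ` Y) = critical_simplex k 1 Y"
proof -
  have "(\<lambda>y. x + s *\<^sub>R y) ` Y = (+) x ` ((*\<^sub>R) s ` Y)" by (simp add: image_image)
  then show ?thesis
    using critical_simplex_scale[OF assms, of k 1 Y] by (simp add: critical_simplex_translate)
qed

lemma h1_eq: "h1 k y = of_bool (critical_simplex k 1 (insert 0 (y ` {..<k})))"
  by (simp add: h1_def critical_simplex_def Let_def)

text \<open>The circumcentre map is a bijection from unblocked simplices to critical points. It is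
  injective because the simplex is recovered from its centre c: the distance function at c equals
  the circumradius, and the vertices are the sample points within that distance of c.\<close>

lemma crit_count_eq_card:
  fixes P :: "'a::euclidean_space set"
  assumes "finite P"
  shows "crit_count k r P = real (card {Y. Y \<subseteq> P \<and> critical_simplex k r Y \<and> (\<forall>p\<in>P - Y. \<not> encloses Y p)})"
    (is "_ = real (card ?Q)")
proof -
  let ?C = "{c. is_critical k P c \<and> dist_fun P c \<le> r}"
  have dist_fun: "dist_fun P c = \<rho>"
    if Y: "Y \<subseteq> P" "Y \<noteq> {}" "\<forall>y\<in>Y. dist c y = \<rho>" "\<forall>p\<in>P - Y. \<rho> < dist c p" for Y c \<rho>
  proof (unfold dist_fun_def, rule antisym)
    obtain y where "y \<in> Y" using Y(2) by auto
    then show "infdist c P \<le> \<rho>" using infdist_le[of y P c] Y by auto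
    show "\<rho> \<le> infdist c P"
      using Y by (auto simp: infdist_def intro!: cINF_greatest) (metis DiffI less_eq_real_def order_refl)
  qed
  have "bij_betw circ_center ?Q ?C"
  proof (rule bij_betw_imageI)
    show "inj_on circ_center ?Q"
    proof (rule inj_onI)
      fix Y Y' assume Y: "Y \<in> ?Q" and Y': "Y' \<in> ?Q" and eq: "circ_center Y = circ_center Y'"
      have ch: "Z = {p \<in> P. dist (circ_center Z) p \<le> circ_radius Z} \<and> dist_fun P (circ_center Z) = circ_radius Z"
        if Z: "Z \<in> ?Q" for Z
      proof -
        have nd: "\<not> affine_dependent Z" "Z \<noteq> {}" using Z by (auto simp: critical_simplex_def)
        have "dist_fun P (circ_center Z) = circ_radius Z"
          using Z nd dist_circ_center[OF nd] by (intro dist_fun[of Z]) (auto simp: encloses_def not_le)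
        then show ?thesis
          using Z dist_circ_center[OF nd] by (auto simp: encloses_def)
      qed
      show "Y = Y'" using ch[OF Y] ch[OF Y'] eq by metis
    qed
    show "circ_center ` ?Q = ?C"
    proof (intro equalityI subsetI)
      fix c assume "c \<in> circ_center ` ?Q"
      then obtain Y where Y: "Y \<in> ?Q" "c = circ_center Y" by auto
      have nd: "\<not> affine_dependent Y" "Y \<noteq> {}" using Y by (auto simp: critical_simplex_def)
      have df: "dist_fun P c = circ_radius Y"
        using Y nd dist_circ_center[OF nd] by (intro dist_fun[of Y]) (auto simp: encloses_def not_le)
      have "finite Y" using assms Y finite_subset by blast
      then show "c \<in> ?C"
        using Y nd df dist_circ_center[OF nd] unfolding is_critical_def critical_simplex_def
        by (auto simp: encloses_def not_le intro!: exI[of _ Y])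
    next
      fix c assume "c \<in> ?C"
      then obtain Y where Y: "Y \<subseteq> P" "card Y = k + 1" "finite Y" "\<not> affine_dependent Y"
        "\<forall>y\<in>Y. dist c y = dist_fun P c" "\<forall>p\<in>P - Y. dist c p > dist_fun P c"
        "c \<in> rel_interior (convex hull Y)" "dist_fun P c \<le> r"
        unfolding is_critical_def by auto
      have ne: "Y \<noteq> {}" using Y by auto
      have c: "circ_center Y = c"
        using Y subsetD[OF rel_interior_convex_hull_subset_affine_hull] by (intro circ_center_eqI) auto
      then have "circ_radius Y = dist_fun P c"
        using dist_circ_center[OF Y(4) ne] Y ne by (metis all_not_in_conv)
      then have "critical_simplex k r Y" "\<forall>p\<in>P - Y. \<not> encloses Y p"
        using Y c by (simp_all add: critical_simplex_def encloses_def not_le)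
      then show "c \<in> circ_center ` ?Q"
        using Y(1) c by blast
    qed
  qed
  then show ?thesis unfolding crit_count_def by (simp add: bij_betw_same_card)
qed

subsection \<open>Measurability of critical simplices\<close>

text \<open>Along a convergent sequence in the projection, the witnesses in \<open>K\<close> have a
  convergent subsequence, whose limit is a witness for the limit point.\<close>

lemma closed_projection_along_compact:
  fixes K :: "'b::metric_space set" and C :: "('b \<times> 'c::metric_space) set"
  assumes "compact K" "closed C"
  shows "closed {y. \<exists>x\<in>K. (x, y) \<in> C}"
  unfolding closed_sequential_limits
proof (intro allI impI, elim conjE)
  fix y :: "nat \<Rightarrow> 'c" and l
  assume y: "\<forall>n. y n \<in> {y. \<exists>x\<in>K. (x, y) \<in> C}" "y \<longlonglongrightarrow> l"
  then obtain x where x: "\<And>n. x n \<in> K" "\<And>n. (x n, y n) \<in> C" by (simp add: Bex_def) metis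
  obtain z s where z: "z \<in> K" "strict_mono s" "(x \<circ> s) \<longlonglongrightarrow> z"
    using compact_imp_seq_compact[OF assms(1)] x(1) unfolding seq_compact_def by metis
  have "(\<lambda>n. ((x \<circ> s) n, (y \<circ> s) n)) \<longlonglongrightarrow> (z, l)"
    by (intro tendsto_Pair z LIMSEQ_subseq_LIMSEQ[OF y(2)])
  moreover have "((x \<circ> s) n, (y \<circ> s) n) \<in> C" for n using x(2) by simp
  ultimately have "(z, l) \<in> C"
    using closed_sequentially[OF assms(2), of "\<lambda>n. ((x \<circ> s) n, (y \<circ> s) n)"] by blast
  then show "l \<in> {y. \<exists>x\<in>K. (x, y) \<in> C}" using z by auto
qed

lemma compact_PiE_UNIV:
  fixes S :: "'i \<Rightarrow> 'b::topological_space set"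
  assumes "\<And>i. compact (S i)"
  shows "compact (PiE UNIV S)"
  using assms compactin_PiE[of "\<lambda>_. euclidean" UNIV S]
  by (simp add: euclidean_product_topology)

lemma continuous_on_fst_apply: "continuous_on A (\<lambda>p. fst p i)"
  for A :: "(('i \<Rightarrow> 'b::topological_space) \<times> 'c::topological_space) set"
  by (rule continuous_on_product_then_coordinatewise) (intro continuous_intros)

lemma continuous_on_snd_apply: "continuous_on A (\<lambda>p. snd p i)"
  for A :: "('c::topological_space \<times> ('i \<Rightarrow> 'b::topological_space)) set"
  by (rule continuous_on_product_then_coordinatewise) (intro continuous_intros)

lemmas closed_Collect_intros = closed_Collect_conj closed_Collect_eq closed_Collect_all
  closed_Collect_imp closed_Collect_le open_Collect_const continuous_on_fst_apply
  continuous_on_snd_apply continuous_intros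

text \<open>Affine dependence of the points is the existence of a normalised affine relation, and a
  point of the open simplex has barycentric coordinates bounded away from zero; in both cases
  the coefficients range over a compact set (a countable union of them), so that projecting
  them out preserves closedness.\<close>

lemma borel_rel_interior_simplex:
  fixes D :: "('a::euclidean_space \<times> (nat \<Rightarrow> 'a)) set"
  assumes I: "finite I" "card I = k + 1" and D: "closed D"
  shows "{\<omega>. card (\<omega> ` I) = k + 1 \<and> \<not> affine_dependent (\<omega> ` I) \<and>
            (\<exists>c \<in> rel_interior (convex hull (\<omega> ` I)). (c, \<omega>) \<in> D)} \<in> sets borel"
proof -
  define K where "K = PiE UNIV (\<lambda>i. if i \<in> I then {-1..1::real} else {0})"
  have K: "compact K" unfolding K_def by (rule compact_PiE_UNIV) auto
  \<comment> \<open>A nontrivial relation divided by its absolute sum has coefficients in [-1, 1].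
    Since the coefficients are attached to indices and not to points, \<open>A\<close> also captures
    repeated points, so its complement is independence together with injectivity on
    \<open>I\<close>.\<close>
  define A where "A = {\<omega> :: nat \<Rightarrow> 'a. \<exists>u\<in>K. (u, \<omega>) \<in>
     {(u, \<omega>). (\<Sum>i\<in>I. u i) = 0 \<and> (\<Sum>i\<in>I. \<bar>u i\<bar>) = 1 \<and> (\<Sum>i\<in>I. u i *\<^sub>R \<omega> i) = 0}}"
  define B where "B m = {\<omega> :: nat \<Rightarrow> 'a. \<exists>u\<in>K. (u, \<omega>) \<in>
     {(u, \<omega>). (\<Sum>i\<in>I. u i) = 1 \<and> (\<forall>i\<in>I. 1 / real (Suc m) \<le> u i) \<and> ((\<Sum>i\<in>I. u i *\<^sub>R \<omega> i), \<omega>) \<in> D}}" for m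
  have clA: "closed A"
    unfolding A_def
    by (rule closed_projection_along_compact[OF K])
       (unfold case_prod_beta', intro closed_Collect_intros)
  have clB: "closed (B m)" for m
  proof -
    have "closed ((\<lambda>p :: (nat \<Rightarrow> real) \<times> (nat \<Rightarrow> 'a). ((\<Sum>i\<in>I. fst p i *\<^sub>R snd p i), snd p)) -` D)"
      by (rule closed_vimage[OF D])
         (intro closed_Collect_intros)
    then have "closed {p :: (nat \<Rightarrow> real) \<times> (nat \<Rightarrow> 'a). ((\<Sum>i\<in>I. fst p i *\<^sub>R snd p i), snd p) \<in> D}"
      by (simp add: vimage_def)
    then show ?thesis
      unfolding B_def
      by (intro closed_projection_along_compact[OF K])
         (unfold case_prod_beta' Ball_def, intro closed_Collect_intros)
  qed
  have A_iff: "\<omega> \<notin> A \<longleftrightarrow> inj_on \<omega> I \<and> \<not> affine_dependent (\<omega> ` I)" for \<omega>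
  proof (cases "inj_on \<omega> I")
    case False
    then obtain a b where ab: "a \<in> I" "b \<in> I" "a \<noteq> b" "\<omega> a = \<omega> b" by (auto simp: inj_on_def)
    \<comment> \<open>Two indices carrying the same point give the relation with coefficients 1/2
      and -1/2.\<close>
    define u :: "nat \<Rightarrow> real" where "u i = (if i = a then 1/2 else if i = b then -1/2 else 0)" for i
    have eq: "(\<Sum>i\<in>I. g i) = g a + g b" if "\<And>i. i \<noteq> a \<Longrightarrow> i \<noteq> b \<Longrightarrow> g i = 0" for g :: "nat \<Rightarrow> 'c::ab_group_add"
    proof -
      have "(\<Sum>i\<in>I. g i) = (\<Sum>i\<in>{a, b}. g i)"
        using ab that I by (intro sum.mono_neutral_right) auto
      then show ?thesis using ab by simp
    qed
    have "\<omega> \<in> A"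
      unfolding A_def using ab
      by (auto simp: eq u_def K_def intro!: bexI[of _ u])
    then show ?thesis using False by simp
  next
    case True
    show ?thesis
    proof
      assume nA: "\<omega> \<notin> A"
      have False if dep: "affine_dependent (\<omega> ` I)"
      proof -
        obtain U where U: "sum U (\<omega> ` I) = 0" "\<exists>v\<in>\<omega> ` I. U v \<noteq> 0" "(\<Sum>v\<in>\<omega> ` I. U v *\<^sub>R v) = 0"
          using dep I affine_dependent_explicit_finite[of "\<omega> ` I"] by auto
        define s where "s = (\<Sum>i\<in>I. \<bar>U (\<omega> i)\<bar>)"
        obtain i where "i \<in> I" "U (\<omega> i) \<noteq> 0" using U(2) by auto
        then have s: "s > 0" unfolding s_def using I by (intro sum_pos2[of I i]) auto
        define u where "u i = (if i \<in> I then U (\<omega> i) / s else 0)" for i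
        have "\<bar>U (\<omega> i)\<bar> \<le> s" if "i \<in> I" for i
          unfolding s_def using that I by (intro member_le_sum) auto
        then have "-1 \<le> U (\<omega> i) / s \<and> U (\<omega> i) / s \<le> 1" if "i \<in> I" for i
          using s that by (fastforce simp: field_simps abs_le_iff)
        then have uK: "u \<in> K" by (auto simp: K_def u_def)
        have 1: "(\<Sum>i\<in>I. u i) = 0"
          using U(1) s True by (simp add: u_def sum.reindex flip: sum_divide_distrib)
        have 2: "(\<Sum>i\<in>I. \<bar>u i\<bar>) = 1"
          using s by (simp add: u_def flip: sum_divide_distrib s_def)
        have "(\<Sum>i\<in>I. u i *\<^sub>R \<omega> i) = (1 / s) *\<^sub>R (\<Sum>i\<in>I. U (\<omega> i) *\<^sub>R \<omega> i)"
          unfolding scaleR_sum_right by (simp add: u_def)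
        also have "\<dots> = 0" using U(3) True by (simp add: sum.reindex)
        finally have "\<omega> \<in> A" using uK 1 2 by (auto simp: A_def)
        then show False using nA by simp
      qed
      then show "inj_on \<omega> I \<and> \<not> affine_dependent (\<omega> ` I)" using True by auto
    next
      assume ind: "inj_on \<omega> I \<and> \<not> affine_dependent (\<omega> ` I)"
      show "\<omega> \<notin> A"
      proof
        assume "\<omega> \<in> A"
        then obtain u where u: "(\<Sum>i\<in>I. u i) = 0" "(\<Sum>i\<in>I. \<bar>u i\<bar>) = 1" "(\<Sum>i\<in>I. u i *\<^sub>R \<omega> i) = 0"
          by (auto simp: A_def)
        define U where "U v = u (the_inv_into I \<omega> v)" for v
        have U: "U (\<omega> i) = u i" if "i \<in> I" for i using that True by (simp add: U_def the_inv_into_f_f)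
        have "\<exists>i\<in>I. u i \<noteq> 0" using u(2) by (rule contrapos_pp) simp
        then have "affine_dependent (\<omega> ` I)"
          using affine_dependent_explicit_finite[of "\<omega> ` I"] I u True U
          by (auto simp: sum.reindex intro!: exI[of _ U])
        then show False using ind by simp
      qed
    qed
  qed
  have B_iff: "(\<exists>m. \<omega> \<in> B m) \<longleftrightarrow> (\<exists>c \<in> rel_interior (convex hull (\<omega> ` I)). (c, \<omega>) \<in> D)" if nA: "\<omega> \<notin> A" for \<omega>
  proof -
    have inj: "inj_on \<omega> I" and ind: "\<not> affine_dependent (\<omega> ` I)" using nA A_iff by auto
    note rel = rel_interior_convex_hull_explicit[OF ind]
    show ?thesis
    proof
      assume "\<exists>m. \<omega> \<in> B m"
      then obtain m u where u: "(\<Sum>i\<in>I. u i) = 1" "\<forall>i\<in>I. 1 / real (Suc m) \<le> u i" "((\<Sum>i\<in>I. u i *\<^sub>R \<omega> i), \<omega>) \<in> D"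
        by (auto simp: B_def)
      define U where "U v = u (the_inv_into I \<omega> v)" for v
      have U: "U (\<omega> i) = u i" if "i \<in> I" for i using that inj by (simp add: U_def the_inv_into_f_f)
      have "0 < u i" if "i \<in> I" for i
        using u(2) that by (meson less_le_trans of_nat_0_less_iff zero_less_Suc zero_less_divide_1_iff)
      then have "(\<Sum>i\<in>I. u i *\<^sub>R \<omega> i) \<in> rel_interior (convex hull (\<omega> ` I))"
        unfolding rel using u(1) inj U by (auto simp: sum.reindex intro!: exI[of _ U])
      then show "\<exists>c \<in> rel_interior (convex hull (\<omega> ` I)). (c, \<omega>) \<in> D" using u(3) by auto
    next
      assume "\<exists>c \<in> rel_interior (convex hull (\<omega> ` I)). (c, \<omega>) \<in> D"
      then obtain U where U: "\<forall>x\<in>\<omega> ` I. 0 < U x" "sum U (\<omega> ` I) = 1" "((\<Sum>x\<in>\<omega> ` I. U x *\<^sub>R x), \<omega>) \<in> D"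
        unfolding rel by auto
      define u where "u i = (if i \<in> I then U (\<omega> i) else 0)" for i
      have sum1: "(\<Sum>i\<in>I. u i) = 1" using U(2) inj by (simp add: u_def sum.reindex)
      have pos: "0 < u i" if "i \<in> I" for i using U(1) that by (auto simp: u_def)
      have le1: "u i \<le> 1" if "i \<in> I" for i
        using member_le_sum[of i I u] that I pos sum1 by (auto simp: less_imp_le)
      have uK: "u \<in> K" using pos le1 by (auto simp: K_def u_def) (smt (verit))+
      have "Min (u ` I) > 0" using pos I by (subst Min_gr_iff) auto
      then obtain m where m: "1 / real (Suc m) < Min (u ` I)" using nat_approx_posE by blast
      have "1 / real (Suc m) \<le> u i" if "i \<in> I" for i
      proof -
        have "Min (u ` I) \<le> u i" using that I by (intro Min_le) auto
        then show ?thesis using m by linarith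
      qed
      moreover have "(\<Sum>i\<in>I. u i *\<^sub>R \<omega> i) = (\<Sum>x\<in>\<omega> ` I. U x *\<^sub>R x)"
        using inj by (simp add: u_def sum.reindex)
      ultimately have "\<omega> \<in> B m" using uK sum1 U(3) unfolding B_def by auto
      then show "\<exists>m. \<omega> \<in> B m" ..
    qed
  qed
  have "{\<omega>. card (\<omega> ` I) = k + 1 \<and> \<not> affine_dependent (\<omega> ` I) \<and>
            (\<exists>c \<in> rel_interior (convex hull (\<omega> ` I)). (c, \<omega>) \<in> D)} = (\<Union>m. B m) - A"
  proof -
    have card: "card (\<omega> ` I) = k + 1 \<longleftrightarrow> inj_on \<omega> I" for \<omega> :: "nat \<Rightarrow> 'a"
      using I by (metis card_image eq_card_imp_inj_on)
    have "(card (\<omega> ` I) = k + 1 \<and> \<not> affine_dependent (\<omega> ` I) \<and>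
      (\<exists>c \<in> rel_interior (convex hull (\<omega> ` I)). (c, \<omega>) \<in> D)) \<longleftrightarrow> \<omega> \<notin> A \<and> (\<exists>m. \<omega> \<in> B m)" for \<omega>
      using A_iff[of \<omega>] B_iff[of \<omega>] card[of \<omega>] by argo
    then show ?thesis by auto
  qed
  also have "\<dots> \<in> sets borel"
    using clA clB by (intro sets.Diff sets.countable_UN borel_closed) (auto intro: borel_closed)
  finally show ?thesis .
qed

text \<open>The existential radius is eliminated: \<open>I\<close> is nonempty, so a common distance
  at most \<open>r\<close> exists exactly if all distances from c agree and are at most
  \<open>r\<close>. This is a closed condition on the pair of c and the sample.\<close>

lemma borel_critical_simplex:
  fixes I :: "nat set"
  assumes I: "finite I" "card I = k + 1"
  shows "{\<omega> :: nat \<Rightarrow> 'a::euclidean_space. critical_simplex k r (\<omega> ` I)} \<in> sets borel"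
proof -
  have "closed {(c, \<omega> :: nat \<Rightarrow> 'a). \<forall>i\<in>I. \<forall>j\<in>I. dist c (\<omega> i) = dist c (\<omega> j) \<and> dist c (\<omega> i) \<le> r}"
    by (unfold case_prod_beta' Ball_def, intro closed_Collect_intros)
  from borel_rel_interior_simplex[OF I this] show ?thesis
  proof (rule back_subst[where P="\<lambda>A. A \<in> sets borel"], intro Collect_cong)
    fix \<omega> :: "nat \<Rightarrow> 'a"
    have "I \<noteq> {}" using I by auto
    then have "(\<exists>\<rho> \<le> r. \<forall>y\<in>\<omega> ` I. dist c y = \<rho>) \<longleftrightarrow>
      (\<forall>i\<in>I. \<forall>j\<in>I. dist c (\<omega> i) = dist c (\<omega> j) \<and> dist c (\<omega> i) \<le> r)" for c
    proof (intro iffI)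
      assume "\<forall>i\<in>I. \<forall>j\<in>I. dist c (\<omega> i) = dist c (\<omega> j) \<and> dist c (\<omega> i) \<le> r"
      moreover obtain i where "i \<in> I" using \<open>I \<noteq> {}\<close> by blast
      ultimately show "\<exists>\<rho> \<le> r. \<forall>y\<in>\<omega> ` I. dist c y = \<rho>"
        by (intro exI[of _ "dist c (\<omega> i)"]) blast
    qed auto
    then show "(card (\<omega> ` I) = k + 1 \<and> \<not> affine_dependent (\<omega> ` I) \<and>
      (\<exists>c\<in>rel_interior (convex hull \<omega> ` I). (c, \<omega>) \<in> {(c, \<omega>). \<forall>i\<in>I. \<forall>j\<in>I. dist c (\<omega> i) = dist c (\<omega> j) \<and> dist c (\<omega> i) \<le> r})) =
      critical_simplex k r (\<omega> ` I)"
      unfolding critical_simplex_iff by simp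
  qed
qed

text \<open>\<open>encloses\<close> alone refers to the circumcentre of a possibly degenerate set,
  where the description operator is unspecified. In conjunction with criticality the centre is the
  point c of the projection, and enclosing becomes one more closed inequality between distances from
  c.\<close>

lemma borel_critical_simplex_encloses:
  fixes I :: "nat set"
  assumes I: "finite I" "card I = k + 1"
  shows "{\<omega> :: nat \<Rightarrow> 'a::euclidean_space. critical_simplex k r (\<omega> ` I) \<and> encloses (\<omega> ` I) (\<omega> p)} \<in> sets borel"
proof -
  let ?D = "{(c, \<omega> :: nat \<Rightarrow> 'a). \<forall>i\<in>I. \<forall>j\<in>I. dist c (\<omega> i) = dist c (\<omega> j) \<and> dist c (\<omega> i) \<le> r
     \<and> dist c (\<omega> p) \<le> dist c (\<omega> i)}"
  have "closed ?D"
    by (unfold case_prod_beta' Ball_def, intro closed_Collect_intros)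
  from borel_rel_interior_simplex[OF I this] show ?thesis
  proof (rule back_subst[where P="\<lambda>A. A \<in> sets borel"], intro Collect_cong iffI)
    fix \<omega> :: "nat \<Rightarrow> 'a"
    have ne: "I \<noteq> {}" using I by auto
    assume *: "card (\<omega> ` I) = k + 1 \<and> \<not> affine_dependent (\<omega> ` I) \<and>
      (\<exists>c\<in>rel_interior (convex hull \<omega> ` I). (c, \<omega>) \<in> ?D)"
    then obtain c where c: "c \<in> rel_interior (convex hull \<omega> ` I)" "(c, \<omega>) \<in> ?D" by auto
    obtain i where i: "i \<in> I" using ne by auto
    have D: "dist c (\<omega> a) = dist c (\<omega> b) \<and> dist c (\<omega> a) \<le> r \<and> dist c (\<omega> p) \<le> dist c (\<omega> a)"
      if "a \<in> I" "b \<in> I" for a b using c(2) that unfolding mem_Collect_eq case_prod_conv by blast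
    have eq: "\<forall>y\<in>\<omega> ` I. dist c y = dist c (\<omega> i)" and le: "dist c (\<omega> i) \<le> r"
      using D i by blast+
    then have crit: "critical_simplex k r (\<omega> ` I)"
      unfolding critical_simplex_iff using * c by blast
    have "circ_center (\<omega> ` I) = c"
      using * eq subsetD[OF rel_interior_convex_hull_subset_affine_hull c(1)]
      by (intro circ_center_eqI[where \<rho>="dist c (\<omega> i)"]) blast+
    moreover have "dist (circ_center (\<omega> ` I)) (\<omega> i) = circ_radius (\<omega> ` I)"
      using dist_circ_center[of "\<omega> ` I" "\<omega> i"] * i by blast
    ultimately show "critical_simplex k r (\<omega> ` I) \<and> encloses (\<omega> ` I) (\<omega> p)"
      using crit D[OF i i] by (simp add: encloses_def)
  next
    fix \<omega> :: "nat \<Rightarrow> 'a"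
    assume *: "critical_simplex k r (\<omega> ` I) \<and> encloses (\<omega> ` I) (\<omega> p)"
    have ne: "I \<noteq> {}" using I by auto
    have "dist (circ_center (\<omega> ` I)) (\<omega> i) = circ_radius (\<omega> ` I)" if "i \<in> I" for i
      using dist_circ_center[of "\<omega> ` I" "\<omega> i"] * ne that by (auto simp: critical_simplex_def)
    then show "card (\<omega> ` I) = k + 1 \<and> \<not> affine_dependent (\<omega> ` I) \<and>
      (\<exists>c\<in>rel_interior (convex hull \<omega> ` I). (c, \<omega>) \<in> ?D)"
      using * by (auto simp: critical_simplex_def encloses_def intro!: bexI[of _ "circ_center (\<omega> ` I)"])
  qed
qed

subsection \<open>Continuity of translations in the mean\<close>

lemma integral_lborel_translate:
  fixes u :: "'a::euclidean_space \<Rightarrow> real"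
  assumes [measurable]: "u \<in> borel_measurable borel"
  shows "(\<integral>x. u (x + c) \<partial>lborel) = (\<integral>x. u x \<partial>lborel)"
    and "integrable lborel u \<Longrightarrow> integrable lborel (\<lambda>x. u (x + c))"
proof -
  have "(\<integral>x. u x \<partial>lborel) = (\<integral>x. u x \<partial>distr lborel borel ((+) c))" by (simp add: lborel_distr_plus)
  also have "\<dots> = (\<integral>x. u (x + c) \<partial>lborel)" by (subst integral_distr) (auto simp: add.commute)
  finally show "(\<integral>x. u (x + c) \<partial>lborel) = (\<integral>x. u x \<partial>lborel)" by simp
  assume "integrable lborel u"
  then have "integrable (distr lborel borel ((+) c)) u" by (simp add: lborel_distr_plus)
  then show "integrable lborel (\<lambda>x. u (x + c))"
    by (subst (asm) integrable_distr_eq) (auto simp: add.commute)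
qed

lemma integrable_indicator_cball:
  "integrable lborel (\<lambda>x :: 'a::euclidean_space. c * indicator (cball 0 R) x :: real)"
  using emeasure_lborel_cball_finite[of "0 :: 'a" R]
  by (intro integrable_mult_right integrable_real_indicator) auto

lemma integrable_lborel_bounded_support:
  fixes u :: "'a::euclidean_space \<Rightarrow> real"
  assumes "u \<in> borel_measurable borel" "\<And>x. \<bar>u x\<bar> \<le> F * indicator (cball 0 R) x"
  shows "integrable lborel u"
proof (rule Bochner_Integration.integrable_bound)
  show "integrable lborel (\<lambda>x. F * indicator (cball 0 R) x :: real)"
    by (rule integrable_indicator_cball)
  show "AE x in lborel. norm (u x) \<le> norm (F * indicator (cball 0 R) x :: real)"
    using assms(2) by (intro AE_I2) (metis abs_ge_self order_trans real_norm_def)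
qed (use assms in simp)

text \<open>A measurable function is an almost everywhere limit of continuous ones. Cutting these
  off at a large radius and clipping them to [0, F] supplies a dominating function, so dominated
  convergence upgrades the limit to L^1. The cutoff and the approximation each cost e/2.\<close>

lemma L1_approx_continuous:
  fixes f :: "'a::euclidean_space \<Rightarrow> real"
  assumes f [measurable]: "f \<in> borel_measurable borel" and nonneg: "\<And>x. 0 \<le> f x" and F: "\<And>x. f x \<le> F"
    and int: "integrable lborel f" and e: "0 < e"
  obtains g R where "continuous_on UNIV g" "\<And>x. \<bar>g x\<bar> \<le> F * indicator (cball 0 R) x"
    "(\<integral>x. \<bar>f x - g x\<bar> \<partial>lborel) < e"
proof -
  have F0: "0 \<le> F" using nonneg[of 0] F[of 0] by linarith
  have "f measurable_on UNIV"
    by (rule lebesgue_measurable_imp_measurable_on_real) (auto intro: measurable_completion)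
  then obtain N g where N: "negligible N" "\<And>n. continuous_on UNIV (g n)"
    "\<And>x. x \<notin> N \<Longrightarrow> (\<lambda>n. g n x) \<longlonglongrightarrow> f x"
    by (auto simp: measurable_on_def)
  have [measurable]: "g n \<in> borel_measurable borel" for n
    using N(2) by (rule borel_measurable_continuous_onI)
  have "AE x in lebesgue. (\<lambda>n. g n x) \<longlonglongrightarrow> f x"
    using N(1,3) by (auto simp: negligible_iff_null_sets intro: AE_I'[of N])
  then have AE: "AE x in lborel. (\<lambda>n. g n x) \<longlonglongrightarrow> f x"
    by (simp add: AE_completion_iff)
  \<comment> \<open>A continuous cutoff: one on the ball of radius \<open>R\<close>, zero outside
    radius \<open>R + 1\<close>.\<close>
  define \<theta> where "\<theta> R x = max 0 (min 1 (real R + 1 - norm x))" for R :: nat and x :: 'a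
  have [measurable]: "\<theta> R \<in> borel_measurable borel" for R unfolding \<theta>_def by measurable
  have \<theta>: "0 \<le> \<theta> R x" "\<theta> R x \<le> 1" for R x by (auto simp: \<theta>_def)
  have \<theta>0: "\<theta> R x = 0" if "x \<notin> cball 0 (real R + 1)" for R x using that by (auto simp: \<theta>_def)
  have "(\<lambda>R. \<integral>x. \<bar>f x - \<theta> R x * f x\<bar> \<partial>lborel) \<longlonglongrightarrow> (\<integral>x. 0 \<partial>(lborel :: 'a measure))"
  proof (rule integral_dominated_convergence[where w=f])
    show "AE x in lborel. (\<lambda>R. \<bar>f x - \<theta> R x * f x\<bar>) \<longlonglongrightarrow> 0"
    proof (rule AE_I2)
      fix x
      have "\<bar>f x - \<theta> R x * f x\<bar> = 0" if "nat \<lceil>norm x\<rceil> \<le> R" for R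
      proof -
        have "norm x \<le> real R" using that by linarith
        then show ?thesis by (simp add: \<theta>_def)
      qed
      then show "(\<lambda>R. \<bar>f x - \<theta> R x * f x\<bar>) \<longlonglongrightarrow> 0"
        by (intro tendsto_eventually eventually_sequentiallyI) blast
    qed
    fix R
    show "AE x in lborel. norm \<bar>f x - \<theta> R x * f x\<bar> \<le> f x"
    proof (rule AE_I2)
      fix x
      have "f x - \<theta> R x * f x = (1 - \<theta> R x) * f x" by (simp add: algebra_simps)
      moreover have "(1 - \<theta> R x) * f x \<le> 1 * f x" using \<theta>[of R x] nonneg[of x] by (intro mult_right_mono) auto
      moreover have "0 \<le> (1 - \<theta> R x) * f x" using \<theta>[of R x] nonneg[of x] by simp
      ultimately show "norm \<bar>f x - \<theta> R x * f x\<bar> \<le> f x" by simp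
    qed
  qed (use int in auto)
  then have "\<forall>\<^sub>F R in sequentially. (\<integral>x. \<bar>f x - \<theta> R x * f x\<bar> \<partial>lborel) < e / 2"
    using e by (intro order_tendstoD(2)) auto
  then obtain R where R: "(\<integral>x. \<bar>f x - \<theta> R x * f x\<bar> \<partial>lborel) < e / 2"
    by (auto simp: eventually_sequentially)
  define G where "G n x = \<theta> R x * max 0 (min F (g n x))" for n x
  have [measurable]: "G n \<in> borel_measurable borel" for n unfolding G_def by measurable
  have Gb: "\<bar>G n x\<bar> \<le> F * indicator (cball 0 (real R + 1)) x" for n x
  proof (cases "x \<in> cball 0 (real R + 1)")
    case True
    have "\<theta> R x * max 0 (min F (g n x)) \<le> 1 * F" using \<theta>[of R x] F0 by (intro mult_mono) auto
    then show ?thesis using True \<theta>[of R x] by (simp add: G_def)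
  qed (simp add: G_def \<theta>0)
  have intw: "integrable lborel (\<lambda>x::'a. F * indicator (cball 0 (real R + 1)) x :: real)"
    by (rule integrable_indicator_cball)
  have "(\<lambda>n. \<integral>x. \<bar>\<theta> R x * f x - G n x\<bar> \<partial>lborel) \<longlonglongrightarrow> (\<integral>x. 0 \<partial>(lborel :: 'a measure))"
  proof (rule integral_dominated_convergence[where w="\<lambda>x. F * indicator (cball 0 (real R + 1)) x"])
    show "AE x in lborel. (\<lambda>n. \<bar>\<theta> R x * f x - G n x\<bar>) \<longlonglongrightarrow> 0"
      using AE
    proof eventually_elim
      case (elim x)
      have "(\<lambda>n. \<bar>\<theta> R x * f x - G n x\<bar>) \<longlonglongrightarrow> \<bar>\<theta> R x * f x - \<theta> R x * max 0 (min F (f x))\<bar>"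
        unfolding G_def by (intro tendsto_intros elim)
      moreover have "max 0 (min F (f x)) = f x" using nonneg[of x] F[of x] by simp
      ultimately show ?case by simp
    qed
    fix n
    show "AE x in lborel. norm \<bar>\<theta> R x * f x - G n x\<bar> \<le> F * indicator (cball 0 (real R + 1)) x"
    proof (rule AE_I2)
      fix x
      show "norm \<bar>\<theta> R x * f x - G n x\<bar> \<le> F * indicator (cball 0 (real R + 1)) x"
      proof (cases "x \<in> cball 0 (real R + 1)")
        case True
        have "\<bar>\<theta> R x * f x - G n x\<bar> = \<theta> R x * \<bar>f x - max 0 (min F (g n x))\<bar>"
          unfolding G_def right_diff_distrib[symmetric] abs_mult using \<theta>[of R x] by simp
        also have "\<dots> \<le> 1 * F"
          using \<theta>[of R x] nonneg[of x] F[of x] F0 by (intro mult_mono) (auto simp: max_def min_def)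
        finally show ?thesis using True by simp
      qed (simp add: G_def \<theta>0)
    qed
  qed (use intw in auto)
  then have "\<forall>\<^sub>F n in sequentially. (\<integral>x. \<bar>\<theta> R x * f x - G n x\<bar> \<partial>lborel) < e / 2"
    using e by (intro order_tendstoD(2)) auto
  then obtain n where n: "(\<integral>x. \<bar>\<theta> R x * f x - G n x\<bar> \<partial>lborel) < e / 2"
    by (auto simp: eventually_sequentially)
  have intG: "integrable lborel (G n)" by (rule integrable_lborel_bounded_support[OF _ Gb]) simp
  have int\<theta>: "integrable lborel (\<lambda>x. \<theta> R x * f x)"
  proof (rule Bochner_Integration.integrable_bound[OF int])
    show "AE x in lborel. norm (\<theta> R x * f x) \<le> norm (f x)"
      using \<theta>[of R] nonneg by (intro AE_I2) (auto simp: abs_mult intro: mult_left_le_one_le)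
  qed simp
  show ?thesis
  proof (rule that[of "G n" "real R + 1"])
    show "continuous_on UNIV (G n)"
      unfolding G_def \<theta>_def by (intro continuous_intros N(2))
    show "\<bar>G n x\<bar> \<le> F * indicator (cball 0 (real R + 1)) x" for x by (rule Gb)
    have "(\<integral>x. \<bar>f x - G n x\<bar> \<partial>lborel) \<le> (\<integral>x. \<bar>f x - \<theta> R x * f x\<bar> + \<bar>\<theta> R x * f x - G n x\<bar> \<partial>lborel)"
      by (intro integral_mono integrable_abs Bochner_Integration.integrable_add Bochner_Integration.integrable_diff int intG int\<theta>) linarith
    also have "\<dots> = (\<integral>x. \<bar>f x - \<theta> R x * f x\<bar> \<partial>lborel) + (\<integral>x. \<bar>\<theta> R x * f x - G n x\<bar> \<partial>lborel)"
      by (intro Bochner_Integration.integral_add integrable_abs Bochner_Integration.integrable_diff int intG int\<theta>)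
    also have "\<dots> < e" using R n by simp
    finally show "(\<integral>x. \<bar>f x - G n x\<bar> \<partial>lborel) < e" .
  qed
qed

text \<open>A three-epsilon argument: \<open>f\<close> is replaced by a continuous \<open>g\<close>
  of bounded support. The two replacement errors coincide by translation invariance of Lebesgue
  measure, and the translates of \<open>g\<close> are handled by dominated convergence.\<close>

lemma L1_translation_continuous:
  fixes f :: "'a::euclidean_space \<Rightarrow> real"
  assumes f [measurable]: "f \<in> borel_measurable borel" and nonneg: "\<And>x. 0 \<le> f x" and F: "\<And>x. f x \<le> F"
    and int: "integrable lborel f" and h: "h \<longlonglongrightarrow> 0"
  shows "(\<lambda>n. \<integral>x. \<bar>f (x + h n) - f x\<bar> \<partial>lborel) \<longlonglongrightarrow> 0"
proof (rule LIMSEQ_I)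
  fix e :: real assume e: "0 < e"
  then have e3: "0 < e / 3" by simp
  obtain g R where g: "continuous_on UNIV g" "\<And>x. \<bar>g x\<bar> \<le> F * indicator (cball 0 R) x"
    "(\<integral>x. \<bar>f x - g x\<bar> \<partial>lborel) < e / 3"
    using L1_approx_continuous[OF f nonneg F int e3] by blast
  have F0: "0 \<le> F" using nonneg[of 0] F[of 0] by linarith
  have [measurable]: "g \<in> borel_measurable borel" by (rule borel_measurable_continuous_onI[OF g(1)])
  have intg: "integrable lborel g" by (rule integrable_lborel_bounded_support[OF _ g(2)]) simp
  \<comment> \<open>The shifts are capped at norm one so that all translates of \<open>g\<close>
    live in one ball of radius \<open>R + 1\<close>; eventually the cap is inactive.\<close>
  define h' where "h' n = (if norm (h n) \<le> 1 then h n else 0)" for n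
  have ev: "\<forall>\<^sub>F n in sequentially. h' n = h n"
  proof -
    have "\<forall>\<^sub>F n in sequentially. norm (h n) < 1"
      using tendsto_norm[OF h] by (intro order_tendstoD(2)) auto
    then show ?thesis by eventually_elim (simp add: h'_def)
  qed
  have h': "h' \<longlonglongrightarrow> 0" "norm (h' n) \<le> 1" for n
    using h ev by (auto simp: h'_def tendsto_cong)
  have "(\<lambda>n. \<integral>x. \<bar>g (x + h' n) - g x\<bar> \<partial>lborel) \<longlonglongrightarrow> (\<integral>x. 0 \<partial>(lborel :: 'a measure))"
  proof (rule integral_dominated_convergence[where w="\<lambda>x. 2 * F * indicator (cball 0 (R + 1)) x"])
    show "integrable lborel (\<lambda>x::'a. 2 * F * indicator (cball 0 (R + 1)) x :: real)"
      by (rule integrable_indicator_cball)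
    show "AE x in lborel. (\<lambda>n. \<bar>g (x + h' n) - g x\<bar>) \<longlonglongrightarrow> 0"
    proof (rule AE_I2)
      fix x
      have "isCont g x" using g(1) by (simp add: continuous_on_eq_continuous_at)
      moreover have "(\<lambda>n. x + h' n) \<longlonglongrightarrow> x" using tendsto_add[OF tendsto_const h'(1), of x] by simp
      ultimately have "(\<lambda>n. g (x + h' n)) \<longlonglongrightarrow> g x" by (rule isCont_tendsto_compose)
      then show "(\<lambda>n. \<bar>g (x + h' n) - g x\<bar>) \<longlonglongrightarrow> 0" by (intro tendsto_rabs_zero) (simp add: LIM_zero)
    qed
    fix n
    show "AE x in lborel. norm \<bar>g (x + h' n) - g x\<bar> \<le> 2 * F * indicator (cball 0 (R + 1)) x"
    proof (rule AE_I2)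
      fix x
      have ind: "indicator (cball 0 R) (x + h' n) \<le> (indicator (cball 0 (R + 1)) x :: real)"
        "indicator (cball 0 R) x \<le> (indicator (cball 0 (R + 1)) x :: real)"
        using h'(2)[of n] norm_triangle_ineq4[of "x + h' n" "h' n"] by (auto simp: indicator_def)
      have "\<bar>g (x + h' n) - g x\<bar> \<le> F * indicator (cball 0 R) (x + h' n) + F * indicator (cball 0 R) x"
        using g(2)[of "x + h' n"] g(2)[of x] by linarith
      also have "\<dots> \<le> F * indicator (cball 0 (R + 1)) x + F * indicator (cball 0 (R + 1)) x"
        using F0 ind by (intro add_mono mult_left_mono) auto
      finally show "norm \<bar>g (x + h' n) - g x\<bar> \<le> 2 * F * indicator (cball 0 (R + 1)) x" by simp
    qed
  qed auto
  then have "\<forall>\<^sub>F n in sequentially. (\<integral>x. \<bar>g (x + h' n) - g x\<bar> \<partial>lborel) < e / 3"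
    using e by (intro order_tendstoD(2)) auto
  with ev have "\<forall>\<^sub>F n in sequentially. (\<integral>x. \<bar>f (x + h n) - f x\<bar> \<partial>lborel) < e"
  proof eventually_elim
    case (elim n)
    note tr = integral_lborel_translate(2)[where c="h n"]
    have i: "integrable lborel (\<lambda>x. f (x + h n))" "integrable lborel (\<lambda>x. g (x + h n))"
      by (intro tr int intg; simp)+
    have "(\<integral>x. \<bar>f (x + h n) - f x\<bar> \<partial>lborel)
      \<le> (\<integral>x. \<bar>f (x + h n) - g (x + h n)\<bar> + (\<bar>g (x + h n) - g x\<bar> + \<bar>f x - g x\<bar>) \<partial>lborel)"
      by (intro integral_mono integrable_abs Bochner_Integration.integrable_add Bochner_Integration.integrable_diff i int intg) linarith
    also have "\<dots> = (\<integral>x. \<bar>f (x + h n) - g (x + h n)\<bar> \<partial>lborel) + ((\<integral>x. \<bar>g (x + h n) - g x\<bar> \<partial>lborel) + (\<integral>x. \<bar>f x - g x\<bar> \<partial>lborel))"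
      using i int intg by simp
    also have "(\<integral>x. \<bar>f (x + h n) - g (x + h n)\<bar> \<partial>lborel) = (\<integral>x. \<bar>f x - g x\<bar> \<partial>lborel)"
      by (rule integral_lborel_translate(1)[where u="\<lambda>x. \<bar>f x - g x\<bar>"]) simp
    finally show ?case using g(3) elim by simp
  qed
  then show "\<exists>no. \<forall>n\<ge>no. norm ((\<integral>x. \<bar>f (x + h n) - f x\<bar> \<partial>lborel) - 0) < e"
    by (auto simp: eventually_sequentially)
qed

text \<open>Dividing all factors by \<open>F\<close> brings them into the unit interval, where
  differences of products telescope without further constants; since \<open>F\<close> is at least 1,
  the divided differences are no larger than the original ones.\<close>

lemma abs_prod_diff_le:
  fixes a b :: "'i \<Rightarrow> real"
  assumes F: "1 \<le> F" and a: "\<And>i. i \<in> I \<Longrightarrow> 0 \<le> a i \<and> a i \<le> F" and b: "\<And>i. i \<in> I \<Longrightarrow> 0 \<le> b i \<and> b i \<le> F"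
  shows "\<bar>(\<Prod>i\<in>I. a i) - (\<Prod>i\<in>I. b i)\<bar> \<le> F ^ card I * (\<Sum>i\<in>I. \<bar>a i - b i\<bar>)"
proof -
  have "norm ((\<Prod>i\<in>I. a i / F) - (\<Prod>i\<in>I. b i / F)) \<le> (\<Sum>i\<in>I. norm (a i / F - b i / F))"
    using a b F by (intro norm_prod_diff) auto
  also have "\<dots> \<le> (\<Sum>i\<in>I. \<bar>a i - b i\<bar>)"
  proof (rule sum_mono)
    fix i
    have "\<bar>a i - b i\<bar> * 1 \<le> \<bar>a i - b i\<bar> * F" using F by (intro mult_left_mono) auto
    then show "norm (a i / F - b i / F) \<le> \<bar>a i - b i\<bar>"
      using F by (simp add: field_simps flip: diff_divide_distrib)
  qed
  finally have "\<bar>((\<Prod>i\<in>I. a i) - (\<Prod>i\<in>I. b i)) / F ^ card I\<bar> \<le> (\<Sum>i\<in>I. \<bar>a i - b i\<bar>)"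
    by (simp add: prod_dividef diff_divide_distrib)
  then show ?thesis using F by (simp add: field_simps)
qed

subsection \<open>The probability of a critical simplex\<close>

interpretation lborel_product: product_sigma_finite "\<lambda>_ :: nat. lborel :: 'a::euclidean_space measure"
  by standard

lemma PiM_density_lborel:
  fixes g :: "'a::euclidean_space \<Rightarrow> ennreal" and I :: "nat set"
  assumes [measurable]: "g \<in> borel_measurable borel" and p: "prob_space (density lborel g)" and I: "finite I"
  shows "density (PiM I (\<lambda>_. lborel)) (\<lambda>y. \<Prod>i\<in>I. g (y i)) = PiM I (\<lambda>_. density lborel g)"
proof -
  interpret prob_space "density lborel g" by (rule p)
  interpret product_sigma_finite "\<lambda>_ :: nat. density lborel g" by standard
  have [measurable]: "(\<lambda>y. \<Prod>i\<in>I. g (y i)) \<in> borel_measurable (PiM I (\<lambda>_. lborel))" by measurable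
  show ?thesis
  proof (rule PiM_eqI[OF I])
    show "sets (density (PiM I (\<lambda>_. lborel)) (\<lambda>y. \<Prod>i\<in>I. g (y i))) = sets (PiM I (\<lambda>_. density lborel g))"
      by (simp cong: sets_PiM_cong)
    fix A assume A: "\<And>i. i \<in> I \<Longrightarrow> A i \<in> sets (density lborel g)"
    then have A' [measurable]: "\<And>i. i \<in> I \<Longrightarrow> A i \<in> sets borel" by simp
    have "emeasure (density (PiM I (\<lambda>_. lborel)) (\<lambda>y. \<Prod>i\<in>I. g (y i))) (Pi\<^sub>E I A)
      = (\<integral>\<^sup>+ y. (\<Prod>i\<in>I. g (y i)) * indicator (Pi\<^sub>E I A) y \<partial>PiM I (\<lambda>_. lborel))"
      using A' I by (intro emeasure_density) (auto intro!: sets_PiM_I_finite)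
    also have "\<dots> = (\<integral>\<^sup>+ y. (\<Prod>i\<in>I. g (y i) * indicator (A i) (y i)) \<partial>PiM I (\<lambda>_. lborel))"
    proof (rule nn_integral_cong)
      fix y assume "y \<in> space (PiM I (\<lambda>_. lborel :: 'a measure))"
      then have "indicator (Pi\<^sub>E I A) y = (\<Prod>i\<in>I. indicator (A i) (y i) :: ennreal)"
        using I by (auto simp: indicator_def space_PiM PiE_iff prod_zero_iff)
      then show "(\<Prod>i\<in>I. g (y i)) * indicator (Pi\<^sub>E I A) y = (\<Prod>i\<in>I. g (y i) * indicator (A i) (y i))"
        by (simp add: prod.distrib)
    qed
    also have "\<dots> = (\<Prod>i\<in>I. \<integral>\<^sup>+ x. g x * indicator (A i) x \<partial>lborel)"
      using A' by (intro lborel_product.product_nn_integral_prod I) auto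
    also have "\<dots> = (\<Prod>i\<in>I. emeasure (density lborel g) (A i))"
      using A' by (intro prod.cong refl emeasure_density[symmetric]) auto
    finally show "emeasure (density (PiM I (\<lambda>_. lborel)) (\<lambda>y. \<Prod>i\<in>I. g (y i))) (Pi\<^sub>E I A) =
      (\<Prod>i\<in>I. emeasure (density lborel g) (A i))" .
  qed
qed

lemma measurable_affine_PiM:
  "(\<lambda>z. \<lambda>i\<in>I. x + r *\<^sub>R z i) \<in> measurable (PiM I (\<lambda>_. lborel)) (PiM I (\<lambda>_. lborel :: 'a::euclidean_space measure))"
  by measurable

text \<open>The substitution y = x + r z in every coordinate, each contributing the Jacobian r^d. It
  suffices to compare the two measures on rectangles, where the affine rule for a single copy of
  Lebesgue measure applies factor by factor.\<close>

lemma nn_integral_PiM_lborel_affine: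
  fixes x :: "'a::euclidean_space" and I :: "nat set"
  assumes I: "finite I" and r: "0 < r"
    and [measurable]: "\<phi> \<in> borel_measurable (PiM I (\<lambda>_. lborel))"
  shows "(\<integral>\<^sup>+ y. \<phi> y \<partial>PiM I (\<lambda>_. lborel)) =
    ennreal (r ^ (DIM('a) * card I)) * (\<integral>\<^sup>+ z. \<phi> (\<lambda>i\<in>I. x + r *\<^sub>R z i) \<partial>PiM I (\<lambda>_. lborel))"
proof -
  let ?T = "\<lambda>z. \<lambda>i\<in>I. x + r *\<^sub>R z i" and ?P = "PiM I (\<lambda>_. lborel :: 'a measure)"
  note [measurable] = measurable_affine_PiM
  let ?D = "density (distr ?P ?P ?T) (\<lambda>_. ennreal (r ^ (DIM('a) * card I)))"
  have "?D = ?P"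
  proof (rule lborel_product.PiM_eqI[OF I])
    show "sets ?D = sets ?P" by simp
    fix A :: "nat \<Rightarrow> 'a set" assume A: "\<And>i. i \<in> I \<Longrightarrow> A i \<in> sets lborel"
    then have A' [measurable]: "\<And>i. i \<in> I \<Longrightarrow> A i \<in> sets borel" by simp
    let ?B = "\<lambda>i. (\<lambda>z. x + r *\<^sub>R z) -` A i"
    have B: "?B i \<in> sets borel" if "i \<in> I" for i
      using measurable_sets[of "\<lambda>z. x + r *\<^sub>R z" borel borel "A i"] A'[OF that] by simp
    have AI: "Pi\<^sub>E I A \<in> sets ?P" using A I by (intro sets_PiM_I_finite) auto
    have "emeasure ?D (Pi\<^sub>E I A) = ennreal (r ^ (DIM('a) * card I)) * emeasure ?P (?T -` Pi\<^sub>E I A \<inter> space ?P)"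
      using AI by (simp add: emeasure_density_const emeasure_distr)
    also have "?T -` Pi\<^sub>E I A \<inter> space ?P = Pi\<^sub>E I ?B"
      by (auto simp: space_PiM PiE_iff)
    also have "emeasure ?P (Pi\<^sub>E I ?B) = (\<Prod>i\<in>I. emeasure lborel (?B i))"
      using B by (intro lborel_product.emeasure_PiM I) auto
    also have "ennreal (r ^ (DIM('a) * card I)) * \<dots> = (\<Prod>i\<in>I. ennreal (r ^ DIM('a)) * emeasure lborel (?B i))"
      using r by (simp add: prod.distrib power_mult ennreal_power)
    also have "\<dots> = (\<Prod>i\<in>I. emeasure lborel (A i))"
    proof (rule prod.cong[OF refl])
      fix i assume i: "i \<in> I"
      have "emeasure lborel (A i) = emeasure (density (distr lborel borel (\<lambda>z. x + r *\<^sub>R z)) (\<lambda>_. ennreal (\<bar>r\<bar> ^ DIM('a)))) (A i)"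
        using lborel_affine[of r x] r by simp
      also have "\<dots> = ennreal (r ^ DIM('a)) * emeasure lborel (?B i)"
        using A'[OF i] r by (simp add: emeasure_density_const emeasure_distr)
      finally show "ennreal (r ^ DIM('a)) * emeasure lborel (?B i) = emeasure lborel (A i)" by simp
    qed
    finally show "emeasure ?D (Pi\<^sub>E I A) = (\<Prod>i\<in>I. emeasure lborel (A i))" .
  qed
  then have "(\<integral>\<^sup>+ y. \<phi> y \<partial>?P) = (\<integral>\<^sup>+ y. \<phi> y \<partial>?D)" by simp
  also have "\<dots> = ennreal (r ^ (DIM('a) * card I)) * (\<integral>\<^sup>+ z. \<phi> (?T z) \<partial>?P)"
    by (simp add: nn_integral_density nn_integral_cmult nn_integral_distr)
  finally show ?thesis .
qed

lemma measurable_critical_simplex_insert: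
  "Measurable.pred (lborel \<Otimes>\<^sub>M PiM {..<k} (\<lambda>_. lborel))
     (\<lambda>(x :: 'a::euclidean_space, z). critical_simplex k r (insert x (z ` {..<k})))"
proof -
  let ?e = "\<lambda>(x :: 'a, z :: nat \<Rightarrow> 'a) i. if i < k then z i else x"
  have e: "?e \<in> measurable (lborel \<Otimes>\<^sub>M PiM {..<k} (\<lambda>_. lborel)) (PiM UNIV (\<lambda>_. borel))"
  proof (rule measurable_PiM_single')
    show "(\<lambda>\<omega>. ?e \<omega> i) \<in> borel_measurable (lborel \<Otimes>\<^sub>M PiM {..<k} (\<lambda>_. lborel))" for i
      by (cases "i < k") (auto simp: case_prod_beta)
  qed (auto simp: case_prod_beta)
  have "Measurable.pred (PiM UNIV (\<lambda>_. borel)) (\<lambda>\<omega> :: nat \<Rightarrow> 'a. critical_simplex k r (\<omega> ` {..<Suc k}))"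
    using borel_critical_simplex[of "{..<Suc k}" k r]
    by (simp add: pred_def sets_PiM_equal_borel space_PiM)
  from measurable_compose[OF e this]
  have "Measurable.pred (lborel \<Otimes>\<^sub>M PiM {..<k} (\<lambda>_. lborel)) (\<lambda>p. critical_simplex k r (?e p ` {..<Suc k}))" .
  also have "(\<lambda>p. critical_simplex k r (?e p ` {..<Suc k})) = (\<lambda>(x, z). critical_simplex k r (insert x (z ` {..<k})))"
    by (auto simp: fun_eq_iff lessThan_Suc)
  finally show ?thesis .
qed

lemma h1_measurable [measurable]: "h1 k \<in> borel_measurable (PiM {..<k} (\<lambda>_. lborel :: 'a::euclidean_space measure))"
proof -
  have "(\<lambda>z. (0 :: 'a, z)) \<in> measurable (PiM {..<k} (\<lambda>_. lborel)) (lborel \<Otimes>\<^sub>M PiM {..<k} (\<lambda>_. lborel))"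
    by measurable
  from measurable_compose[OF this measurable_critical_simplex_insert[of k 1]]
  have [measurable]: "Measurable.pred (PiM {..<k} (\<lambda>_. lborel)) (\<lambda>z :: nat \<Rightarrow> 'a. critical_simplex k 1 (insert 0 (z ` {..<k})))"
    by simp
  show ?thesis unfolding h1_eq[abs_def] by measurable
qed

text \<open>A simplex of circumradius at most 1 with a vertex at the origin has all its vertices in
  the ball of radius 2, so \<open>h1\<close> is dominated by the indicator of a product of such
  balls.\<close>

lemma h1_integrable: "integrable (PiM {..<k} (\<lambda>_. lborel :: 'a::euclidean_space measure)) (h1 k)"
proof (rule Bochner_Integration.integrable_bound)
  let ?P = "PiM {..<k} (\<lambda>_. lborel :: 'a measure)"
  let ?B = "Pi\<^sub>E {..<k} (\<lambda>_. cball (0 :: 'a) 2)"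
  have "?B \<in> sets ?P" by (intro sets_PiM_I_finite) auto
  moreover have "emeasure ?P ?B = (\<Prod>i<k. emeasure lborel (cball (0 :: 'a) 2))"
    by (intro lborel_product.emeasure_PiM) auto
  then have "emeasure ?P ?B < \<infinity>"
    using emeasure_lborel_cball_finite[of "0 :: 'a" 2] by (simp add: power_less_top_ennreal)
  ultimately show "integrable ?P (indicator ?B :: _ \<Rightarrow> real)" by (rule integrable_real_indicator)
  show "AE z in ?P. norm (h1 k z) \<le> norm (indicator ?B z :: real)"
  proof (rule AE_I2)
    fix z :: "nat \<Rightarrow> 'a" assume z: "z \<in> space ?P"
    have "z \<in> ?B" if "critical_simplex k 1 (insert 0 (z ` {..<k}))"
      using z critical_simplex_dist_le[OF that, of 0] by (auto simp: space_PiM PiE_iff)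
    then show "norm (h1 k z) \<le> norm (indicator ?B z :: real)" by (simp add: h1_eq)
  qed
qed simp

text \<open>The joint density of the k + 1 points x, x + r z_0, ..., x + r z_(k-1), integrated over
  the base point x. At r = 0 it is the integral of f^(k+1), the first factor of the limit
  constant.\<close>

definition shifted_product :: "('a::euclidean_space \<Rightarrow> real) \<Rightarrow> nat \<Rightarrow> real \<Rightarrow> (nat \<Rightarrow> 'a) \<Rightarrow> real" where
  "shifted_product f k r z = (\<integral>x. f x * (\<Prod>i<k. f (x + r *\<^sub>R z i)) \<partial>lborel)"

lemma h1_nonneg: "0 \<le> h1 k z"
  by (simp add: h1_eq)

locale bounded_density =
  fixes f :: "'a::euclidean_space \<Rightarrow> real" and F :: real
  assumes f_meas [measurable]: "f \<in> borel_measurable borel"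
    and f_nonneg: "\<And>x. 0 \<le> f x" and f_le: "\<And>x. f x \<le> F" and F_ge1: "1 \<le> F"
    and f_dens: "(\<integral>\<^sup>+ x. ennreal (f x) \<partial>lborel) = 1"
begin

abbreviation \<mu> :: "'a measure" where "\<mu> \<equiv> density lborel (\<lambda>x. ennreal (f x))"

lemma prob_\<mu>: "prob_space \<mu>"
  by (rule prob_spaceI) (simp add: emeasure_density f_dens cong: nn_integral_cong)

lemma integrable_f: "integrable lborel f"
  using f_dens f_nonneg by (intro integrableI_nonneg) auto

lemma measurable_shifted:
  "(\<lambda>(x, z). f x * (\<Prod>i<k. f (x + r *\<^sub>R z i))) \<in> borel_measurable (lborel \<Otimes>\<^sub>M PiM {..<k} (\<lambda>_. lborel))"
proof -
  have "(\<lambda>p. f (fst p + r *\<^sub>R snd p i)) \<in> borel_measurable (lborel \<Otimes>\<^sub>M PiM {..<k} (\<lambda>_. lborel))" if "i < k" for i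
  proof -
    have [measurable]: "(\<lambda>p. snd p i) \<in> measurable (lborel \<Otimes>\<^sub>M PiM {..<k} (\<lambda>_. lborel)) (borel :: 'a measure)"
      using measurable_compose[OF measurable_snd measurable_component_singleton[of i "{..<k}" "\<lambda>_. lborel :: 'a measure"]] that by simp
    show ?thesis by measurable
  qed
  then have "(\<lambda>p. \<Prod>i<k. f (fst p + r *\<^sub>R snd p i)) \<in> borel_measurable (lborel \<Otimes>\<^sub>M PiM {..<k} (\<lambda>_. lborel))"
    by (intro borel_measurable_prod) auto
  then show ?thesis by (simp add: case_prod_beta)
qed

lemma shifted_bounds:
  fixes k :: nat
  shows "0 \<le> (\<Prod>i<k. f (x + r *\<^sub>R z i))" "(\<Prod>i<k. f (x + r *\<^sub>R z i)) \<le> F ^ k"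
proof -
  show "0 \<le> (\<Prod>i<k. f (x + r *\<^sub>R z i))" by (intro prod_nonneg) (simp add: f_nonneg)
  have "(\<Prod>i<k. f (x + r *\<^sub>R z i)) \<le> (\<Prod>i<k. F)" by (intro prod_mono) (simp add: f_nonneg f_le)
  then show "(\<Prod>i<k. f (x + r *\<^sub>R z i)) \<le> F ^ k" by simp
qed

lemma integrable_shifted:
  fixes k :: nat
  shows "integrable lborel (\<lambda>x. f x * (\<Prod>i<k. f (x + r *\<^sub>R z i)))"
proof (rule Bochner_Integration.integrable_bound[OF integrable_mult_right[OF integrable_f, of "F ^ k"]])
  show "AE x in lborel. norm (f x * (\<Prod>i<k. f (x + r *\<^sub>R z i))) \<le> norm (F ^ k * f x)"
  proof (rule AE_I2)
    fix x
    have "f x * (\<Prod>i<k. f (x + r *\<^sub>R z i)) \<le> f x * F ^ k"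
      by (intro mult_left_mono shifted_bounds f_nonneg)
    then show "norm (f x * (\<Prod>i<k. f (x + r *\<^sub>R z i))) \<le> norm (F ^ k * f x)"
      using shifted_bounds(1)[where k=k and x=x and r=r and z=z] f_nonneg[of x] F_ge1 by (simp add: abs_mult mult.commute)
  qed
qed measurable

lemma shifted_product_bounds: "0 \<le> shifted_product f k r z" "shifted_product f k r z \<le> F ^ k"
proof -
  show "0 \<le> shifted_product f k r z"
    unfolding shifted_product_def by (intro Bochner_Integration.integral_nonneg mult_nonneg_nonneg f_nonneg shifted_bounds)
  have "shifted_product f k r z \<le> (\<integral>x. f x * F ^ k \<partial>lborel)"
    unfolding shifted_product_def
    by (intro integral_mono integrable_shifted integrable_mult_left integrable_f mult_left_mono shifted_bounds f_nonneg)
  also have "\<dots> = F ^ k"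
    using f_dens f_nonneg by (simp add: integral_eq_nn_integral)
  finally show "shifted_product f k r z \<le> F ^ k" .
qed

lemma shifted_product_measurable [measurable]:
  "shifted_product f k r \<in> borel_measurable (PiM {..<k} (\<lambda>_. lborel))"
proof -
  have "(\<lambda>(z, x). f x * (\<Prod>i<k. f (x + r *\<^sub>R z i))) \<in> borel_measurable (PiM {..<k} (\<lambda>_. lborel) \<Otimes>\<^sub>M lborel)"
    using measurable_compose[OF measurable_pair_swap' measurable_shifted[of k r]] by (simp add: case_prod_beta)
  then show ?thesis unfolding shifted_product_def[abs_def]
    by (intro lborel.borel_measurable_lebesgue_integral)
qed

lemma nn_integral_shifted: "(\<integral>\<^sup>+ x. ennreal (f x * (\<Prod>i<k. f (x + r *\<^sub>R z i))) \<partial>lborel) = ennreal (shifted_product f k r z)"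
  unfolding shifted_product_def
  by (intro nn_integral_eq_integral integrable_shifted AE_I2 mult_nonneg_nonneg f_nonneg shifted_bounds)

text \<open>Relative to one vertex x, the others are written as x + r z_i. Translation and scaling
  turn criticality at radius \<open>r\<close> into the condition of \<open>h1\<close> on z, the
  Jacobian gives r^(dk), and Tonelli moves the integral over x inside, where it becomes
  \<open>shifted_product\<close>.\<close>

lemma simplex_probability_nn:
  assumes r: "0 < r"
  shows "(\<integral>\<^sup>+ \<omega>. of_bool (critical_simplex k r (\<omega> ` {..<k + 1})) \<partial>PiM UNIV (\<lambda>_::nat. \<mu>)) =
    ennreal (r ^ (DIM('a) * k)) * (\<integral>\<^sup>+ z. ennreal (h1 k z * shifted_product f k r z) \<partial>PiM {..<k} (\<lambda>_. lborel))"
proof -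
  let ?L = "PiM {..<k} (\<lambda>_. lborel :: 'a measure)"
  let ?c = "\<lambda>x z. of_bool (critical_simplex k r (insert x (z ` {..<k}))) :: ennreal"
  interpret \<mu>: prob_space \<mu> by (rule prob_\<mu>)
  interpret product_prob_space "\<lambda>_ :: nat. \<mu>" UNIV by standard
  interpret pl: pair_sigma_finite lborel ?L
    by (intro pair_sigma_finite.intro lborel.sigma_finite_measure_axioms lborel_product.sigma_finite) simp
  have sets\<mu>: "sets (PiM J (\<lambda>_. \<mu>)) = sets (PiM J (\<lambda>_. borel))" for J :: "nat set"
    by (intro sets_PiM_cong) auto
  have cs_meas: "Measurable.pred (PiM UNIV (\<lambda>_. \<mu>)) (\<lambda>\<omega> :: nat \<Rightarrow> 'a. critical_simplex k r (\<omega> ` {..<Suc k}))"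
    using borel_critical_simplex[of "{..<Suc k}" k r]
    by (simp add: pred_def sets\<mu> sets_PiM_equal_borel space_PiM)
  \<comment> \<open>Padding with a fixed value embeds the finite product into the infinite one, so
    that measurability, known for sequences, passes to finite tuples.\<close>
  have e: "(\<lambda>y i. if i < Suc k then y i else undefined) \<in> measurable (PiM {..<Suc k} (\<lambda>_. \<mu>)) (PiM UNIV (\<lambda>_. \<mu>))"
  proof (rule measurable_PiM_single')
    show "(\<lambda>\<omega>. if i < Suc k then \<omega> i else undefined) \<in> measurable (PiM {..<Suc k} (\<lambda>_. \<mu>)) \<mu>" for i
      by (cases "i < Suc k") auto
  qed auto
  have [measurable]: "Measurable.pred (PiM {..<Suc k} (\<lambda>_. \<mu>)) (\<lambda>y. critical_simplex k r (y ` {..<Suc k}))"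
  proof -
    have "(\<lambda>y. critical_simplex k r ((\<lambda>i. if i < Suc k then y i else undefined) ` {..<Suc k}))
      = (\<lambda>y :: nat \<Rightarrow> 'a. critical_simplex k r (y ` {..<Suc k}))"
      by (intro ext arg_cong[where f="critical_simplex k r"] image_cong) auto
    then show ?thesis using measurable_compose[OF e cs_meas] by simp
  qed
  have [measurable]: "Measurable.pred ?L (\<lambda>z. critical_simplex k r (insert x (z ` {..<k})))" for x
    using measurable_compose[OF measurable_Pair1'[of x lborel ?L] measurable_critical_simplex_insert[of k r]] by simp
  have [measurable]: "(\<lambda>y. \<Prod>i<k. ennreal (f (y i))) \<in> borel_measurable ?L"
    by (intro borel_measurable_prod_ennreal) measurable
  have dens: "PiM {..<k} (\<lambda>_. \<mu>) = density ?L (\<lambda>y. \<Prod>i<k. ennreal (f (y i)))"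
    by (rule PiM_density_lborel[symmetric]) (auto intro: prob_\<mu>)
  have "(\<integral>\<^sup>+ \<omega>. of_bool (critical_simplex k r (\<omega> ` {..<k + 1})) \<partial>PiM UNIV (\<lambda>_::nat. \<mu>))
    = (\<integral>\<^sup>+ \<omega>. of_bool (critical_simplex k r ((restrict \<omega> {..<Suc k}) ` {..<Suc k})) \<partial>PiM UNIV (\<lambda>_::nat. \<mu>))"
    by (intro nn_integral_cong arg_cong[where f=of_bool] arg_cong[where f="critical_simplex k r"]) auto
  also have "\<dots> = (\<integral>\<^sup>+ y. of_bool (critical_simplex k r (y ` {..<Suc k})) \<partial>distr (PiM UNIV (\<lambda>_. \<mu>)) (PiM {..<Suc k} (\<lambda>_. \<mu>)) (\<lambda>\<omega>. restrict \<omega> {..<Suc k}))"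
    by (rule nn_integral_distr[symmetric]) measurable
  also have "\<dots> = (\<integral>\<^sup>+ y. of_bool (critical_simplex k r (y ` {..<Suc k})) \<partial>PiM (insert k {..<k}) (\<lambda>_. \<mu>))"
    by (subst distr_PiM_restrict_finite) (auto simp: lessThan_Suc)
  \<comment> \<open>The point with index \<open>k\<close> becomes the outermost variable x, the
    origin of the rescaled configuration.\<close>
  also have "\<dots> = (\<integral>\<^sup>+ x. (\<integral>\<^sup>+ y. of_bool (critical_simplex k r ((y(k := x)) ` {..<Suc k})) \<partial>PiM {..<k} (\<lambda>_. \<mu>)) \<partial>\<mu>)"
    by (rule product_nn_integral_insert_rev) (auto simp: lessThan_Suc[symmetric])
  also have "\<dots> = (\<integral>\<^sup>+ x. (\<integral>\<^sup>+ y. ?c x y \<partial>PiM {..<k} (\<lambda>_. \<mu>)) \<partial>\<mu>)"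
  proof -
    have "(y(k := x)) ` {..<Suc k} = insert x (y ` {..<k})" for x :: 'a and y
      by (auto simp: lessThan_Suc)
    then show ?thesis by simp
  qed
  also have "\<dots> = (\<integral>\<^sup>+ x. (\<integral>\<^sup>+ y. (\<Prod>i<k. ennreal (f (y i))) * ?c x y \<partial>?L) \<partial>\<mu>)"
    unfolding dens by (intro nn_integral_cong nn_integral_density) measurable
  also have "\<dots> = (\<integral>\<^sup>+ x. ennreal (r ^ (DIM('a) * k)) * (\<integral>\<^sup>+ z. ennreal (h1 k z * (\<Prod>i<k. f (x + r *\<^sub>R z i))) \<partial>?L) \<partial>\<mu>)"
  proof (intro nn_integral_cong)
    fix x
    have "(\<integral>\<^sup>+ y. (\<Prod>i<k. ennreal (f (y i))) * ?c x y \<partial>?L) = ennreal (r ^ (DIM('a) * card {..<k})) *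
       (\<integral>\<^sup>+ z. (\<Prod>i<k. ennreal (f ((\<lambda>i\<in>{..<k}. x + r *\<^sub>R z i) i))) * ?c x (\<lambda>i\<in>{..<k}. x + r *\<^sub>R z i) \<partial>?L)"
      by (rule nn_integral_PiM_lborel_affine) (use r in auto)
    also have "(\<integral>\<^sup>+ z. (\<Prod>i<k. ennreal (f ((\<lambda>i\<in>{..<k}. x + r *\<^sub>R z i) i))) * ?c x (\<lambda>i\<in>{..<k}. x + r *\<^sub>R z i) \<partial>?L)
      = (\<integral>\<^sup>+ z. ennreal (h1 k z * (\<Prod>i<k. f (x + r *\<^sub>R z i))) \<partial>?L)"
    proof (rule nn_integral_cong)
      fix z :: "nat \<Rightarrow> 'a"
      have "insert x ((\<lambda>i\<in>{..<k}. x + r *\<^sub>R z i) ` {..<k}) = (\<lambda>y. x + r *\<^sub>R y) ` insert 0 (z ` {..<k})"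
        by (auto simp: image_image)
      then have "?c x (\<lambda>i\<in>{..<k}. x + r *\<^sub>R z i) = ennreal (h1 k z)"
        using critical_simplex_affine_image[OF r, of k x "insert 0 (z ` {..<k})"] by (simp add: h1_eq of_bool_def)
      moreover have "(\<Prod>i<k. ennreal (f ((\<lambda>i\<in>{..<k}. x + r *\<^sub>R z i) i))) = ennreal (\<Prod>i<k. f (x + r *\<^sub>R z i))"
        by (simp add: prod_ennreal f_nonneg)
      ultimately show "(\<Prod>i<k. ennreal (f ((\<lambda>i\<in>{..<k}. x + r *\<^sub>R z i) i))) * ?c x (\<lambda>i\<in>{..<k}. x + r *\<^sub>R z i)
         = ennreal (h1 k z * (\<Prod>i<k. f (x + r *\<^sub>R z i)))"
        using shifted_bounds(1)[of x r z k] by (simp add: ennreal_mult h1_eq mult.commute)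
    qed
    finally show "(\<integral>\<^sup>+ y. (\<Prod>i<k. ennreal (f (y i))) * ?c x y \<partial>?L) =
      ennreal (r ^ (DIM('a) * k)) * (\<integral>\<^sup>+ z. ennreal (h1 k z * (\<Prod>i<k. f (x + r *\<^sub>R z i))) \<partial>?L)" by simp
  qed
  also have "\<dots> = ennreal (r ^ (DIM('a) * k)) * (\<integral>\<^sup>+ x. (\<integral>\<^sup>+ z. ennreal (h1 k z * (f x * (\<Prod>i<k. f (x + r *\<^sub>R z i)))) \<partial>?L) \<partial>lborel)"
    (is "?A = _")
  proof -
    have p: "(\<lambda>p. \<Prod>i<k. f (fst p + r *\<^sub>R snd p i)) \<in> borel_measurable (lborel \<Otimes>\<^sub>M ?L)"
    proof (intro borel_measurable_prod)
      fix i assume "i \<in> {..<k}"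
      then have [measurable]: "(\<lambda>p. snd p i) \<in> measurable (lborel \<Otimes>\<^sub>M ?L) (borel :: 'a measure)"
        using measurable_compose[OF measurable_snd measurable_component_singleton[of i "{..<k}" "\<lambda>_. lborel :: 'a measure"]] by simp
      show "(\<lambda>p. f (fst p + r *\<^sub>R snd p i)) \<in> borel_measurable (lborel \<Otimes>\<^sub>M ?L)" by measurable
    qed
    have ms: "(\<lambda>(x, z). ennreal (h1 k z * (\<Prod>i<k. f (x + r *\<^sub>R z i)))) \<in> borel_measurable (lborel \<Otimes>\<^sub>M ?L)"
      using p by (simp add: case_prod_beta)
    have [measurable]: "(\<lambda>x. \<integral>\<^sup>+ z. ennreal (h1 k z * (\<Prod>i<k. f (x + r *\<^sub>R z i))) \<partial>?L) \<in> borel_measurable lborel"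
      using pl.M2.borel_measurable_nn_integral_fst[OF ms] by simp
    have [measurable]: "(\<lambda>z. ennreal (h1 k z * (\<Prod>i<k. f (x + r *\<^sub>R z i)))) \<in> borel_measurable ?L" for x
      using measurable_compose[OF measurable_Pair1'[of x lborel ?L] ms] by simp
    have "?A = (\<integral>\<^sup>+ x. ennreal (r ^ (DIM('a) * k)) * (ennreal (f x) * (\<integral>\<^sup>+ z. ennreal (h1 k z * (\<Prod>i<k. f (x + r *\<^sub>R z i))) \<partial>?L)) \<partial>lborel)"
      by (subst nn_integral_density) (auto simp: mult_ac)
    also have "\<dots> = ennreal (r ^ (DIM('a) * k)) * (\<integral>\<^sup>+ x. ennreal (f x) * (\<integral>\<^sup>+ z. ennreal (h1 k z * (\<Prod>i<k. f (x + r *\<^sub>R z i))) \<partial>?L) \<partial>lborel)"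
      by (rule nn_integral_cmult) measurable
    also have "(\<integral>\<^sup>+ x. ennreal (f x) * (\<integral>\<^sup>+ z. ennreal (h1 k z * (\<Prod>i<k. f (x + r *\<^sub>R z i))) \<partial>?L) \<partial>lborel)
      = (\<integral>\<^sup>+ x. (\<integral>\<^sup>+ z. ennreal (h1 k z * (f x * (\<Prod>i<k. f (x + r *\<^sub>R z i)))) \<partial>?L) \<partial>lborel)"
      by (intro nn_integral_cong)
         (simp add: nn_integral_cmult[symmetric] ennreal_mult'[symmetric] f_nonneg mult_ac)
    finally show ?thesis .
  qed
  also have "(\<integral>\<^sup>+ x. (\<integral>\<^sup>+ z. ennreal (h1 k z * (f x * (\<Prod>i<k. f (x + r *\<^sub>R z i)))) \<partial>?L) \<partial>lborel)
    = (\<integral>\<^sup>+ z. (\<integral>\<^sup>+ x. ennreal (h1 k z * (f x * (\<Prod>i<k. f (x + r *\<^sub>R z i)))) \<partial>lborel) \<partial>?L)"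
  proof (rule pl.Fubini'[symmetric])
    show "(\<lambda>(x, z). ennreal (h1 k z * (f x * (\<Prod>i<k. f (x + r *\<^sub>R z i))))) \<in> borel_measurable (lborel \<Otimes>\<^sub>M ?L)"
      using measurable_shifted[of k r] by (simp add: case_prod_beta)
  qed
  also have "\<dots> = (\<integral>\<^sup>+ z. ennreal (h1 k z * shifted_product f k r z) \<partial>?L)"
  proof (rule nn_integral_cong)
    fix z :: "nat \<Rightarrow> 'a"
    have h0: "0 \<le> h1 k z" by (rule h1_nonneg)
    have "(\<integral>\<^sup>+ x. ennreal (h1 k z * (f x * (\<Prod>i<k. f (x + r *\<^sub>R z i)))) \<partial>lborel)
      = (\<integral>\<^sup>+ x. ennreal (h1 k z) * ennreal (f x * (\<Prod>i<k. f (x + r *\<^sub>R z i))) \<partial>lborel)"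
      using h0 by (simp add: ennreal_mult')
    also have "\<dots> = ennreal (h1 k z) * ennreal (shifted_product f k r z)"
      by (subst nn_integral_cmult) (auto simp: nn_integral_shifted)
    also have "\<dots> = ennreal (h1 k z * shifted_product f k r z)" using h0 by (simp add: ennreal_mult')
    finally show "(\<integral>\<^sup>+ x. ennreal (h1 k z * (f x * (\<Prod>i<k. f (x + r *\<^sub>R z i)))) \<partial>lborel) = ennreal (h1 k z * shifted_product f k r z)" .
  qed
  finally show ?thesis .
qed

lemma simplex_probability:
  assumes r: "0 < r"
  shows "(\<integral>\<omega>. of_bool (critical_simplex k r (\<omega> ` {..<k + 1})) \<partial>PiM UNIV (\<lambda>_::nat. \<mu>)) / r ^ (DIM('a) * k) =
    (\<integral>z. h1 k z * shifted_product f k r z \<partial>PiM {..<k} (\<lambda>_. lborel))"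
proof -
  have sets\<mu>: "sets (PiM J (\<lambda>_. \<mu>)) = sets (PiM J (\<lambda>_. borel))" for J :: "nat set"
    by (intro sets_PiM_cong) auto
  have [measurable]: "Measurable.pred (PiM UNIV (\<lambda>_. \<mu>)) (\<lambda>\<omega> :: nat \<Rightarrow> 'a. critical_simplex k r (\<omega> ` {..<Suc k}))"
    using borel_critical_simplex[of "{..<Suc k}" k r]
    by (simp add: pred_def sets\<mu> sets_PiM_equal_borel space_PiM)
  have "(\<integral>\<omega>. of_bool (critical_simplex k r (\<omega> ` {..<k + 1})) \<partial>PiM UNIV (\<lambda>_::nat. \<mu>))
    = enn2real (\<integral>\<^sup>+ \<omega>. of_bool (critical_simplex k r (\<omega> ` {..<k + 1})) \<partial>PiM UNIV (\<lambda>_::nat. \<mu>))"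
    by (subst integral_eq_nn_integral) (auto intro!: arg_cong[where f=enn2real] nn_integral_cong)
  also have "\<dots> = r ^ (DIM('a) * k) * enn2real (\<integral>\<^sup>+ z. ennreal (h1 k z * shifted_product f k r z) \<partial>PiM {..<k} (\<lambda>_. lborel))"
    unfolding simplex_probability_nn[OF r] using r by (simp add: enn2real_mult)
  also have "enn2real (\<integral>\<^sup>+ z. ennreal (h1 k z * shifted_product f k r z) \<partial>PiM {..<k} (\<lambda>_. lborel))
    = (\<integral>z. h1 k z * shifted_product f k r z \<partial>PiM {..<k} (\<lambda>_. lborel))"
    by (subst integral_eq_nn_integral) (auto simp: h1_nonneg shifted_product_bounds)
  finally show ?thesis using r by simp
qed

text \<open>The difference to the value at r = 0 is an integral of a difference of products, bounded
  by a constant times the sum of the L^1 distances between \<open>f\<close> and its translates by r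
  z_i; each of these tends to zero.\<close>

lemma shifted_product_limit:
  assumes r: "r \<longlonglongrightarrow> 0"
  shows "(\<lambda>n. shifted_product f k (r n) z) \<longlonglongrightarrow> (\<integral>x. f x ^ (k + 1) \<partial>lborel)"
proof -
  have p: "(\<integral>x. f x ^ (k + 1) \<partial>lborel) = shifted_product f k 0 z"
    unfolding shifted_product_def by simp
  have bnd: "norm (shifted_product f k (r n) z - shifted_product f k 0 z) \<le>
      F * F ^ k * (\<Sum>i<k. \<integral>x. \<bar>f (x + r n *\<^sub>R z i) - f x\<bar> \<partial>lborel)" for n
  proof -
    have i1: "integrable lborel (\<lambda>x. \<bar>f (x + r n *\<^sub>R z i) - f x\<bar>)" for i
      by (intro integrable_abs Bochner_Integration.integrable_diff integral_lborel_translate(2) integrable_f f_meas)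
    have "\<bar>shifted_product f k (r n) z - shifted_product f k 0 z\<bar>
      = \<bar>\<integral>x. f x * (\<Prod>i<k. f (x + r n *\<^sub>R z i)) - f x * (\<Prod>i<k. f (x + 0 *\<^sub>R z i)) \<partial>lborel\<bar>"
      unfolding shifted_product_def by (subst Bochner_Integration.integral_diff[OF integrable_shifted integrable_shifted]) simp
    also have "\<dots> \<le> (\<integral>x. \<bar>f x * (\<Prod>i<k. f (x + r n *\<^sub>R z i)) - f x * (\<Prod>i<k. f (x + 0 *\<^sub>R z i))\<bar> \<partial>lborel)"
      by (rule integral_abs_bound)
    also have "\<dots> \<le> (\<integral>x. F * F ^ k * (\<Sum>i<k. \<bar>f (x + r n *\<^sub>R z i) - f x\<bar>) \<partial>lborel)"
    proof (rule integral_mono)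
      show "integrable lborel (\<lambda>x. \<bar>f x * (\<Prod>i<k. f (x + r n *\<^sub>R z i)) - f x * (\<Prod>i<k. f (x + 0 *\<^sub>R z i))\<bar>)"
        by (intro integrable_abs Bochner_Integration.integrable_diff integrable_shifted)
      show "integrable lborel (\<lambda>x. F * F ^ k * (\<Sum>i<k. \<bar>f (x + r n *\<^sub>R z i) - f x\<bar>))"
        by (intro integrable_mult_right Bochner_Integration.integrable_sum i1)
      fix x
      have "\<bar>(\<Prod>i<k. f (x + r n *\<^sub>R z i)) - (\<Prod>i<k. f (x + 0 *\<^sub>R z i))\<bar> \<le> F ^ card {..<k} * (\<Sum>i<k. \<bar>f (x + r n *\<^sub>R z i) - f (x + 0 *\<^sub>R z i)\<bar>)"
        by (rule abs_prod_diff_le[OF F_ge1]) (simp_all add: f_nonneg f_le)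
      then have "\<bar>f x\<bar> * \<bar>(\<Prod>i<k. f (x + r n *\<^sub>R z i)) - (\<Prod>i<k. f (x + 0 *\<^sub>R z i))\<bar> \<le> F * (F ^ k * (\<Sum>i<k. \<bar>f (x + r n *\<^sub>R z i) - f x\<bar>))"
        using f_le[of x] f_nonneg[of x] F_ge1 by (intro mult_mono) auto
      then show "\<bar>f x * (\<Prod>i<k. f (x + r n *\<^sub>R z i)) - f x * (\<Prod>i<k. f (x + 0 *\<^sub>R z i))\<bar> \<le> F * F ^ k * (\<Sum>i<k. \<bar>f (x + r n *\<^sub>R z i) - f x\<bar>)"
        unfolding right_diff_distrib[symmetric] abs_mult by (simp only: mult.assoc)
    qed
    also have "\<dots> = F * F ^ k * (\<Sum>i<k. \<integral>x. \<bar>f (x + r n *\<^sub>R z i) - f x\<bar> \<partial>lborel)"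
      by (simp add: Bochner_Integration.integral_sum i1)
    finally show ?thesis by simp
  qed
  have "(\<lambda>n. F * F ^ k * (\<Sum>i<k. \<integral>x. \<bar>f (x + r n *\<^sub>R z i) - f x\<bar> \<partial>lborel)) \<longlonglongrightarrow> F * F ^ k * (\<Sum>i<k. 0)"
  proof (intro tendsto_mult tendsto_const tendsto_sum)
    fix i
    have "(\<lambda>n. r n *\<^sub>R z i) \<longlonglongrightarrow> 0 *\<^sub>R z i" by (intro tendsto_intros r)
    then show "(\<lambda>n. \<integral>x. \<bar>f (x + r n *\<^sub>R z i) - f x\<bar> \<partial>lborel) \<longlonglongrightarrow> 0"
      by (intro L1_translation_continuous[OF f_meas f_nonneg f_le integrable_f]) simp
  qed
  then have b0: "(\<lambda>n. F * F ^ k * (\<Sum>i<k. \<integral>x. \<bar>f (x + r n *\<^sub>R z i) - f x\<bar> \<partial>lborel)) \<longlonglongrightarrow> 0" by simp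
  have "(\<lambda>n. shifted_product f k (r n) z - shifted_product f k 0 z) \<longlonglongrightarrow> 0"
    by (rule Lim_null_comparison[OF always_eventually b0]) (use bnd in blast)
  then show ?thesis unfolding p by (rule LIM_zero_cancel)
qed

text \<open>Dominated convergence over the shapes z, with \<open>h1\<close> times
  \<open>F ^ k\<close> as dominating function.\<close>

lemma simplex_probability_limit:
  assumes r: "r \<longlonglongrightarrow> 0" "\<And>n. 0 < r n"
  shows "(\<lambda>n. (\<integral>\<omega>. of_bool (critical_simplex k (r n) (\<omega> ` {..<k + 1})) \<partial>PiM UNIV (\<lambda>_::nat. \<mu>)) / r n ^ (DIM('a) * k))
    \<longlonglongrightarrow> (\<integral>x. f x ^ (k + 1) \<partial>lborel) * (\<integral>z. h1 k z \<partial>PiM {..<k} (\<lambda>_. lborel :: 'a measure))"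
proof -
  let ?L = "PiM {..<k} (\<lambda>_. lborel :: 'a measure)" and ?c = "\<integral>x. f x ^ (k + 1) \<partial>lborel"
  have "(\<lambda>n. \<integral>z. h1 k z * shifted_product f k (r n) z \<partial>?L) \<longlonglongrightarrow> (\<integral>z. h1 k z * ?c \<partial>?L)"
  proof (rule integral_dominated_convergence[where w="\<lambda>z. h1 k z * F ^ k"])
    show "integrable ?L (\<lambda>z. h1 k z * F ^ k)" by (intro integrable_mult_left h1_integrable)
    show "AE z in ?L. (\<lambda>n. h1 k z * shifted_product f k (r n) z) \<longlonglongrightarrow> h1 k z * ?c"
      by (intro AE_I2 tendsto_mult tendsto_const shifted_product_limit r)
    show "AE z in ?L. norm (h1 k z * shifted_product f k (r n) z) \<le> h1 k z * F ^ k" for n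
      using shifted_product_bounds[of k "r n"] by (intro AE_I2) (auto simp: h1_eq abs_mult)
  qed measurable
  then show ?thesis unfolding simplex_probability[OF r(2)] by (simp add: mult.commute)
qed

end

subsection \<open>The Efron-Stein inequality for i.i.d. sequences\<close>

definition depends_on :: "(('i \<Rightarrow> 'b) \<Rightarrow> 'c) \<Rightarrow> 'i set \<Rightarrow> bool" where
  "depends_on \<phi> J \<longleftrightarrow> (\<forall>\<omega> \<omega>'. (\<forall>i\<in>J. \<omega> i = \<omega>' i) \<longrightarrow> \<phi> \<omega> = \<phi> \<omega>')"

lemma depends_onD: "depends_on \<phi> J \<Longrightarrow> (\<And>i. i \<in> J \<Longrightarrow> \<omega> i = \<omega>' i) \<Longrightarrow> \<phi> \<omega> = \<phi> \<omega>'"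
  by (auto simp: depends_on_def)

locale iid_sequence = product_prob_space "\<lambda>_::nat. M" UNIV for M :: "'b measure" +
  assumes space_M [simp]: "space M = UNIV"
begin

abbreviation P :: "(nat \<Rightarrow> 'b) measure" where "P \<equiv> Pi\<^sub>M UNIV (\<lambda>_. M)"

lemma space_P [simp]: "space P = UNIV"
  by (simp add: space_PiM)

lemma measurable_reindex [measurable]: "(\<lambda>\<omega>. \<omega> \<circ> g) \<in> measurable P P"
  unfolding comp_def by (rule measurable_PiM_single') auto

lemma distr_reindex:
  assumes "inj g"
  shows "distr P P (\<lambda>\<omega>. \<omega> \<circ> g) = P"
proof -
  have "distr P (Pi\<^sub>M UNIV (\<lambda>i. M)) (\<lambda>\<omega>. \<lambda>n\<in>UNIV. \<omega> (g n)) = P"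
    using assms by (intro distr_PiM_reindex M.prob_space_axioms) auto
  then show ?thesis by (simp add: comp_def restrict_def)
qed

lemma expectation_reindex:
  fixes \<phi> :: "(nat \<Rightarrow> 'b) \<Rightarrow> real"
  assumes "inj g" and [measurable]: "\<phi> \<in> borel_measurable P"
  shows "(\<integral>\<omega>. \<phi> (\<omega> \<circ> g) \<partial>P) = (\<integral>\<omega>. \<phi> \<omega> \<partial>P)"
proof -
  have "(\<integral>\<omega>. \<phi> \<omega> \<partial>P) = (\<integral>\<omega>. \<phi> \<omega> \<partial>distr P P (\<lambda>\<omega>. \<omega> \<circ> g))" using distr_reindex[OF assms(1)] by simp
  also have "\<dots> = (\<integral>\<omega>. \<phi> (\<omega> \<circ> g) \<partial>P)" by (rule integral_distr) auto
  finally show ?thesis by simp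
qed

lemma integrable_bounded:
  fixes \<phi> :: "(nat \<Rightarrow> 'b) \<Rightarrow> real"
  assumes "\<phi> \<in> borel_measurable P" "\<And>\<omega>. \<bar>\<phi> \<omega>\<bar> \<le> C"
  shows "integrable P \<phi>"
  using assms by (intro P.integrable_const_bound[of _ C]) auto

text \<open>Each function factors through the restriction of the sequence to its own index set,
  padded by a fixed value, and restrictions to disjoint index sets are independent.\<close>

lemma expectation_mult_disjoint:
  fixes \<phi> \<psi> :: "(nat \<Rightarrow> 'b) \<Rightarrow> real"
  assumes IJ: "I \<inter> J = {}"
    and [measurable]: "\<phi> \<in> borel_measurable P" "\<psi> \<in> borel_measurable P"
    and dep: "depends_on \<phi> I" "depends_on \<psi> J"
    and bdd: "\<And>\<omega>. \<bar>\<phi> \<omega>\<bar> \<le> C" "\<And>\<omega>. \<bar>\<psi> \<omega>\<bar> \<le> C"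
  shows "(\<integral>\<omega>. \<phi> \<omega> * \<psi> \<omega> \<partial>P) = (\<integral>\<omega>. \<phi> \<omega> \<partial>P) * (\<integral>\<omega>. \<psi> \<omega> \<partial>P)"
proof -
  have "P.indep_vars (\<lambda>_. M) (\<lambda>i \<omega>. \<omega> i) UNIV"
  proof (subst P.indep_vars_iff_distr_eq_PiM)
    show "distr P (Pi\<^sub>M UNIV (\<lambda>i. M)) (\<lambda>x. \<lambda>i\<in>UNIV. x i) = (\<Pi>\<^sub>M i\<in>UNIV. distr P M (\<lambda>\<omega>. \<omega> i))"
      by (simp add: distr_PiM_component[of UNIV "\<lambda>_. M", OF M.prob_space_axioms UNIV_I] restrict_def)
  qed auto
  then have ind: "P.indep_var (PiM I (\<lambda>_. M)) (\<lambda>\<omega>. restrict (\<lambda>i. \<omega> i) I) (PiM J (\<lambda>_. M)) (\<lambda>\<omega>. restrict (\<lambda>i. \<omega> i) J)"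
    using IJ by (intro P.indep_var_restrict) auto
  have e: "(\<lambda>x i. if i \<in> K then x i else undefined) \<in> measurable (PiM K (\<lambda>_. M)) P" for K
  proof (rule measurable_PiM_single')
    show "(\<lambda>x. if i \<in> K then x i else undefined) \<in> measurable (PiM K (\<lambda>_. M)) M" for i
      by (cases "i \<in> K") auto
  qed auto
  have "P.indep_var borel ((\<lambda>x. \<phi> (\<lambda>i. if i \<in> I then x i else undefined)) \<circ> (\<lambda>\<omega>. restrict (\<lambda>i. \<omega> i) I))
     borel ((\<lambda>x. \<psi> (\<lambda>i. if i \<in> J then x i else undefined)) \<circ> (\<lambda>\<omega>. restrict (\<lambda>i. \<omega> i) J))"
    by (rule P.indep_var_compose[OF ind]) (rule measurable_compose[OF e], measurable)+
  also have "(\<lambda>x. \<phi> (\<lambda>i. if i \<in> I then x i else undefined)) \<circ> (\<lambda>\<omega>. restrict (\<lambda>i. \<omega> i) I) = \<phi>"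
    unfolding comp_def by (intro ext depends_onD[OF dep(1)]) auto
  also have "(\<lambda>x. \<psi> (\<lambda>i. if i \<in> J then x i else undefined)) \<circ> (\<lambda>\<omega>. restrict (\<lambda>i. \<omega> i) J) = \<psi>"
    unfolding comp_def by (intro ext depends_onD[OF dep(2)]) auto
  finally have "P.indep_var borel \<phi> borel \<psi>" .
  then show ?thesis
    by (intro P.indep_var_lebesgue_integral integrable_bounded[of _ C]) (auto intro: bdd)
qed

text \<open>The coordinates \<open>m + i\<close>, \<open>i < m\<close>, serve as the independent copy of the first \<open>m\<close>
  coordinates; resampling a set of coordinates is then a permutation of the index set.\<close>

definition exch :: "nat \<Rightarrow> nat set \<Rightarrow> nat \<Rightarrow> nat" where
  "exch m A i = (if i < m \<and> i \<in> A then i + m else if m \<le> i \<and> i < 2 * m \<and> i - m \<in> A then i - m else i)"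

lemma exch_exch: "exch m A (exch m A i) = i"
  by (auto simp: exch_def)

lemma inj_exch: "inj (exch m A)"
  by (metis exch_exch injI)

lemma exch_comp: "A \<inter> B = {} \<Longrightarrow> exch m A \<circ> exch m B = exch m (A \<union> B)"
  by (rule ext) (auto simp: exch_def)

lemma exch_step:
  "exch m {j} \<circ> exch m {..<j} = exch m {..<Suc j}"
  "exch m {j} \<circ> exch m {..<Suc j} = exch m {..<j}"
  "exch m {..<j} \<circ> exch m {j} = exch m {..<Suc j}"
proof -
  show *: "exch m {j} \<circ> exch m {..<j} = exch m {..<Suc j}"
    by (subst exch_comp) (auto simp: lessThan_Suc)
  show "exch m {j} \<circ> exch m {..<Suc j} = exch m {..<j}"
    unfolding *[symmetric] by (rule ext) (simp add: exch_exch)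
  show "exch m {..<j} \<circ> exch m {j} = exch m {..<Suc j}"
    by (subst exch_comp) (auto simp: lessThan_Suc)
qed

lemma exch_empty: "exch m {} = id"
  by (rule ext) (auto simp: exch_def)

text \<open>\<open>V j\<close> is \<open>T\<close> with its first \<open>j\<close> coordinates
  resampled. \<open>V m\<close> is independent of \<open>T\<close> with the same mean, so the
  variance is the mean of T V_0 - T V_m and telescopes into the terms T W with W = V_j - V_(j+1).
  Symmetry under exchanging coordinate \<open>j\<close> with its copy gives 2 E[T W] = E[(T - S) W],
  and both factors on the right have the same second moment, so the elementary bound ab <= (a^2 +
  b^2) / 2 finishes.\<close>

lemma efron_stein:
  fixes T :: "(nat \<Rightarrow> 'b) \<Rightarrow> real"
  assumes [measurable]: "T \<in> borel_measurable P"
    and dep: "depends_on T {..<m}"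
    and bdd: "\<And>\<omega>. \<bar>T \<omega>\<bar> \<le> C"
  shows "P.variance T \<le> (\<Sum>j<m. (\<integral>\<omega>. (T \<omega> - T (\<omega> \<circ> exch m {j}))\<^sup>2 \<partial>P)) / 2"
proof -
  define V where "V j \<omega> = T (\<omega> \<circ> exch m {..<j})" for j \<omega>
  have [measurable]: "V j \<in> borel_measurable P" for j unfolding V_def by measurable
  have bV: "\<bar>V j \<omega>\<bar> \<le> C" for j \<omega> unfolding V_def by (rule bdd)
  have C0: "0 \<le> C" using bdd[of undefined] by linarith
  have bb: "\<bar>a * b\<bar> \<le> C * C'" if "\<bar>a\<bar> \<le> C" "\<bar>b\<bar> \<le> C'" for a b C'
    unfolding abs_mult using that C0 by (intro mult_mono) auto
  have int: "integrable P (\<lambda>\<omega>. T \<omega> * V j \<omega>)" for j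
    by (rule integrable_bounded[of _ "C * C"]) (auto intro!: bb bdd bV)
  have V0: "V 0 = T" by (simp add: V_def exch_empty fun_eq_iff)
  have int2: "integrable P T" by (rule integrable_bounded[of _ C]) (auto intro: bdd)
  have "(\<integral>\<omega>. T \<omega> * V m \<omega> \<partial>P) = (\<integral>\<omega>. T \<omega> \<partial>P) * (\<integral>\<omega>. V m \<omega> \<partial>P)"
  proof (rule expectation_mult_disjoint[where I="{..<m}" and J="{m..<2*m}" and C=C])
    show "depends_on (V m) {m..<2 * m}"
      unfolding depends_on_def V_def
      by (intro allI impI depends_onD[OF dep]) (auto simp: exch_def)
  qed (auto simp: dep bdd bV)
  also have "(\<integral>\<omega>. V m \<omega> \<partial>P) = (\<integral>\<omega>. T \<omega> \<partial>P)"
    unfolding V_def by (rule expectation_reindex) (auto simp: inj_exch)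
  finally have TV: "(\<integral>\<omega>. T \<omega> * V m \<omega> \<partial>P) = (\<integral>\<omega>. T \<omega> \<partial>P)\<^sup>2" by (simp add: power2_eq_square)
  have "P.variance T = (\<integral>\<omega>. (T \<omega>)\<^sup>2 \<partial>P) - (\<integral>\<omega>. T \<omega> \<partial>P)\<^sup>2"
    using int[of 0] int2 by (intro P.variance_eq) (auto simp: V0 power2_eq_square)
  also have "\<dots> = (\<integral>\<omega>. T \<omega> * V 0 \<omega> \<partial>P) - (\<integral>\<omega>. T \<omega> * V m \<omega> \<partial>P)"
    by (simp add: TV V0 power2_eq_square)
  also have "\<dots> = (\<Sum>j<m. (\<integral>\<omega>. T \<omega> * V j \<omega> \<partial>P) - (\<integral>\<omega>. T \<omega> * V (Suc j) \<omega> \<partial>P))"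
    by (rule sum_lessThan_telescope'[symmetric])
  also have "\<dots> \<le> (\<Sum>j<m. (\<integral>\<omega>. (T \<omega> - T (\<omega> \<circ> exch m {j}))\<^sup>2 \<partial>P) / 2)"
  proof (rule sum_mono)
    fix j
    define S where "S \<omega> = T (\<omega> \<circ> exch m {j})" for \<omega>
    define W where "W \<omega> = V j \<omega> - V (Suc j) \<omega>" for \<omega>
    have [measurable]: "S \<in> borel_measurable P" "W \<in> borel_measurable P"
      unfolding S_def W_def by measurable
    have bS: "\<bar>S \<omega>\<bar> \<le> C" for \<omega> unfolding S_def by (rule bdd)
    have bW: "\<bar>W \<omega>\<bar> \<le> 2 * C" for \<omega> unfolding W_def using bV[of j \<omega>] bV[of "Suc j" \<omega>] by linarith
    have bTS: "\<bar>T \<omega> - S \<omega>\<bar> \<le> 2 * C" for \<omega> using bdd[of \<omega>] bS[of \<omega>] by linarith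
    have bb2: "\<bar>a * b\<bar> \<le> 2 * C * (2 * C)" if "\<bar>a\<bar> \<le> 2 * C" "\<bar>b\<bar> \<le> 2 * C" for a b
      unfolding abs_mult using that C0 by (intro mult_mono) auto
    have iTW: "integrable P (\<lambda>\<omega>. T \<omega> * W \<omega>)" "integrable P (\<lambda>\<omega>. S \<omega> * W \<omega>)"
      by (rule integrable_bounded[of _ "C * (2 * C)"]; (intro bb bdd bS bW)?; measurable)+
    have isq: "integrable P (\<lambda>\<omega>. (T \<omega> - S \<omega>)\<^sup>2)" "integrable P (\<lambda>\<omega>. (W \<omega>)\<^sup>2)"
      unfolding power2_eq_square
      by (rule integrable_bounded[of _ "2 * C * (2 * C)"]; (intro bb2 bTS bW)?; measurable)+
    \<comment> \<open>Exchanging coordinate \<open>j\<close> with its copy swaps \<open>V j\<close>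
      and \<open>V (Suc j)\<close>, so \<open>W\<close> changes sign, while \<open>S\<close> turns
      into \<open>T\<close>.\<close>
    have "(\<integral>\<omega>. S \<omega> * W \<omega> \<partial>P) = (\<integral>\<omega>. - (T (\<omega> \<circ> exch m {j}) * W (\<omega> \<circ> exch m {j})) \<partial>P)"
      by (intro Bochner_Integration.integral_cong refl)
         (simp add: S_def W_def V_def comp_assoc exch_step algebra_simps)
    also have "\<dots> = (\<integral>\<omega>. - (T \<omega> * W \<omega>) \<partial>P)"
      by (rule expectation_reindex[where \<phi>="\<lambda>\<omega>. - (T \<omega> * W \<omega>)"]) (auto simp: inj_exch)
    finally have SW: "(\<integral>\<omega>. S \<omega> * W \<omega> \<partial>P) = - (\<integral>\<omega>. T \<omega> * W \<omega> \<partial>P)" by simp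
    \<comment> \<open>\<open>W\<close> is T - S evaluated at the sequence with the first
      \<open>j\<close> coordinates exchanged, hence has the same second moment as T - S.\<close>
    have "(\<integral>\<omega>. (W \<omega>)\<^sup>2 \<partial>P) = (\<integral>\<omega>. (T (\<omega> \<circ> exch m {..<j}) - S (\<omega> \<circ> exch m {..<j}))\<^sup>2 \<partial>P)"
      by (intro Bochner_Integration.integral_cong refl)
         (simp add: S_def W_def V_def comp_assoc exch_step)
    also have "\<dots> = (\<integral>\<omega>. (T \<omega> - S \<omega>)\<^sup>2 \<partial>P)"
      by (rule expectation_reindex[where \<phi>="\<lambda>\<omega>. (T \<omega> - S \<omega>)\<^sup>2"]) (auto simp: inj_exch)
    finally have WW: "(\<integral>\<omega>. (W \<omega>)\<^sup>2 \<partial>P) = (\<integral>\<omega>. (T \<omega> - S \<omega>)\<^sup>2 \<partial>P)" .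
    have "2 * (\<integral>\<omega>. T \<omega> * W \<omega> \<partial>P) = (\<integral>\<omega>. T \<omega> * W \<omega> - S \<omega> * W \<omega> \<partial>P)"
      using iTW SW by simp
    also have "\<dots> \<le> (\<integral>\<omega>. ((T \<omega> - S \<omega>)\<^sup>2 + (W \<omega>)\<^sup>2) / 2 \<partial>P)"
    proof (rule integral_mono)
      fix \<omega>
      show "T \<omega> * W \<omega> - S \<omega> * W \<omega> \<le> ((T \<omega> - S \<omega>)\<^sup>2 + (W \<omega>)\<^sup>2) / 2"
        using sum_squares_bound[of "T \<omega> - S \<omega>" "W \<omega>"] by (simp add: algebra_simps)
    qed (use iTW isq in auto)
    also have "\<dots> = (\<integral>\<omega>. (T \<omega> - S \<omega>)\<^sup>2 \<partial>P)"
      using isq WW by simp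
    finally have "2 * (\<integral>\<omega>. T \<omega> * W \<omega> \<partial>P) \<le> (\<integral>\<omega>. (T \<omega> - S \<omega>)\<^sup>2 \<partial>P)" .
    moreover have "(\<integral>\<omega>. T \<omega> * W \<omega> \<partial>P) = (\<integral>\<omega>. T \<omega> * V j \<omega> \<partial>P) - (\<integral>\<omega>. T \<omega> * V (Suc j) \<omega> \<partial>P)"
      using int by (simp add: W_def right_diff_distrib)
    ultimately show "(\<integral>\<omega>. T \<omega> * V j \<omega> \<partial>P) - (\<integral>\<omega>. T \<omega> * V (Suc j) \<omega> \<partial>P)
        \<le> (\<integral>\<omega>. (T \<omega> - T (\<omega> \<circ> exch m {j}))\<^sup>2 \<partial>P) / 2"
      by (simp add: S_def)
  qed
  finally show ?thesis by (simp add: sum_divide_distrib)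
qed

text \<open>\<open>R j\<close> does not see coordinate \<open>j\<close>, so it is unchanged by the
  resampling and may be inserted between \<open>T\<close> and its resampled version. The inequality
  (a-b)^2 <= 2(a-c)^2 + 2(b-c)^2 yields two terms of equal mean: a factor 4, halved by
  Efron-Stein.\<close>

lemma efron_stein_leave_one_out:
  fixes T :: "(nat \<Rightarrow> 'b) \<Rightarrow> real" and R :: "nat \<Rightarrow> (nat \<Rightarrow> 'b) \<Rightarrow> real"
  assumes [measurable]: "T \<in> borel_measurable P" "\<And>j. R j \<in> borel_measurable P"
    and dep: "depends_on T {..<m}" "\<And>j. depends_on (R j) ({..<m} - {j})"
    and bdd: "\<And>\<omega>. \<bar>T \<omega>\<bar> \<le> C" "\<And>j \<omega>. \<bar>R j \<omega>\<bar> \<le> C"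
  shows "P.variance T \<le> 2 * (\<Sum>j<m. (\<integral>\<omega>. (T \<omega> - R j \<omega>)\<^sup>2 \<partial>P))"
proof -
  have "(\<integral>\<omega>. (T \<omega> - T (\<omega> \<circ> exch m {j}))\<^sup>2 \<partial>P) \<le> 4 * (\<integral>\<omega>. (T \<omega> - R j \<omega>)\<^sup>2 \<partial>P)" if "j < m" for j
  proof -
    let ?D = "\<lambda>\<omega>. (T \<omega> - R j \<omega>)\<^sup>2" and ?s = "\<lambda>\<omega>. \<omega> \<circ> exch m {j}"
    have "\<bar>T \<omega> - R j \<omega>\<bar> \<le> 2 * C" for \<omega> using bdd(1)[of \<omega>] bdd(2)[of j \<omega>] by linarith
    then have "\<bar>?D \<omega>\<bar> \<le> (2 * C)\<^sup>2" for \<omega> 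
      using power_mono[OF _ abs_ge_zero, of "T \<omega> - R j \<omega>" "2 * C" 2] by simp
    then have int: "integrable P ?D" "integrable P (\<lambda>\<omega>. ?D (?s \<omega>))"
      by (intro integrable_bounded[of _ "(2 * C)\<^sup>2"]; measurable)+
    have R: "R j (?s \<omega>) = R j \<omega>" for \<omega>
      by (rule depends_onD[OF dep(2)]) (auto simp: exch_def)
    have "(\<integral>\<omega>. (T \<omega> - T (?s \<omega>))\<^sup>2 \<partial>P) \<le> (\<integral>\<omega>. 2 * ?D \<omega> + 2 * ?D (?s \<omega>) \<partial>P)"
    proof (rule integral_mono_AE')
      show "AE \<omega> in P. (T \<omega> - T (?s \<omega>))\<^sup>2 \<le> 2 * ?D \<omega> + 2 * ?D (?s \<omega>)"
      proof (rule AE_I2)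
        fix \<omega>
        have "(a - b)\<^sup>2 \<le> 2 * (a - c)\<^sup>2 + 2 * (b - c)\<^sup>2" for a b c :: real
          using zero_le_power2[of "a + b - 2 * c"] by (simp add: power2_eq_square algebra_simps)
        then show "(T \<omega> - T (?s \<omega>))\<^sup>2 \<le> 2 * ?D \<omega> + 2 * ?D (?s \<omega>)" by (simp add: R)
      qed
    qed (use int in auto)
    also have "\<dots> = 2 * (\<integral>\<omega>. ?D \<omega> \<partial>P) + 2 * (\<integral>\<omega>. ?D (?s \<omega>) \<partial>P)"
      using int by simp
    also have "(\<integral>\<omega>. ?D (?s \<omega>) \<partial>P) = (\<integral>\<omega>. ?D \<omega> \<partial>P)"
      by (rule expectation_reindex) (auto simp: inj_exch)
    finally show ?thesis by (simp add: comp_def)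
  qed
  then have "(\<Sum>j<m. (\<integral>\<omega>. (T \<omega> - T (\<omega> \<circ> exch m {j}))\<^sup>2 \<partial>P)) \<le> (\<Sum>j<m. 4 * (\<integral>\<omega>. (T \<omega> - R j \<omega>)\<^sup>2 \<partial>P))"
    by (intro sum_mono) auto
  then show ?thesis
    using efron_stein[OF assms(1) dep(1) bdd(1)] by (simp add: sum_distrib_left[symmetric])
qed

end

subsection \<open>Clusters and U-statistics\<close>

definition ksubsets :: "nat \<Rightarrow> 'i set \<Rightarrow> 'i set set" where
  "ksubsets p L = {I. I \<subseteq> L \<and> card I = p}"

lemma finite_ksubsets [simp]: "finite L \<Longrightarrow> finite (ksubsets p L)"
  by (simp add: ksubsets_def)

lemma card_ksubsets: "finite L \<Longrightarrow> card (ksubsets p L) = card L choose p"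
  unfolding ksubsets_def by (rule n_subsets)

lemma ksubsetsD: "I \<in> ksubsets p L \<Longrightarrow> I \<subseteq> L" "I \<in> ksubsets p L \<Longrightarrow> card I = p"
  by (auto simp: ksubsets_def)

lemma finite_ksubset: "finite L \<Longrightarrow> I \<in> ksubsets p L \<Longrightarrow> finite I"
  by (auto simp: ksubsets_def intro: finite_subset)

definition cover_pairs :: "nat \<Rightarrow> 'i set \<Rightarrow> ('i set \<times> 'i set) set" where
  "cover_pairs p U = {(I, J). I \<union> J = U \<and> card I = p \<and> card J = p}"

lemma cover_pairs_subset: "cover_pairs p U \<subseteq> Pow U \<times> Pow U"
  by (auto simp: cover_pairs_def)

lemma card_cover_pairs_le: "finite U \<Longrightarrow> card (cover_pairs p U) \<le> 4 ^ card U"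
proof -
  assume U: "finite U"
  have "card (cover_pairs p U) \<le> card (Pow U \<times> Pow U)"
    using U by (intro card_mono cover_pairs_subset) auto
  also have "\<dots> = 4 ^ card U"
    using U by (simp add: card_Pow card_cartesian_product flip: power_mult_distrib)
  finally show ?thesis .
qed

text \<open>The union of two \<open>p\<close>-subsets has between p and 2p elements. Grouping by the
  union organises second moments by the number of points involved, which is what determines the
  order of magnitude of a term.\<close>

lemma sum_pairs_by_union:
  fixes f :: "'i set \<Rightarrow> 'i set \<Rightarrow> 'c::comm_monoid_add"
  assumes L: "finite L" and p: "0 < p"
  shows "(\<Sum>I\<in>ksubsets p L. \<Sum>J\<in>ksubsets p L. f I J) =
    (\<Sum>s\<in>{p..2*p}. \<Sum>U\<in>ksubsets s L. \<Sum>(I, J)\<in>cover_pairs p U. f I J)"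
proof -
  let ?Us = "{U. U \<subseteq> L \<and> card U \<in> {p..2*p}}"
  have fU: "finite ?Us" using L by auto
  have cU: "card (I \<union> J) \<in> {p..2*p}" if "I \<in> ksubsets p L" "J \<in> ksubsets p L" for I J
  proof -
    have "finite I" "finite J" using that L finite_ksubset by auto
    then have "card I \<le> card (I \<union> J)" by (intro card_mono) auto
    moreover have "card (I \<union> J) \<le> card I + card J" by (rule card_Un_le)
    ultimately show ?thesis using that by (auto simp: ksubsets_def)
  qed
  have "(\<Sum>I\<in>ksubsets p L. \<Sum>J\<in>ksubsets p L. f I J) = (\<Sum>(I, J)\<in>ksubsets p L \<times> ksubsets p L. f I J)"
    by (simp add: sum.cartesian_product)
  also have "\<dots> = (\<Sum>U\<in>?Us. \<Sum>(I, J)\<in>{x \<in> ksubsets p L \<times> ksubsets p L. (case x of (I, J) \<Rightarrow> I \<union> J) = U}. f I J)"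
  proof (rule sum.group[symmetric])
    show "(\<lambda>(I, J). I \<union> J) ` (ksubsets p L \<times> ksubsets p L) \<subseteq> ?Us"
      using cU by (auto dest: ksubsetsD)
  qed (use L fU in auto)
  also have "\<dots> = (\<Sum>U\<in>?Us. \<Sum>(I, J)\<in>cover_pairs p U. f I J)"
    by (intro sum.cong refl) (auto simp: cover_pairs_def ksubsets_def)
  also have "\<dots> = (\<Sum>s\<in>{p..2*p}. \<Sum>U\<in>{U \<in> ?Us. card U = s}. \<Sum>(I, J)\<in>cover_pairs p U. f I J)"
    using fU by (intro sum.group[symmetric]) auto
  also have "\<dots> = (\<Sum>s\<in>{p..2*p}. \<Sum>U\<in>ksubsets s L. \<Sum>(I, J)\<in>cover_pairs p U. f I J)"
    by (intro sum.cong refl) (auto simp: ksubsets_def)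
  finally show ?thesis .
qed

lemma choose_le_power: "n choose s \<le> n ^ s"
  by (cases "s \<le> n") (auto simp: binomial_le_pow binomial_eq_0)

text \<open>A bijection from \<open>U\<close> to \<open>V\<close> is extended to all naturals by a
  shift beyond the maximum of \<open>V\<close> outside \<open>U\<close>. Global injectivity is
  needed because \<open>expectation_reindex\<close> relabels the entire sequence.\<close>

lemma ex_inj_image_eq:
  fixes U V :: "nat set"
  assumes "finite U" "finite V" "card U = card V"
  shows "\<exists>g :: nat \<Rightarrow> nat. inj g \<and> g ` U = V"
proof -
  obtain h where h: "bij_betw h U V" using assms finite_same_card_bij by blast
  define g where "g i = (if i \<in> U then h i else i + Suc (Max (insert 0 V)))" for i
  have le: "h i < i' + Suc (Max (insert 0 V))" if "i \<in> U" for i i'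
  proof -
    have "h i \<le> Max (insert 0 V)"
      using h that assms by (intro Max_ge) (auto simp: bij_betw_def)
    then show ?thesis by linarith
  qed
  have "inj g"
  proof (rule injI)
    fix x y assume eq: "g x = g y"
    have "x \<in> U \<longleftrightarrow> y \<in> U"
      using eq le[of x y] le[of y x] by (simp add: g_def split: if_splits)
    then show "x = y"
      using eq h by (simp add: g_def bij_betw_def inj_on_def split: if_splits)
  qed
  moreover have "g ` U = V" using h by (auto simp: g_def bij_betw_def)
  ultimately show ?thesis by blast
qed

text \<open>The abstract setting: \<open>H\<close> stands for being a critical simplex,
  \<open>G\<close> for enclosing a point, \<open>near\<close> for distance at most 2r, and \<beta>
  bounds the mass of a ball of that radius. \<open>G\<close> is required to be measurable only
  jointly with \<open>H\<close>, which is all that the geometry provides.\<close>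

locale local_count = iid_sequence M for M :: "'b measure" +
  fixes H :: "'b set \<Rightarrow> bool" and G :: "'b set \<Rightarrow> 'b \<Rightarrow> bool"
    and near :: "'b \<Rightarrow> 'b \<Rightarrow> bool" and k :: nat and \<beta> :: real
  assumes meas_H: "finite I \<Longrightarrow> card I = k + 1 \<Longrightarrow> Measurable.pred P (\<lambda>\<omega>. H (\<omega> ` I))"
    and meas_HG: "finite I \<Longrightarrow> card I = k + 1 \<Longrightarrow> Measurable.pred P (\<lambda>\<omega>. H (\<omega> ` I) \<and> G (\<omega> ` I) (\<omega> j))"
    and meas_near [measurable]: "Measurable.pred (M \<Otimes>\<^sub>M M) (\<lambda>(x, y). near x y)"
    and near_H: "H Y \<Longrightarrow> x \<in> Y \<Longrightarrow> y \<in> Y \<Longrightarrow> near x y"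
    and near_G: "H Y \<Longrightarrow> G Y p \<Longrightarrow> y \<in> Y \<Longrightarrow> near p y \<and> near y p"
    and near_prob: "measure M {y. near x y} \<le> \<beta>"
begin

lemma \<beta>_nonneg: "0 \<le> \<beta>"
  using near_prob[of undefined] measure_nonneg[of M] order_trans by blast

text \<open>A star around the point \<open>i\<close>, with no proximity required among the points of
  \<open>B\<close>: given the centre, the conditions are then independent, and stars about a common
  centre multiply to a star.\<close>

definition cluster :: "nat \<Rightarrow> nat set \<Rightarrow> (nat \<Rightarrow> 'b) \<Rightarrow> real" where
  "cluster i B \<omega> = of_bool (\<forall>j\<in>B. near (\<omega> i) (\<omega> j))"

definition U_stat :: "nat set \<Rightarrow> (nat \<Rightarrow> 'b) \<Rightarrow> real" where
  "U_stat L \<omega> = (\<Sum>I\<in>ksubsets (k + 1) L. of_bool (H (\<omega> ` I)))"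

definition blocked :: "nat set \<Rightarrow> (nat \<Rightarrow> 'b) \<Rightarrow> real" where
  "blocked L \<omega> = (\<Sum>I\<in>ksubsets (k + 1) L. of_bool (H (\<omega> ` I) \<and> (\<exists>j\<in>L - I. G (\<omega> ` I) (\<omega> j))))"

definition q :: real where
  "q = (\<integral>\<omega>. of_bool (H (\<omega> ` {..<k + 1})) \<partial>P)"

lemma meas_coord_near [measurable]: "Measurable.pred P (\<lambda>\<omega>. near (\<omega> i) (\<omega> j))"
proof -
  have "Measurable.pred P (\<lambda>\<omega>. (\<lambda>(x, y). near x y) (\<omega> i, \<omega> j))" by measurable
  then show ?thesis by simp
qed

lemma meas_cluster [measurable]: "finite B \<Longrightarrow> cluster i B \<in> borel_measurable P"
  unfolding cluster_def by measurable

lemma cluster_bounds: "0 \<le> cluster i B \<omega>" "cluster i B \<omega> \<le> 1" "\<bar>cluster i B \<omega>\<bar> \<le> 1"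
  by (auto simp: cluster_def)

lemma cluster_mult: "cluster i B \<omega> * cluster i B' \<omega> = cluster i (B \<union> B') \<omega>"
  by (auto simp: cluster_def)

text \<open>Given the centre, the points indexed by \<open>B\<close> are independent and each is
  near it with probability at most \<beta>.\<close>

lemma expectation_cluster_le:
  assumes B: "finite B" "i \<notin> B"
  shows "(\<integral>\<omega>. cluster i B \<omega> \<partial>P) \<le> \<beta> ^ card B"
proof -
  let ?f = "\<lambda>\<omega>. \<Prod>j\<in>B. (of_bool (near (\<omega> i) (\<omega> j)) :: ennreal)"
  have [measurable]: "?f \<in> borel_measurable (PiM (insert i B) (\<lambda>_. M))"
    using B(1) by (intro borel_measurable_prod_ennreal) measurable
  have one: "(\<integral>\<^sup>+ z. of_bool (near y z) \<partial>M) \<le> ennreal \<beta>" for y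
  proof -
    have "(\<integral>\<^sup>+ z. of_bool (near y z) \<partial>M) = (\<integral>\<^sup>+ z. indicator {z. near y z} z \<partial>M)"
      by (intro nn_integral_cong) (simp add: indicator_def)
    also have "\<dots> = emeasure M {z. near y z}"
    proof (rule nn_integral_indicator)
      have "Measurable.pred M (\<lambda>z. (\<lambda>(x, y). near x y) (y, z))" by measurable
      then show "{z. near y z} \<in> sets M" by (simp add: pred_def)
    qed
    also have "\<dots> \<le> ennreal \<beta>"
      using near_prob[of y] \<beta>_nonneg by (simp add: M.emeasure_eq_measure)
    finally show ?thesis .
  qed
  have prod: "?f \<omega> = of_bool (\<forall>j\<in>B. near (\<omega> i) (\<omega> j))" for \<omega>
    using B(1) by (induction B) auto
  have "(\<integral>\<^sup>+ \<omega>. ennreal (cluster i B \<omega>) \<partial>P) = (\<integral>\<^sup>+ \<omega>. ?f (restrict \<omega> (insert i B)) \<partial>P)"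
    unfolding prod by (intro nn_integral_cong) (simp add: cluster_def)
  also have "\<dots> = (\<integral>\<^sup>+ \<omega>. ?f \<omega> \<partial>distr P (PiM (insert i B) (\<lambda>_. M)) (\<lambda>\<omega>. restrict \<omega> (insert i B)))"
    by (rule nn_integral_distr[symmetric]) measurable
  also have "\<dots> = (\<integral>\<^sup>+ \<omega>. ?f \<omega> \<partial>PiM (insert i B) (\<lambda>_. M))"
    using B by (subst distr_PiM_restrict_finite) auto
  also have "\<dots> = (\<integral>\<^sup>+ y. (\<integral>\<^sup>+ x. ?f (x(i := y)) \<partial>PiM B (\<lambda>_. M)) \<partial>M)"
    using B by (intro product_nn_integral_insert_rev) auto
  also have "\<dots> = (\<integral>\<^sup>+ y. (\<integral>\<^sup>+ x. (\<Prod>j\<in>B. of_bool (near y (x j))) \<partial>PiM B (\<lambda>_. M)) \<partial>M)"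
    using B by (intro nn_integral_cong prod.cong) auto
  also have "\<dots> = (\<integral>\<^sup>+ y. (\<Prod>j\<in>B. \<integral>\<^sup>+ z. of_bool (near y z) \<partial>M) \<partial>M)"
    using B by (intro nn_integral_cong product_nn_integral_prod) auto
  also have "\<dots> \<le> (\<integral>\<^sup>+ y. (\<Prod>j\<in>B. ennreal \<beta>) \<partial>M)"
    by (intro nn_integral_mono prod_mono_ennreal one)
  also have "\<dots> = ennreal (\<beta> ^ card B)"
    using \<beta>_nonneg M.emeasure_space_1 by (simp add: ennreal_power)
  finally have "(\<integral>\<^sup>+ \<omega>. ennreal (cluster i B \<omega>) \<partial>P) \<le> ennreal (\<beta> ^ card B)" .
  moreover have "(\<integral>\<^sup>+ \<omega>. ennreal (cluster i B \<omega>) \<partial>P) = ennreal (\<integral>\<omega>. cluster i B \<omega> \<partial>P)"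
    using B by (intro nn_integral_eq_integral integrable_bounded[of _ 1]) (auto simp: cluster_bounds)
  ultimately show ?thesis using \<beta>_nonneg by (simp add: ennreal_le_iff)
qed

text \<open>The product of two clusters around \<open>i\<close> is the cluster of the union. A union
  of size s arises from at most 4^s pairs of subsets, there are at most m^s such unions, and each
  contributes at most \<beta>^s.\<close>

lemma expectation_cluster_sum_sq_le:
  assumes L: "finite L" "i \<notin> L" "card L \<le> m" and p: "0 < p"
  shows "(\<integral>\<omega>. (\<Sum>B\<in>ksubsets p L. cluster i B \<omega>)\<^sup>2 \<partial>P) \<le> (\<Sum>s\<in>{p..2*p}. (4 * real m * \<beta>) ^ s)"
proof -
  have fin: "finite B" if "B \<in> ksubsets s L" for B s using that L finite_ksubset by blast
  have int: "integrable P (cluster i B)" if "finite B" for B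
    using that by (intro integrable_bounded[of _ 1]) (auto simp: cluster_bounds)
  have "(\<integral>\<omega>. (\<Sum>B\<in>ksubsets p L. cluster i B \<omega>)\<^sup>2 \<partial>P)
      = (\<integral>\<omega>. (\<Sum>B\<in>ksubsets p L. \<Sum>B'\<in>ksubsets p L. cluster i (B \<union> B') \<omega>) \<partial>P)"
    by (simp add: power2_eq_square sum_product cluster_mult)
  also have "\<dots> = (\<Sum>B\<in>ksubsets p L. \<Sum>B'\<in>ksubsets p L. \<integral>\<omega>. cluster i (B \<union> B') \<omega> \<partial>P)"
    using fin by (simp add: Bochner_Integration.integral_sum int)
  also have "\<dots> \<le> (\<Sum>B\<in>ksubsets p L. \<Sum>B'\<in>ksubsets p L. \<beta> ^ card (B \<union> B'))"
    using fin L by (intro sum_mono expectation_cluster_le) (auto dest: ksubsetsD)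
  also have "\<dots> = (\<Sum>s\<in>{p..2*p}. \<Sum>U\<in>ksubsets s L. \<Sum>(I, J)\<in>cover_pairs p U. \<beta> ^ card (I \<union> J))"
    by (rule sum_pairs_by_union[OF L(1) p])
  also have "\<dots> = (\<Sum>s\<in>{p..2*p}. \<Sum>U\<in>ksubsets s L. real (card (cover_pairs p U)) * \<beta> ^ s)"
  proof (intro sum.cong refl)
    fix s U assume "U \<in> ksubsets s L"
    then have "(\<Sum>(I, J)\<in>cover_pairs p U. \<beta> ^ card (I \<union> J)) = (\<Sum>(I, J)\<in>cover_pairs p U. \<beta> ^ s)"
      by (intro sum.cong refl) (auto simp: cover_pairs_def ksubsets_def)
    then show "(\<Sum>(I, J)\<in>cover_pairs p U. \<beta> ^ card (I \<union> J)) = real (card (cover_pairs p U)) * \<beta> ^ s"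
      by (simp add: case_prod_beta)
  qed
  also have "\<dots> \<le> (\<Sum>s\<in>{p..2*p}. \<Sum>U\<in>ksubsets s L. 4 ^ s * \<beta> ^ s)"
  proof (intro sum_mono mult_right_mono)
    fix s U assume "U \<in> ksubsets s L"
    then have "card (cover_pairs p U) \<le> 4 ^ s"
      using card_cover_pairs_le[OF fin, of U s p] by (simp add: ksubsets_def)
    then show "real (card (cover_pairs p U)) \<le> 4 ^ s"
      by (metis of_nat_le_iff of_nat_numeral of_nat_power)
  qed (simp add: \<beta>_nonneg)
  also have "\<dots> = (\<Sum>s\<in>{p..2*p}. real (card L choose s) * (4 * \<beta>) ^ s)"
    using L by (simp add: card_ksubsets power_mult_distrib)
  also have "\<dots> \<le> (\<Sum>s\<in>{p..2*p}. real m ^ s * (4 * \<beta>) ^ s)"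
  proof (intro sum_mono mult_right_mono)
    fix s
    have "card L choose s \<le> m ^ s"
      using choose_le_power[of "card L" s] power_mono[OF L(3), of s] by simp
    then show "real (card L choose s) \<le> real m ^ s"
      by (metis of_nat_le_iff of_nat_power)
  qed (simp add: \<beta>_nonneg)
  also have "\<dots> = (\<Sum>s\<in>{p..2*p}. (4 * real m * \<beta>) ^ s)"
    by (simp add: power_mult_distrib mult_ac)
  finally show ?thesis .
qed

lemma expectation_cluster_sum_le:
  assumes L: "finite L" "i \<notin> L"
  shows "(\<integral>\<omega>. (\<Sum>B\<in>ksubsets p L. cluster i B \<omega>) \<partial>P) \<le> (real (card L) * \<beta>) ^ p"
proof -
  have fin: "finite B" if "B \<in> ksubsets s L" for B s using that L finite_ksubset by blast
  have int: "integrable P (cluster i B)" if "finite B" for B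
    using that by (intro integrable_bounded[of _ 1]) (auto simp: cluster_bounds)
  have "(\<integral>\<omega>. (\<Sum>B\<in>ksubsets p L. cluster i B \<omega>) \<partial>P) = (\<Sum>B\<in>ksubsets p L. \<integral>\<omega>. cluster i B \<omega> \<partial>P)"
    using fin by (intro Bochner_Integration.integral_sum int) auto
  also have "\<dots> \<le> (\<Sum>B\<in>ksubsets p L. \<beta> ^ p)"
  proof (rule sum_mono)
    fix B assume B: "B \<in> ksubsets p L"
    then have "i \<notin> B" "card B = p" using L by (auto simp: ksubsets_def)
    then show "(\<integral>\<omega>. cluster i B \<omega> \<partial>P) \<le> \<beta> ^ p"
      using expectation_cluster_le[OF fin[OF B], of i] by simp
  qed
  also have "\<dots> = real (card L choose p) * \<beta> ^ p" using L by (simp add: card_ksubsets)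
  also have "\<dots> \<le> real (card L) ^ p * \<beta> ^ p"
    using choose_le_power[of "card L" p] \<beta>_nonneg
    by (intro mult_right_mono) (auto simp flip: of_nat_power)
  finally show ?thesis by (simp add: power_mult_distrib)
qed

end

lemma cover_pairs_image:
  assumes g: "inj g"
  shows "cover_pairs p (g ` U) = (\<lambda>(I, J). (g ` I, g ` J)) ` cover_pairs p U"
proof (intro equalityI subsetI)
  fix x assume "x \<in> cover_pairs p (g ` U)"
  then obtain I J where x: "x = (I, J)" "I \<union> J = g ` U" "card I = p" "card J = p"
    by (auto simp: cover_pairs_def)
  then have "I = g ` (g -` I)" "J = g ` (g -` J)" by auto
  moreover have "g -` I \<union> g -` J = U" using x(2) g by (auto simp: inj_def)
  moreover have "card (g -` I) = p" "card (g -` J) = p"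
    using x calculation g by (metis card_image inj_on_subset subset_UNIV)+
  ultimately show "x \<in> (\<lambda>(I, J). (g ` I, g ` J)) ` cover_pairs p U"
    using x by (intro image_eqI[of _ _ "(g -` I, g -` J)"]) (auto simp: cover_pairs_def)
next
  fix x assume "x \<in> (\<lambda>(I, J). (g ` I, g ` J)) ` cover_pairs p U"
  then show "x \<in> cover_pairs p (g ` U)"
    using g by (auto simp: cover_pairs_def card_image inj_on_def inj_def)
qed

section \<open>The first two moments of the U-statistic\<close>

context local_count
begin

definition simp_ind :: "nat set \<Rightarrow> (nat \<Rightarrow> 'b) \<Rightarrow> real" where
  "simp_ind I \<omega> = of_bool (H (\<omega> ` I))"

lemma simp_ind_bounds: "0 \<le> simp_ind I \<omega>" "simp_ind I \<omega> \<le> 1" "\<bar>simp_ind I \<omega>\<bar> \<le> 1"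
  by (auto simp: simp_ind_def)

lemma simp_ind_idem: "simp_ind I \<omega> * simp_ind I \<omega> = simp_ind I \<omega>"
  by (simp add: simp_ind_def)

lemma meas_simp_ind: "card I = k + 1 \<Longrightarrow> simp_ind I \<in> borel_measurable P"
proof -
  assume I: "card I = k + 1"
  then have "finite I" by (intro card_ge_0_finite) simp
  note [measurable] = meas_H[OF this I]
  show ?thesis unfolding simp_ind_def by measurable
qed

lemma simp_ind_image: "simp_ind (g ` I) \<omega> = simp_ind I (\<omega> \<circ> g)"
  by (simp add: simp_ind_def image_comp)

lemma simp_ind_depends: "depends_on (simp_ind I) I"
  unfolding depends_on_def simp_ind_def by (metis (mono_tags) image_cong)

lemma expectation_simp_ind:
  assumes "card I = k + 1"
  shows "(\<integral>\<omega>. simp_ind I \<omega> \<partial>P) = q"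
proof -
  have "finite I" using assms by (intro card_ge_0_finite) simp
  then obtain g :: "nat \<Rightarrow> nat" where g: "inj g" "g ` {..<k + 1} = I"
    using ex_inj_image_eq[of "{..<k + 1}" I] assms by auto
  have "(\<integral>\<omega>. simp_ind I \<omega> \<partial>P) = (\<integral>\<omega>. simp_ind {..<k + 1} (\<omega> \<circ> g) \<partial>P)"
    by (simp only: g(2)[symmetric] simp_ind_image)
  also have "\<dots> = (\<integral>\<omega>. simp_ind {..<k + 1} \<omega> \<partial>P)"
    by (rule expectation_reindex[OF g(1)]) (rule meas_simp_ind, simp)
  finally show ?thesis by (simp add: q_def simp_ind_def)
qed

text \<open>A common vertex is near all other vertices of both simplices.\<close>

lemma simp_ind_mult_le_cluster:
  assumes "i \<in> I" "i \<in> J"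
  shows "simp_ind I \<omega> * simp_ind J \<omega> \<le> cluster i (I \<union> J - {i}) \<omega>"
  using assms near_H unfolding simp_ind_def cluster_def by (auto simp: of_bool_def)

lemma q_nonneg: "0 \<le> q"
  unfolding q_def by (rule Bochner_Integration.integral_nonneg) auto

lemma q_le: "q \<le> \<beta> ^ k"
proof -
  let ?I = "{..<k + 1}"
  have "q = (\<integral>\<omega>. simp_ind ?I \<omega> \<partial>P)" by (simp add: q_def simp_ind_def)
  also have "\<dots> \<le> (\<integral>\<omega>. cluster 0 (?I - {0}) \<omega> \<partial>P)"
  proof (rule integral_mono)
    show "integrable P (simp_ind ?I)"
      by (rule integrable_bounded[of _ 1]) (auto intro: meas_simp_ind simp_ind_bounds)
    show "integrable P (cluster 0 (?I - {0}))"
      by (rule integrable_bounded[of _ 1]) (auto intro: cluster_bounds)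
    show "simp_ind ?I \<omega> \<le> cluster 0 (?I - {0}) \<omega>" for \<omega>
      using simp_ind_mult_le_cluster[of 0 ?I ?I \<omega>] by (simp add: simp_ind_idem)
  qed
  also have "\<dots> \<le> \<beta> ^ card (?I - {0})" by (rule expectation_cluster_le) auto
  finally show ?thesis by simp
qed

lemma U_stat_eq: "U_stat L \<omega> = (\<Sum>I\<in>ksubsets (k + 1) L. simp_ind I \<omega>)"
  by (simp add: U_stat_def simp_ind_def)

lemma meas_U_stat [measurable]: "U_stat L \<in> borel_measurable P"
  unfolding U_stat_eq by (intro borel_measurable_sum meas_simp_ind) (simp add: ksubsets_def)

lemma U_stat_bounds: "0 \<le> U_stat L \<omega>" "finite L \<Longrightarrow> U_stat L \<omega> \<le> real (card L) ^ (k + 1)"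
proof -
  show "0 \<le> U_stat L \<omega>" unfolding U_stat_def by (rule sum_nonneg) auto
  assume L: "finite L"
  have "U_stat L \<omega> \<le> (\<Sum>I\<in>ksubsets (k + 1) L. 1)"
    unfolding U_stat_def by (rule sum_mono) auto
  also have "\<dots> = real (card L choose (k + 1))" using L by (simp add: card_ksubsets)
  also have "\<dots> \<le> real (card L) ^ (k + 1)"
    by (metis choose_le_power of_nat_le_iff of_nat_power)
  finally show "U_stat L \<omega> \<le> real (card L) ^ (k + 1)" .
qed

lemma expectation_U_stat:
  assumes "finite L"
  shows "(\<integral>\<omega>. U_stat L \<omega> \<partial>P) = real (card L choose (k + 1)) * q"
proof -
  have "(\<integral>\<omega>. U_stat L \<omega> \<partial>P) = (\<Sum>I\<in>ksubsets (k + 1) L. (\<integral>\<omega>. simp_ind I \<omega> \<partial>P))"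
    unfolding U_stat_eq
    by (intro Bochner_Integration.integral_sum integrable_bounded[of _ 1])
       (auto intro: meas_simp_ind simp_ind_bounds simp: ksubsets_def)
  also have "\<dots> = (\<Sum>I\<in>ksubsets (k + 1) L. q)"
    by (intro sum.cong refl expectation_simp_ind) (simp add: ksubsets_def)
  finally show ?thesis using assms by (simp add: card_ksubsets)
qed

definition pair_sum :: "nat set \<Rightarrow> (nat \<Rightarrow> 'b) \<Rightarrow> real" where
  "pair_sum U \<omega> = (\<Sum>(I, J)\<in>cover_pairs (k + 1) U. simp_ind I \<omega> * simp_ind J \<omega>)"

text \<open>By exchangeability the mean of \<open>pair_sum\<close> depends only on the size of the
  index set, so an initial segment represents all sets of size \<open>s\<close>; see
  \<open>expectation_pair_sum\<close>.\<close>

definition pair_mean :: "nat \<Rightarrow> real" where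
  "pair_mean s = (\<integral>\<omega>. pair_sum {..<s} \<omega> \<partial>P)"

lemma meas_simp_ind_pair:
  "(I, J) \<in> cover_pairs (k + 1) U \<Longrightarrow> (\<lambda>\<omega>. simp_ind I \<omega> * simp_ind J \<omega>) \<in> borel_measurable P"
  by (intro borel_measurable_times meas_simp_ind) (auto simp: cover_pairs_def)

lemma meas_pair_sum [measurable]: "pair_sum U \<in> borel_measurable P"
proof -
  have "(\<lambda>\<omega>. case x of (I, J) \<Rightarrow> simp_ind I \<omega> * simp_ind J \<omega>) \<in> borel_measurable P"
    if "x \<in> cover_pairs (k + 1) U" for x
    using that meas_simp_ind_pair by (cases x) auto
  then show ?thesis unfolding pair_sum_def by (rule borel_measurable_sum)
qed

lemma integrable_simp_ind_pair:
  "(I, J) \<in> cover_pairs (k + 1) U \<Longrightarrow> integrable P (\<lambda>\<omega>. simp_ind I \<omega> * simp_ind J \<omega>)"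
  by (rule integrable_bounded[of _ 1], erule meas_simp_ind_pair) (simp add: simp_ind_def)

lemma expectation_pair_sum_sum:
  "(\<integral>\<omega>. pair_sum U \<omega> \<partial>P) =
    (\<Sum>(I, J)\<in>cover_pairs (k + 1) U. \<integral>\<omega>. simp_ind I \<omega> * simp_ind J \<omega> \<partial>P)"
proof -
  have "(\<integral>\<omega>. pair_sum U \<omega> \<partial>P) = (\<Sum>x\<in>cover_pairs (k + 1) U. \<integral>\<omega>. simp_ind (fst x) \<omega> * simp_ind (snd x) \<omega> \<partial>P)"
    unfolding pair_sum_def case_prod_beta
    by (rule Bochner_Integration.integral_sum) (rule integrable_simp_ind_pair, simp)
  then show ?thesis by (simp add: case_prod_beta)
qed

lemma integrable_pair_sum: "integrable P (pair_sum U)"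
proof -
  have "integrable P (\<lambda>\<omega>. \<Sum>x\<in>cover_pairs (k + 1) U. simp_ind (fst x) \<omega> * simp_ind (snd x) \<omega>)"
    by (rule Bochner_Integration.integrable_sum) (rule integrable_simp_ind_pair, simp)
  then show ?thesis by (simp add: pair_sum_def[abs_def] case_prod_beta)
qed

lemma pair_sum_image:
  assumes "inj g"
  shows "pair_sum (g ` U) \<omega> = pair_sum U (\<omega> \<circ> g)"
proof -
  have "inj_on (\<lambda>(I, J). (g ` I, g ` J)) (cover_pairs (k + 1) U)"
    using assms by (auto simp: inj_on_def inj_image_eq_iff)
  then show ?thesis
    unfolding pair_sum_def cover_pairs_image[OF assms]
    by (subst sum.reindex) (auto simp: simp_ind_image case_prod_beta intro!: sum.cong)
qed

lemma expectation_pair_sum: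
  assumes "finite U"
  shows "(\<integral>\<omega>. pair_sum U \<omega> \<partial>P) = pair_mean (card U)"
proof -
  obtain g :: "nat \<Rightarrow> nat" where g: "inj g" "g ` {..<card U} = U"
    using ex_inj_image_eq[of "{..<card U}" U] assms by auto
  have "(\<integral>\<omega>. pair_sum U \<omega> \<partial>P) = (\<integral>\<omega>. pair_sum {..<card U} (\<omega> \<circ> g) \<partial>P)"
    using pair_sum_image[OF g(1), of "{..<card U}"] by (simp only: g(2))
  also have "\<dots> = pair_mean (card U)"
    unfolding pair_mean_def by (rule expectation_reindex[OF g(1)]) measurable
  finally show ?thesis .
qed

lemma expectation_U_stat_sq:
  assumes L: "finite L"
  shows "(\<integral>\<omega>. (U_stat L \<omega>)\<^sup>2 \<partial>P) = (\<Sum>s\<in>{k + 1..2 * (k + 1)}. real (card L choose s) * pair_mean s)"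
proof -
  have "(U_stat L \<omega>)\<^sup>2 = (\<Sum>s\<in>{k + 1..2 * (k + 1)}. \<Sum>U\<in>ksubsets s L. pair_sum U \<omega>)" for \<omega>
    unfolding U_stat_eq power2_eq_square sum_product pair_sum_def
    by (rule sum_pairs_by_union[OF L]) simp
  then have "(\<integral>\<omega>. (U_stat L \<omega>)\<^sup>2 \<partial>P) =
      (\<Sum>s\<in>{k + 1..2 * (k + 1)}. \<Sum>U\<in>ksubsets s L. \<integral>\<omega>. pair_sum U \<omega> \<partial>P)"
    by (simp add: Bochner_Integration.integral_sum Bochner_Integration.integrable_sum integrable_pair_sum)
  also have "\<dots> = (\<Sum>s\<in>{k + 1..2 * (k + 1)}. \<Sum>U\<in>ksubsets s L. pair_mean s)"
  proof (intro sum.cong refl)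
    fix s U assume U: "U \<in> ksubsets s L"
    show "(\<integral>\<omega>. pair_sum U \<omega> \<partial>P) = pair_mean s"
      using expectation_pair_sum[OF finite_ksubset[OF L U]] ksubsetsD(2)[OF U] by simp
  qed
  finally show ?thesis using L by (simp add: card_ksubsets)
qed

text \<open>Two (k+1)-subsets whose union has k + 1 elements coincide, and the indicator is
  idempotent. This diagonal term is the mean of the U-statistic and dominates its variance.\<close>

lemma pair_mean_bot: "pair_mean (k + 1) = q"
proof -
  have "cover_pairs (k + 1) {..<k + 1} = {({..<k + 1}, {..<k + 1})}"
  proof (intro equalityI subsetI)
    fix x assume "x \<in> cover_pairs (k + 1) {..<k + 1}"
    then obtain I J where x: "x = (I, J)" "I \<union> J = {..<k + 1}" "card I = k + 1" "card J = k + 1"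
      by (auto simp: cover_pairs_def)
    have "I = {..<k + 1}" by (rule card_subset_eq) (use x in auto)
    moreover have "J = {..<k + 1}" by (rule card_subset_eq) (use x in auto)
    ultimately show "x \<in> {({..<k + 1}, {..<k + 1})}" using x by simp
  qed (auto simp: cover_pairs_def)
  then show ?thesis
    unfolding pair_mean_def expectation_pair_sum_sum
    using expectation_simp_ind[of "{..<k + 1}"] by (simp add: simp_ind_idem)
qed

lemma pair_mean_nonneg: "0 \<le> pair_mean s"
  unfolding pair_mean_def pair_sum_def
  by (intro Bochner_Integration.integral_nonneg sum_nonneg) (auto simp: simp_ind_def)

text \<open>With at most 2k + 1 indices in the union, two (k+1)-subsets must meet. The remaining s -
  1 indices then form a cluster around a shared one, and 4^s bounds the number of pairs.\<close>

lemma pair_mean_le: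
  assumes "s \<le> 2 * k + 1"
  shows "pair_mean s \<le> 4 ^ s * \<beta> ^ (s - 1)"
proof -
  have "pair_mean s = (\<Sum>(I, J)\<in>cover_pairs (k + 1) {..<s}. \<integral>\<omega>. simp_ind I \<omega> * simp_ind J \<omega> \<partial>P)"
    unfolding pair_mean_def by (rule expectation_pair_sum_sum)
  also have "\<dots> \<le> (\<Sum>(I, J)\<in>cover_pairs (k + 1) {..<s}. \<beta> ^ (s - 1))"
  proof (intro sum_mono, clarify)
    fix I J assume IJ: "(I, J) \<in> cover_pairs (k + 1) {..<s}"
    then have U: "I \<union> J = {..<s}" "card I = k + 1" "card J = k + 1" by (auto simp: cover_pairs_def)
    have fin: "finite I" "finite J"
      using U(1) by (metis finite_Un finite_lessThan)+
    have "I \<inter> J \<noteq> {}"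
    proof
      assume "I \<inter> J = {}"
      then have "card (I \<union> J) = 2 * (k + 1)" using fin U(2,3) by (simp add: card_Un_disjoint)
      then show False using U(1) assms by simp
    qed
    then obtain i where i: "i \<in> I" "i \<in> J" by auto
    have "(\<integral>\<omega>. simp_ind I \<omega> * simp_ind J \<omega> \<partial>P) \<le> (\<integral>\<omega>. cluster i (I \<union> J - {i}) \<omega> \<partial>P)"
      using fin by (intro integral_mono integrable_simp_ind_pair[OF IJ] simp_ind_mult_le_cluster i
        integrable_bounded[of _ 1]) (auto intro: cluster_bounds)
    also have "\<dots> \<le> \<beta> ^ card (I \<union> J - {i})"
      using fin by (intro expectation_cluster_le) auto
    also have "card (I \<union> J - {i}) = s - 1" using U i fin by (subst card_Diff_singleton) auto
    finally show "(\<integral>\<omega>. simp_ind I \<omega> * simp_ind J \<omega> \<partial>P) \<le> \<beta> ^ (s - 1)" .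
  qed
  also have "\<dots> = real (card (cover_pairs (k + 1) {..<s})) * \<beta> ^ (s - 1)"
    by (simp add: case_prod_beta)
  also have "\<dots> \<le> 4 ^ s * \<beta> ^ (s - 1)"
  proof (rule mult_right_mono)
    have "card (cover_pairs (k + 1) {..<s}) \<le> 4 ^ s"
      using card_cover_pairs_le[of "{..<s}" "k + 1"] by simp
    then have "real (card (cover_pairs (k + 1) {..<s})) \<le> real (4 ^ s)"
      by (simp only: of_nat_le_iff)
    then show "real (card (cover_pairs (k + 1) {..<s})) \<le> 4 ^ s" by simp
  qed (simp add: \<beta>_nonneg)
  finally show ?thesis .
qed

text \<open>Covering 2k + 2 indices by two (k+1)-subsets forces them to be complementary, so each
  summand factorises by independence. These are the terms to be cancelled by the squared
  mean.\<close>

lemma pair_mean_top: "pair_mean (2 * (k + 1)) = real (2 * (k + 1) choose (k + 1)) * q\<^sup>2"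
proof -
  let ?U = "{..<2 * (k + 1)}"
  have eq: "cover_pairs (k + 1) ?U = (\<lambda>I. (I, ?U - I)) ` ksubsets (k + 1) ?U"
  proof (intro equalityI subsetI)
    fix x assume "x \<in> cover_pairs (k + 1) ?U"
    then obtain I J where x: "x = (I, J)" "I \<union> J = ?U" "card I = k + 1" "card J = k + 1"
      by (auto simp: cover_pairs_def)
    have fin: "finite I" "finite J"
      using x(2) by (metis finite_Un finite_lessThan)+
    have "card (I \<inter> J) = 0"
      using card_Un_Int[OF fin] x by simp
    then have "I \<inter> J = {}" using fin by simp
    then have "J = ?U - I" using x(2) by auto
    then show "x \<in> (\<lambda>I. (I, ?U - I)) ` ksubsets (k + 1) ?U"
      using x by (auto simp: ksubsets_def)
  next
    fix x assume "x \<in> (\<lambda>I. (I, ?U - I)) ` ksubsets (k + 1) ?U"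
    then obtain I where I: "x = (I, ?U - I)" "I \<subseteq> ?U" "card I = k + 1" by (auto simp: ksubsets_def)
    then have "card (?U - I) = k + 1"
      using finite_subset[OF I(2)] by (subst card_Diff_subset) auto
    then show "x \<in> cover_pairs (k + 1) ?U" using I by (auto simp: cover_pairs_def)
  qed
  have "pair_mean (2 * (k + 1)) = (\<Sum>I\<in>ksubsets (k + 1) ?U. \<integral>\<omega>. simp_ind I \<omega> * simp_ind (?U - I) \<omega> \<partial>P)"
    unfolding pair_mean_def expectation_pair_sum_sum eq
    by (subst sum.reindex) (auto simp: inj_on_def)
  also have "\<dots> = (\<Sum>I\<in>ksubsets (k + 1) ?U. q\<^sup>2)"
  proof (intro sum.cong refl)
    fix I assume I: "I \<in> ksubsets (k + 1) ?U"
    then have "(I, ?U - I) \<in> cover_pairs (k + 1) ?U" using eq by auto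
    then have c: "card I = k + 1" "card (?U - I) = k + 1" by (auto simp: cover_pairs_def)
    have "(\<integral>\<omega>. simp_ind I \<omega> * simp_ind (?U - I) \<omega> \<partial>P) = (\<integral>\<omega>. simp_ind I \<omega> \<partial>P) * (\<integral>\<omega>. simp_ind (?U - I) \<omega> \<partial>P)"
      by (rule expectation_mult_disjoint[where I=I and J="?U - I" and C=1])
         (rule simp_ind_depends meas_simp_ind[OF c(1)] meas_simp_ind[OF c(2)] simp_ind_bounds Diff_disjoint)+
    then show "(\<integral>\<omega>. simp_ind I \<omega> * simp_ind (?U - I) \<omega> \<partial>P) = q\<^sup>2"
      by (simp only: expectation_simp_ind[OF c(1)] expectation_simp_ind[OF c(2)] power2_eq_square)
  qed
  finally show ?thesis by (simp add: card_ksubsets)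
qed

end

subsection \<open>Blocked simplices\<close>

context local_count
begin

definition blocked_ind :: "nat set \<Rightarrow> nat set \<Rightarrow> (nat \<Rightarrow> 'b) \<Rightarrow> real" where
  "blocked_ind L I \<omega> = of_bool (H (\<omega> ` I) \<and> (\<exists>j\<in>L - I. G (\<omega> ` I) (\<omega> j)))"

lemma blocked_eq: "blocked L \<omega> = (\<Sum>I\<in>ksubsets (k + 1) L. blocked_ind L I \<omega>)"
  by (simp add: blocked_def blocked_ind_def)

lemma meas_blocked [measurable]:
  assumes L: "finite L"
  shows "blocked L \<in> borel_measurable P"
  unfolding blocked_eq
proof (rule borel_measurable_sum)
  fix I assume I: "I \<in> ksubsets (k + 1) L"
  note [measurable] = meas_HG[OF finite_ksubset[OF L I] ksubsetsD(2)[OF I]]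
  have [simp]: "finite (L - I)" using L by simp
  have "blocked_ind L I = (\<lambda>\<omega>. of_bool (\<exists>j\<in>L - I. H (\<omega> ` I) \<and> G (\<omega> ` I) (\<omega> j)))"
    by (auto simp: blocked_ind_def fun_eq_iff)
  also have "\<dots> \<in> borel_measurable P" by measurable
  finally show "blocked_ind L I \<in> borel_measurable P" .
qed

lemma blocked_nonneg: "0 \<le> blocked L \<omega>"
  unfolding blocked_def by (rule sum_nonneg) auto

lemma blocked_le_U_stat: "blocked L \<omega> \<le> U_stat L \<omega>"
  unfolding blocked_def U_stat_def by (rule sum_mono) auto

lemma blocked_le: "finite L \<Longrightarrow> \<bar>blocked L \<omega>\<bar> \<le> real (card L) ^ (k + 1)"
  using blocked_nonneg[of L \<omega>] blocked_le_U_stat[of L \<omega>] U_stat_bounds(2)[of L \<omega>] by linarith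

lemma blocked_depends: "depends_on (blocked L) L"
  unfolding depends_on_def
proof (intro allI impI)
  fix \<omega> \<omega>' :: "nat \<Rightarrow> 'b" assume eq: "\<forall>i\<in>L. \<omega> i = \<omega>' i"
  have "\<omega> ` I = \<omega>' ` I" if "I \<in> ksubsets (k + 1) L" for I
    using that eq by (intro image_cong) (auto simp: ksubsets_def)
  then show "blocked L \<omega> = blocked L \<omega>'"
    unfolding blocked_def using eq by (intro sum.cong refl) auto
qed

lemma ksubsets_insert:
  assumes "finite L" "i \<notin> L"
  shows "ksubsets (Suc p) (insert i L) = ksubsets (Suc p) L \<union> insert i ` ksubsets p L"
proof (intro equalityI subsetI)
  fix I assume I: "I \<in> ksubsets (Suc p) (insert i L)"
  then have fin: "finite I" using assms finite_ksubset by (metis finite_insert)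
  show "I \<in> ksubsets (Suc p) L \<union> insert i ` ksubsets p L"
  proof (cases "i \<in> I")
    case True
    then have "I = insert i (I - {i})" "I - {i} \<in> ksubsets p L"
      using I fin by (auto simp: ksubsets_def)
    then show ?thesis by blast
  qed (use I in \<open>auto simp: ksubsets_def\<close>)
next
  fix I assume "I \<in> ksubsets (Suc p) L \<union> insert i ` ksubsets p L"
  moreover have "card (insert i B) = Suc p" if "B \<subseteq> L" "card B = p" for B
    using that assms by (metis card_insert_disjoint finite_subset subsetD)
  ultimately show "I \<in> ksubsets (Suc p) (insert i L)"
    by (auto simp: ksubsets_def)
qed

text \<open>Adding the point \<open>i\<close> can only block a simplex through a cluster of \<open>k + 1\<close> further
  points around \<open>i\<close>: either \<open>i\<close> is the blocking point, or \<open>i\<close> is a vertex and the cluster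
  consists of the other vertices and one blocking point.\<close>

lemma blocked_insert_bounds:
  assumes L: "finite L" "i \<notin> L"
  shows "blocked L \<omega> \<le> blocked (insert i L) \<omega>"
    and "blocked (insert i L) \<omega> - blocked L \<omega> \<le> real (k + 2) * (\<Sum>B\<in>ksubsets (k + 1) L. cluster i B \<omega>)"
proof -
  let ?L = "insert i L"
  have fin: "finite B" if "B \<in> ksubsets p L" for B p using that L finite_ksubset by blast
  have split: "blocked ?L \<omega> = (\<Sum>I\<in>ksubsets (k + 1) L. blocked_ind ?L I \<omega>)
      + (\<Sum>B\<in>ksubsets k L. blocked_ind ?L (insert i B) \<omega>)"
  proof -
    have inj: "inj_on (insert i) (ksubsets k L)"
      using L by (auto simp: inj_on_def ksubsets_def)
    have "blocked ?L \<omega> = (\<Sum>I\<in>ksubsets (k + 1) L. blocked_ind ?L I \<omega>)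
      + (\<Sum>I\<in>insert i ` ksubsets k L. blocked_ind ?L I \<omega>)"
      unfolding blocked_eq using L
      by (simp add: ksubsets_insert) (subst sum.union_disjoint, auto simp: ksubsets_def)
    then show ?thesis using inj by (simp add: sum.reindex)
  qed
  have mono: "blocked_ind L I \<omega> \<le> blocked_ind ?L I \<omega>" for I
    unfolding blocked_ind_def by auto
  have "blocked L \<omega> \<le> (\<Sum>I\<in>ksubsets (k + 1) L. blocked_ind ?L I \<omega>)"
    unfolding blocked_eq by (intro sum_mono mono)
  moreover have "0 \<le> (\<Sum>B\<in>ksubsets k L. blocked_ind ?L (insert i B) \<omega>)"
    by (intro sum_nonneg) (simp add: blocked_ind_def)
  ultimately show "blocked L \<omega> \<le> blocked ?L \<omega>" using split by linarith
  have first: "(\<Sum>I\<in>ksubsets (k + 1) L. blocked_ind ?L I \<omega>) - blocked L \<omega>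
     \<le> (\<Sum>B\<in>ksubsets (k + 1) L. cluster i B \<omega>)"
    unfolding blocked_eq sum_subtractf[symmetric]
  proof (rule sum_mono)
    fix I assume "I \<in> ksubsets (k + 1) L"
    have "cluster i I \<omega> = 1" if "H (\<omega> ` I)" "G (\<omega> ` I) (\<omega> i)"
      using near_G[OF that] by (auto simp: cluster_def)
    then show "blocked_ind ?L I \<omega> - blocked_ind L I \<omega> \<le> cluster i I \<omega>"
      using cluster_bounds(1)[of i I \<omega>] by (auto simp: blocked_ind_def of_bool_def)
  qed
  have "(\<Sum>B\<in>ksubsets k L. blocked_ind ?L (insert i B) \<omega>)
      \<le> (\<Sum>B\<in>ksubsets k L. \<Sum>j\<in>L - B. cluster i (insert j B) \<omega>)"
  proof (rule sum_mono)
    fix B assume B: "B \<in> ksubsets k L"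
    show "blocked_ind ?L (insert i B) \<omega> \<le> (\<Sum>j\<in>L - B. cluster i (insert j B) \<omega>)"
    proof (cases "H (\<omega> ` insert i B) \<and> (\<exists>j\<in>?L - insert i B. G (\<omega> ` insert i B) (\<omega> j))")
      case True
      then obtain j where j: "j \<in> L - B" "G (\<omega> ` insert i B) (\<omega> j)" and H: "H (\<omega> ` insert i B)" by auto
      have "cluster i (insert j B) \<omega> = 1"
        using near_G[OF H j(2), of "\<omega> i"] near_H[OF H, of "\<omega> i"] by (auto simp: cluster_def)
      then have "1 \<le> (\<Sum>j\<in>L - B. cluster i (insert j B) \<omega>)"
        using j L member_le_sum[of j "L - B" "\<lambda>j. cluster i (insert j B) \<omega>"]
        by (simp add: cluster_bounds)
      then show ?thesis by (simp add: blocked_ind_def)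
    next
      case False
      then have "blocked_ind ?L (insert i B) \<omega> = 0" unfolding blocked_ind_def by simp
      then show ?thesis by (simp add: sum_nonneg cluster_bounds)
    qed
  qed
  also have "\<dots> = (\<Sum>(B, j)\<in>Sigma (ksubsets k L) (\<lambda>B. L - B). cluster i (insert j B) \<omega>)"
    using L by (simp add: sum.Sigma)
  \<comment> \<open>Double counting: vertices \<open>B\<close> plus a blocking index
    \<open>j\<close> become one (k+1)-set \<open>C\<close> with a marked element. Each
    \<open>C\<close> occurs k + 1 times, and the case of \<open>i\<close> as blocking point adds one
    more, whence the factor k + 2.\<close>
  also have "\<dots> = (\<Sum>(C, j)\<in>Sigma (ksubsets (k + 1) L) (\<lambda>C. C). cluster i C \<omega>)"
  proof (rule sum.reindex_bij_witness[where j="\<lambda>(B, j). (insert j B, j)" and i="\<lambda>(C, j). (C - {j}, j)"], goal_cases)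
    case (1 a)
    then show ?case by auto
  next
    case (2 a)
    then obtain B j where a: "a = (B, j)" "B \<in> ksubsets k L" "j \<in> L - B" by auto
    then show ?case using fin[OF a(2)] by (auto simp: ksubsets_def)
  next
    case (3 b)
    then show ?case by auto
  next
    case (4 b)
    then obtain C j where b: "b = (C, j)" "C \<in> ksubsets (k + 1) L" "j \<in> C" by auto
    then show ?case using fin[OF b(2)] by (auto simp: ksubsets_def)
  qed auto
  also have "\<dots> = (\<Sum>C\<in>ksubsets (k + 1) L. \<Sum>j\<in>C. cluster i C \<omega>)"
    using L fin by (intro sum.Sigma[symmetric]) auto
  also have "\<dots> = (\<Sum>C\<in>ksubsets (k + 1) L. real (k + 1) * cluster i C \<omega>)"
    by (intro sum.cong refl) (auto simp: ksubsets_def)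
  also have "\<dots> = real (k + 1) * (\<Sum>C\<in>ksubsets (k + 1) L. cluster i C \<omega>)"
    by (simp add: sum_distrib_left)
  finally show "blocked ?L \<omega> - blocked L \<omega> \<le> real (k + 2) * (\<Sum>B\<in>ksubsets (k + 1) L. cluster i B \<omega>)"
    using first split by (simp add: algebra_simps)
qed

text \<open>Leave-one-out Efron-Stein, comparing with the count in which point \<open>j\<close> is
  removed. The difference lies between zero and k + 2 times the number of (k+1)-clusters around
  \<open>j\<close>, whose second moment is already bounded.\<close>

lemma variance_blocked_le:
  "P.variance (blocked {..<m}) \<le>
     2 * real m * (real (k + 2))\<^sup>2 * (\<Sum>s\<in>{k + 1..2 * (k + 1)}. (4 * real m * \<beta>) ^ s)"
proof -
  let ?R = "\<lambda>j. blocked ({..<m} - {j})"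
  let ?Q = "\<Sum>s\<in>{k + 1..2 * (k + 1)}. (4 * real m * \<beta>) ^ s"
  have "P.variance (blocked {..<m}) \<le> 2 * (\<Sum>j<m. (\<integral>\<omega>. (blocked {..<m} \<omega> - ?R j \<omega>)\<^sup>2 \<partial>P))"
  proof (rule efron_stein_leave_one_out)
    show "\<bar>blocked {..<m} \<omega>\<bar> \<le> real m ^ (k + 1)" for \<omega>
      using blocked_le[of "{..<m}" \<omega>] by simp
    show "\<bar>?R j \<omega>\<bar> \<le> real m ^ (k + 1)" for j \<omega>
    proof -
      have "card ({..<m} - {j}) \<le> m" by (metis card_Diff1_le card_lessThan finite_lessThan)
      then have "real (card ({..<m} - {j})) ^ (k + 1) \<le> real m ^ (k + 1)" by (intro power_mono) auto
      then show ?thesis using blocked_le[of "{..<m} - {j}" \<omega>] by simp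
    qed
  qed (auto intro: blocked_depends)
  also have "(\<Sum>j<m. (\<integral>\<omega>. (blocked {..<m} \<omega> - ?R j \<omega>)\<^sup>2 \<partial>P)) \<le> (\<Sum>j<m. (real (k + 2))\<^sup>2 * ?Q)"
  proof (rule sum_mono)
    fix j assume j: "j \<in> {..<m}"
    let ?L = "{..<m} - {j}"
    have ins: "insert j ?L = {..<m}" using j by auto
    have fin: "finite B" if "B \<in> ksubsets (k + 1) ?L" for B
      by (rule finite_ksubset[OF _ that]) simp
    let ?S = "\<lambda>\<omega>. \<Sum>B\<in>ksubsets (k + 1) ?L. cluster j B \<omega>"
    have [measurable]: "?S \<in> borel_measurable P"
      by (intro borel_measurable_sum meas_cluster fin)
    have S: "0 \<le> ?S \<omega>" "?S \<omega> \<le> real (card (ksubsets (k + 1) ?L))" for \<omega>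
      using sum_bounded_above[of "ksubsets (k + 1) ?L" "\<lambda>B. cluster j B \<omega>" 1]
      by (auto intro: sum_nonneg cluster_bounds)
    have d: "0 \<le> blocked {..<m} \<omega> - ?R j \<omega>" "blocked {..<m} \<omega> - ?R j \<omega> \<le> real (k + 2) * ?S \<omega>" for \<omega>
      using blocked_insert_bounds[of ?L j \<omega>] unfolding ins by auto
    have "(\<integral>\<omega>. (blocked {..<m} \<omega> - ?R j \<omega>)\<^sup>2 \<partial>P) \<le> (\<integral>\<omega>. (real (k + 2))\<^sup>2 * (?S \<omega>)\<^sup>2 \<partial>P)"
    proof (rule integral_mono_AE')
      show "integrable P (\<lambda>\<omega>. (real (k + 2))\<^sup>2 * (?S \<omega>)\<^sup>2)"
      proof (rule integrable_bounded[of _ "(real (k + 2))\<^sup>2 * (real (card (ksubsets (k + 1) ?L)))\<^sup>2"])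
        show "\<bar>(real (k + 2))\<^sup>2 * (?S \<omega>)\<^sup>2\<bar> \<le> (real (k + 2))\<^sup>2 * (real (card (ksubsets (k + 1) ?L)))\<^sup>2" for \<omega>
          using S[of \<omega>] by (auto simp: abs_mult intro!: mult_left_mono power_mono)
      qed measurable
      show "AE \<omega> in P. (blocked {..<m} \<omega> - ?R j \<omega>)\<^sup>2 \<le> (real (k + 2))\<^sup>2 * (?S \<omega>)\<^sup>2"
        using power_mono[OF d(2) d(1), of _ 2] by (intro AE_I2) (simp add: power_mult_distrib)
    qed auto
    also have "\<dots> = (real (k + 2))\<^sup>2 * (\<integral>\<omega>. (?S \<omega>)\<^sup>2 \<partial>P)" by simp
    also have "\<dots> \<le> (real (k + 2))\<^sup>2 * ?Q"
    proof (rule mult_left_mono)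
      have "card ?L \<le> m" by (metis card_Diff1_le card_lessThan finite_lessThan)
      then show "(\<integral>\<omega>. (?S \<omega>)\<^sup>2 \<partial>P) \<le> ?Q"
        by (intro expectation_cluster_sum_sq_le) auto
    qed simp
    finally show "(\<integral>\<omega>. (blocked {..<m} \<omega> - ?R j \<omega>)\<^sup>2 \<partial>P) \<le> (real (k + 2))\<^sup>2 * ?Q" .
  qed
  finally show ?thesis by simp
qed

lemma integrable_blocked: "finite L \<Longrightarrow> integrable P (blocked L)"
  by (rule integrable_bounded[OF meas_blocked blocked_le])

lemma expectation_blocked_step:
  "(\<integral>\<omega>. blocked {..<m} \<omega> \<partial>P) \<le> (\<integral>\<omega>. blocked {..<Suc m} \<omega> \<partial>P)"
  "(\<integral>\<omega>. blocked {..<Suc m} \<omega> \<partial>P) - (\<integral>\<omega>. blocked {..<m} \<omega> \<partial>P) \<le> real (k + 2) * (real m * \<beta>) ^ (k + 1)"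
proof -
  let ?S = "\<lambda>\<omega>. \<Sum>B\<in>ksubsets (k + 1) {..<m}. cluster m B \<omega>"
  have fin: "finite B" if "B \<in> ksubsets (k + 1) {..<m}" for B
    by (rule finite_ksubset[OF _ that]) simp
  have b: "blocked {..<m} \<omega> \<le> blocked {..<Suc m} \<omega>"
    "blocked {..<Suc m} \<omega> - blocked {..<m} \<omega> \<le> real (k + 2) * ?S \<omega>" for \<omega>
    using blocked_insert_bounds[of "{..<m}" m \<omega>] by (auto simp: lessThan_Suc)
  show "(\<integral>\<omega>. blocked {..<m} \<omega> \<partial>P) \<le> (\<integral>\<omega>. blocked {..<Suc m} \<omega> \<partial>P)"
    by (intro integral_mono integrable_blocked b) auto
  have int: "integrable P ?S"
    by (rule Bochner_Integration.integrable_sum)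
       (rule integrable_bounded[OF meas_cluster[OF fin] cluster_bounds(3)])
  have "(\<integral>\<omega>. blocked {..<Suc m} \<omega> \<partial>P) - (\<integral>\<omega>. blocked {..<m} \<omega> \<partial>P)
      = (\<integral>\<omega>. blocked {..<Suc m} \<omega> - blocked {..<m} \<omega> \<partial>P)"
    by (simp add: integrable_blocked)
  also have "\<dots> \<le> (\<integral>\<omega>. real (k + 2) * ?S \<omega> \<partial>P)"
    by (intro integral_mono b Bochner_Integration.integrable_diff integrable_mult_right
        integrable_blocked int finite_lessThan)
  also have "\<dots> = real (k + 2) * (\<integral>\<omega>. ?S \<omega> \<partial>P)" by simp
  also have "\<dots> \<le> real (k + 2) * (real m * \<beta>) ^ (k + 1)"
    using expectation_cluster_sum_le[of "{..<m}" m "k + 1"] by (intro mult_left_mono) auto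
  finally show "(\<integral>\<omega>. blocked {..<Suc m} \<omega> \<partial>P) - (\<integral>\<omega>. blocked {..<m} \<omega> \<partial>P) \<le> real (k + 2) * (real m * \<beta>) ^ (k + 1)" .
qed

text \<open>The one-point increments are summed from the smaller to the larger sample size; m + n
  serves as a symmetric upper bound for the sizes in between.\<close>

lemma expectation_blocked_diff_le:
  "\<bar>(\<integral>\<omega>. blocked {..<m} \<omega> \<partial>P) - (\<integral>\<omega>. blocked {..<n} \<omega> \<partial>P)\<bar>
     \<le> real (k + 2) * \<bar>real m - real n\<bar> * (real (m + n) * \<beta>) ^ (k + 1)"
proof -
  have main: "\<bar>(\<integral>\<omega>. blocked {..<n + d} \<omega> \<partial>P) - (\<integral>\<omega>. blocked {..<n} \<omega> \<partial>P)\<bar>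
     \<le> real (k + 2) * real d * (real (n + d) * \<beta>) ^ (k + 1)" for n d
  proof (induction d)
    case (Suc d)
    let ?E = "\<lambda>m. \<integral>\<omega>. blocked {..<m} \<omega> \<partial>P"
    have pw: "(real (n + d) * \<beta>) ^ (k + 1) \<le> (real (n + Suc d) * \<beta>) ^ (k + 1)"
      using \<beta>_nonneg by (intro power_mono mult_right_mono) auto
    have "\<bar>?E (n + Suc d) - ?E n\<bar> \<le> \<bar>?E (n + d) - ?E n\<bar> + real (k + 2) * (real (n + d) * \<beta>) ^ (k + 1)"
      using expectation_blocked_step[of "n + d"] by simp
    also have "\<dots> \<le> real (k + 2) * real d * (real (n + d) * \<beta>) ^ (k + 1) + real (k + 2) * (real (n + d) * \<beta>) ^ (k + 1)"
      using Suc.IH by linarith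
    also have "\<dots> = real (k + 2) * real (Suc d) * (real (n + d) * \<beta>) ^ (k + 1)"
      by (simp add: algebra_simps)
    also have "\<dots> \<le> real (k + 2) * real (Suc d) * (real (n + Suc d) * \<beta>) ^ (k + 1)"
      by (intro mult_left_mono pw) auto
    finally show ?case .
  qed simp
  have wlog: "\<bar>(\<integral>\<omega>. blocked {..<m} \<omega> \<partial>P) - (\<integral>\<omega>. blocked {..<n} \<omega> \<partial>P)\<bar>
     \<le> real (k + 2) * \<bar>real m - real n\<bar> * (real (m + n) * \<beta>) ^ (k + 1)" if "n \<le> m" for m n
  proof -
    have "(real m * \<beta>) ^ (k + 1) \<le> (real (m + n) * \<beta>) ^ (k + 1)"
      using \<beta>_nonneg by (intro power_mono mult_right_mono) auto
    then have "real (k + 2) * \<bar>real m - real n\<bar> * (real m * \<beta>) ^ (k + 1)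
       \<le> real (k + 2) * \<bar>real m - real n\<bar> * (real (m + n) * \<beta>) ^ (k + 1)"
      by (intro mult_left_mono) auto
    moreover have eqs: "n + (m - n) = m" "real (m - n) = \<bar>real m - real n\<bar>"
      using that by (auto simp: of_nat_diff)
    ultimately show ?thesis using main[of n "m - n", unfolded eqs] by linarith
  qed
  show ?thesis
  proof (cases "n \<le> m")
    case False
    then show ?thesis using wlog[of m n] by (simp add: abs_minus_commute add.commute)
  qed (rule wlog)
qed

end

subsection \<open>Random sample size\<close>

context iid_sequence
begin

abbreviation indexed :: "nat pmf \<Rightarrow> (nat \<times> (nat \<Rightarrow> 'b)) measure" where
  "indexed \<nu> \<equiv> measure_pmf \<nu> \<Otimes>\<^sub>M P"

lemma prob_space_indexed: "prob_space (indexed \<nu>)"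
proof -
  interpret J: pair_prob_space "measure_pmf \<nu>" P ..
  show ?thesis by (rule J.prob_space_axioms)
qed

lemma measurable_indexed:
  fixes F :: "nat \<Rightarrow> (nat \<Rightarrow> 'b) \<Rightarrow> real"
  assumes "\<And>m. F m \<in> borel_measurable P"
  shows "(\<lambda>\<omega>. F (fst \<omega>) (snd \<omega>)) \<in> borel_measurable (indexed \<nu>)"
proof -
  have "(\<lambda>\<omega>. F (fst \<omega>) (snd \<omega>)) \<in> borel_measurable (count_space UNIV \<Otimes>\<^sub>M P)"
    using assms by (intro measurable_pair_measure_countable1) auto
  then show ?thesis
    by (subst measurable_cong_sets[OF sets_pair_measure_cong refl]) auto
qed

text \<open>The bound \<open>b\<close> may grow with the sample size, because the counts are bounded
  only by a power of the number of points; its integrability under the law of that number justifies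
  Fubini.\<close>

lemma
  fixes F :: "nat \<Rightarrow> (nat \<Rightarrow> 'b) \<Rightarrow> real"
  assumes meas: "\<And>m. F m \<in> borel_measurable P"
    and bdd: "\<And>m \<omega>. \<bar>F m \<omega>\<bar> \<le> b m" and b: "integrable (measure_pmf \<nu>) b"
  shows integrable_indexed: "integrable (indexed \<nu>) (\<lambda>\<omega>. F (fst \<omega>) (snd \<omega>))"
    and expectation_indexed: "(\<integral>\<omega>. F (fst \<omega>) (snd \<omega>) \<partial>indexed \<nu>) =
      measure_pmf.expectation \<nu> (\<lambda>m. \<integral>\<omega>. F m \<omega> \<partial>P)"
proof -
  interpret J: pair_prob_space "measure_pmf \<nu>" P ..
  have int: "integrable P (F m)" for m using meas bdd by (rule integrable_bounded)
  have le: "(\<integral>\<omega>. \<bar>F m \<omega>\<bar> \<partial>P) \<le> b m" for m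
  proof -
    have "(\<integral>\<omega>. \<bar>F m \<omega>\<bar> \<partial>P) \<le> (\<integral>\<omega>. b m \<partial>P)"
      using int[of m] bdd by (intro integral_mono) auto
    then show ?thesis using P.prob_space by simp
  qed
  show 1: "integrable (indexed \<nu>) (\<lambda>\<omega>. F (fst \<omega>) (snd \<omega>))"
  proof (rule J.Fubini_integrable)
    show "integrable (measure_pmf \<nu>) (\<lambda>x. \<integral>y. norm (F (fst (x, y)) (snd (x, y))) \<partial>P)"
      using le by (intro Bochner_Integration.integrable_bound[OF b]) (auto intro!: AE_pmfI order_trans[OF _ abs_ge_self])
  qed (use meas int in \<open>auto intro: measurable_indexed\<close>)
  show "(\<integral>\<omega>. F (fst \<omega>) (snd \<omega>) \<partial>indexed \<nu>) = measure_pmf.expectation \<nu> (\<lambda>m. \<integral>\<omega>. F m \<omega> \<partial>P)"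
    using J.integral_fst'[OF 1] by simp
qed

end

section \<open>Variance inequalities for comparing two random variables\<close>

lemma (in prob_space) variance_le:
  fixes X :: "'a \<Rightarrow> real"
  assumes X: "integrable M X" "integrable M (\<lambda>x. (X x)\<^sup>2)"
  shows "variance X \<le> (\<integral>x. (X x - c)\<^sup>2 \<partial>M)"
proof -
  have "(\<integral>x. (X x - c)\<^sup>2 \<partial>M) = (\<integral>x. (X x)\<^sup>2 - 2 * c * X x + c\<^sup>2 \<partial>M)"
    by (intro Bochner_Integration.integral_cong refl) (simp add: power2_eq_square algebra_simps)
  also have "\<dots> = (\<integral>x. (X x)\<^sup>2 \<partial>M) - 2 * c * expectation X + c\<^sup>2"
    using X by (simp add: prob_space)
  also have "\<dots> \<ge> (\<integral>x. (X x)\<^sup>2 \<partial>M) - (expectation X)\<^sup>2"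
    using zero_le_power2[of "expectation X - c"] by (simp add: power2_eq_square algebra_simps)
  finally show ?thesis using variance_eq[OF X] by simp
qed

text \<open>The discriminant form of Cauchy-Schwarz: the quadratic is evaluated at its minimiser
  -C/B. For B = 0 it is affine in t, and t = -(A+1)/(2C) would give the value -1 unless C =
  0.\<close>

lemma square_le_of_nonneg_quadratic:
  fixes A B C :: real
  assumes q: "\<And>t. 0 \<le> A + 2 * t * C + t\<^sup>2 * B" and B: "0 \<le> B"
  shows "C\<^sup>2 \<le> A * B"
proof (cases "B = 0")
  case True
  have "C = 0"
  proof (rule ccontr)
    assume "C \<noteq> 0"
    then show False using q[of "- (A + 1) / (2 * C)"] True by (simp add: field_simps)
  qed
  then show ?thesis using True by simp
next
  case False
  then show ?thesis using q[of "- C / B"] B by (simp add: field_simps power2_eq_square)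
qed

text \<open>Expanding the square of the difference of the centred variables leaves a covariance,
  bounded by Cauchy-Schwarz. If the variance of Y is of smaller order than that of X, then
  subtracting Y does not affect the leading order.\<close>

lemma (in prob_space) variance_diff_bound:
  fixes X Y :: "'a \<Rightarrow> real"
  assumes X: "integrable M X" "integrable M (\<lambda>x. (X x)\<^sup>2)"
    and Y: "integrable M Y" "integrable M (\<lambda>x. (Y x)\<^sup>2)"
  shows "\<bar>variance (\<lambda>x. X x - Y x) - variance X\<bar> \<le> 2 * sqrt (variance X * variance Y) + variance Y"
proof -
  define a where "a x = X x - expectation X" for x
  define b where "b x = Y x - expectation Y" for x
  have [measurable]: "X \<in> borel_measurable M" "Y \<in> borel_measurable M" using X Y by auto
  have [measurable]: "a \<in> borel_measurable M" "b \<in> borel_measurable M" unfolding a_def b_def by measurable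
  have a2: "integrable M (\<lambda>x. (a x)\<^sup>2)"
    unfolding a_def power2_diff using X by auto
  have b2: "integrable M (\<lambda>x. (b x)\<^sup>2)"
    unfolding b_def power2_diff using Y by auto
  have ab: "integrable M (\<lambda>x. a x * b x)"
  proof (rule Bochner_Integration.integrable_bound)
    show "integrable M (\<lambda>x. (a x)\<^sup>2 + (b x)\<^sup>2)" using a2 b2 by auto
    show "AE x in M. norm (a x * b x) \<le> norm ((a x)\<^sup>2 + (b x)\<^sup>2)"
    proof (rule AE_I2)
      fix x
      have "2 * (\<bar>a x\<bar> * \<bar>b x\<bar>) \<le> (a x)\<^sup>2 + (b x)\<^sup>2"
        using sum_squares_bound[of "\<bar>a x\<bar>" "\<bar>b x\<bar>"] by (simp add: mult.assoc)
      moreover have "0 \<le> \<bar>a x\<bar> * \<bar>b x\<bar>" by simp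
      ultimately have "\<bar>a x\<bar> * \<bar>b x\<bar> \<le> (a x)\<^sup>2 + (b x)\<^sup>2" by linarith
      then show "norm (a x * b x) \<le> norm ((a x)\<^sup>2 + (b x)\<^sup>2)" by (simp add: abs_mult)
    qed
  qed simp
  have "variance (\<lambda>x. X x - Y x) = (\<integral>x. (a x)\<^sup>2 - 2 * (a x * b x) + (b x)\<^sup>2 \<partial>M)"
    using X Y by (intro Bochner_Integration.integral_cong refl)
      (simp add: a_def b_def power2_eq_square algebra_simps)
  also have "\<dots> = variance X - 2 * (\<integral>x. a x * b x \<partial>M) + variance Y"
    using a2 b2 ab by (simp add: a_def b_def)
  finally have eq: "variance (\<lambda>x. X x - Y x) - variance X = variance Y - 2 * (\<integral>x. a x * b x \<partial>M)"
    by simp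
  have "(\<integral>x. a x * b x \<partial>M)\<^sup>2 \<le> variance X * variance Y"
  proof (rule square_le_of_nonneg_quadratic)
    fix t
    have "0 \<le> (\<integral>x. (a x + t * b x)\<^sup>2 \<partial>M)" by simp
    also have "\<dots> = (\<integral>x. (a x)\<^sup>2 + 2 * t * (a x * b x) + t\<^sup>2 * (b x)\<^sup>2 \<partial>M)"
      by (intro Bochner_Integration.integral_cong refl) (simp add: power2_eq_square algebra_simps)
    also have "\<dots> = variance X + 2 * t * (\<integral>x. a x * b x \<partial>M) + t\<^sup>2 * variance Y"
      using a2 b2 ab by (simp add: a_def b_def)
    finally show "0 \<le> variance X + 2 * t * (\<integral>x. a x * b x \<partial>M) + t\<^sup>2 * variance Y" .
  qed (rule variance_positive)
  then have "\<bar>\<integral>x. a x * b x \<partial>M\<bar> \<le> sqrt (variance X * variance Y)"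
    by (simp add: real_le_rsqrt real_sqrt_abs[symmetric] del: real_sqrt_abs)
  moreover have "0 \<le> variance Y" by (rule variance_positive)
  ultimately show ?thesis using eq by linarith
qed

section \<open>Variances of the counts with a random number of points\<close>

context local_count
begin

definition unblocked :: "nat set \<Rightarrow> (nat \<Rightarrow> 'b) \<Rightarrow> real" where
  "unblocked L \<omega> = U_stat L \<omega> - blocked L \<omega>"

abbreviation rU :: "nat \<times> (nat \<Rightarrow> 'b) \<Rightarrow> real" where "rU \<equiv> \<lambda>\<omega>. U_stat {..<fst \<omega>} (snd \<omega>)"
abbreviation rB :: "nat \<times> (nat \<Rightarrow> 'b) \<Rightarrow> real" where "rB \<equiv> \<lambda>\<omega>. blocked {..<fst \<omega>} (snd \<omega>)"

context
  fixes \<nu> :: "nat pmf"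
  assumes moments: "\<And>p. integrable (measure_pmf \<nu>) (\<lambda>m. real m ^ p)"
begin

interpretation I: prob_space "indexed \<nu>" by (rule prob_space_indexed)

lemma integrable_rU: "integrable (indexed \<nu>) rU" "integrable (indexed \<nu>) (\<lambda>\<omega>. (rU \<omega>)\<^sup>2)"
proof -
  have b: "\<bar>U_stat {..<m} \<omega>\<bar> \<le> real m ^ (k + 1)" for m \<omega>
    using U_stat_bounds[of "{..<m}" \<omega>] by simp
  show "integrable (indexed \<nu>) rU"
    by (rule integrable_indexed[OF meas_U_stat b moments])
  have b2: "\<bar>(U_stat {..<m} \<omega>)\<^sup>2\<bar> \<le> real m ^ ((k + 1) * 2)" for m \<omega>
    using power_mono[OF b[of m \<omega>], of 2] unfolding power_mult by simp
  show "integrable (indexed \<nu>) (\<lambda>\<omega>. (rU \<omega>)\<^sup>2)"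
    by (rule integrable_indexed[where F="\<lambda>m \<omega>. (U_stat {..<m} \<omega>)\<^sup>2", OF _ b2 moments]) simp
qed

lemma integrable_rB: "integrable (indexed \<nu>) rB" "integrable (indexed \<nu>) (\<lambda>\<omega>. (rB \<omega>)\<^sup>2)"
proof -
  have b: "\<bar>blocked {..<m} \<omega>\<bar> \<le> real m ^ (k + 1)" for m \<omega>
    using blocked_le[of "{..<m}" \<omega>] by simp
  show "integrable (indexed \<nu>) rB"
    by (rule integrable_indexed[OF meas_blocked b moments]) simp
  have b2: "\<bar>(blocked {..<m} \<omega>)\<^sup>2\<bar> \<le> real m ^ ((k + 1) * 2)" for m \<omega>
    using power_mono[OF b[of m \<omega>], of 2] unfolding power_mult by simp
  show "integrable (indexed \<nu>) (\<lambda>\<omega>. (rB \<omega>)\<^sup>2)"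
    by (rule integrable_indexed[where F="\<lambda>m \<omega>. (blocked {..<m} \<omega>)\<^sup>2", OF _ b2 moments]) simp
qed

lemma integrable_choose: "integrable (measure_pmf \<nu>) (\<lambda>m. real (m choose s))"
proof (rule Bochner_Integration.integrable_bound[OF moments[of s]])
  show "AE m in measure_pmf \<nu>. norm (real (m choose s)) \<le> norm (real m ^ s)"
    using choose_le_power by (intro AE_pmfI) (simp flip: of_nat_power)
qed simp

lemma variance_rU:
  "I.variance rU = (\<Sum>s\<in>{k + 1..2 * (k + 1)}. measure_pmf.expectation \<nu> (\<lambda>m. real (m choose s)) * pair_mean s)
     - (measure_pmf.expectation \<nu> (\<lambda>m. real (m choose (k + 1))) * q)\<^sup>2"
proof -
  have b: "\<bar>U_stat {..<m} \<omega>\<bar> \<le> real m ^ (k + 1)" for m \<omega>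
    using U_stat_bounds[of "{..<m}" \<omega>] by simp
  have b2: "\<bar>(U_stat {..<m} \<omega>)\<^sup>2\<bar> \<le> real m ^ ((k + 1) * 2)" for m \<omega>
    using power_mono[OF b[of m \<omega>], of 2] unfolding power_mult by simp
  have "I.expectation rU = measure_pmf.expectation \<nu> (\<lambda>m. \<integral>\<omega>. U_stat {..<m} \<omega> \<partial>P)"
    by (rule expectation_indexed[OF meas_U_stat b moments])
  also have "\<dots> = measure_pmf.expectation \<nu> (\<lambda>m. real (m choose (k + 1))) * q"
    by (simp add: expectation_U_stat)
  finally have 1: "I.expectation rU = measure_pmf.expectation \<nu> (\<lambda>m. real (m choose (k + 1))) * q" .
  have "I.expectation (\<lambda>\<omega>. (rU \<omega>)\<^sup>2) = measure_pmf.expectation \<nu> (\<lambda>m. \<integral>\<omega>. (U_stat {..<m} \<omega>)\<^sup>2 \<partial>P)"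
    by (rule expectation_indexed[where F="\<lambda>m \<omega>. (U_stat {..<m} \<omega>)\<^sup>2", OF _ b2 moments]) simp
  also have "\<dots> = measure_pmf.expectation \<nu> (\<lambda>m. \<Sum>s\<in>{k + 1..2 * (k + 1)}. real (m choose s) * pair_mean s)"
    by (intro Bochner_Integration.integral_cong refl) (subst expectation_U_stat_sq, auto)
  also have "\<dots> = (\<Sum>s\<in>{k + 1..2 * (k + 1)}. measure_pmf.expectation \<nu> (\<lambda>m. real (m choose s)) * pair_mean s)"
    by (subst Bochner_Integration.integral_sum) (auto intro: integrable_choose)
  finally show ?thesis using I.variance_eq[OF integrable_rU] 1 by simp
qed

text \<open>The deviation is measured from the constant \<open>\<tau> n\<close>, the mean for
  exactly \<open>n\<close> points, which can only increase it. Given the number m of points it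
  splits into the Efron-Stein variance and the squared drift from \<open>\<tau> m\<close> to
  \<open>\<tau> n\<close>, which is quadratic in m - n.\<close>

lemma variance_rB_le:
  assumes n: "0 < n"
  shows "I.variance rB \<le>
     measure_pmf.expectation \<nu> (\<lambda>m. 2 * real m * (real (k + 2))\<^sup>2 * (\<Sum>s\<in>{k + 1..2 * (k + 1)}. (4 * real m * \<beta>) ^ s))
     + (real (k + 2))\<^sup>2 * \<beta> ^ (2 * (k + 1)) * measure_pmf.expectation \<nu> (\<lambda>m. (real m - real n)\<^sup>2 * (real m + real n) ^ (2 * (k + 1)))"
proof -
  define \<tau> where "\<tau> m = (\<integral>\<omega>. blocked {..<m} \<omega> \<partial>P)" for m
  define v where "v m = 2 * real m * (real (k + 2))\<^sup>2 * (\<Sum>s\<in>{k + 1..2 * (k + 1)}. (4 * real m * \<beta>) ^ s)" for m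
  define w where "w m = (real (k + 2))\<^sup>2 * \<beta> ^ (2 * (k + 1)) * ((real m - real n)\<^sup>2 * (real m + real n) ^ (2 * (k + 1)))" for m
  have b: "\<bar>blocked {..<m} \<omega>\<bar> \<le> real m ^ (k + 1)" for m \<omega>
    using blocked_le[of "{..<m}" \<omega>] by simp
  have intv: "integrable (measure_pmf \<nu>) v"
  proof -
    have "v = (\<lambda>m. \<Sum>s\<in>{k + 1..2 * (k + 1)}. (2 * (real (k + 2))\<^sup>2 * (4 * \<beta>) ^ s) * real m ^ Suc s)"
      unfolding v_def sum_distrib_left
      by (intro ext sum.cong refl) (simp add: power_mult_distrib mult_ac)
    then show ?thesis
      by (simp only:) (intro Bochner_Integration.integrable_sum integrable_mult_right moments)
  qed
  have intw: "integrable (measure_pmf \<nu>) w"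
  proof -
    have "integrable (measure_pmf \<nu>) (\<lambda>m. (real m)\<^sup>2 * (real m + real n) ^ (2 * (k + 1)) - 2 * real n * (real m * (real m + real n) ^ (2 * (k + 1)))
       + (real n)\<^sup>2 * (real m + real n) ^ (2 * (k + 1)))"
    proof -
      have *: "integrable (measure_pmf \<nu>) (\<lambda>m. real m ^ a * (real m + real n) ^ c)" for a c
      proof -
        have "(\<lambda>m. real m ^ a * (real m + real n) ^ c) =
          (\<lambda>m. \<Sum>i\<le>c. (real (c choose i) * real n ^ (c - i)) * real m ^ (a + i))"
          by (simp add: fun_eq_iff binomial_ring sum_distrib_left power_add mult_ac)
        then show ?thesis using moments by simp
      qed
      show ?thesis using *[of 2 "2 * (k + 1)"] *[of 1 "2 * (k + 1)"] *[of 0 "2 * (k + 1)"]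
        by (intro Bochner_Integration.integrable_add Bochner_Integration.integrable_diff integrable_mult_right) auto
    qed
    then show ?thesis unfolding w_def
      by (intro integrable_mult_right) (simp add: power2_diff algebra_simps)
  qed
  have pt: "(\<integral>\<omega>. (blocked {..<m} \<omega> - \<tau> n)\<^sup>2 \<partial>P) \<le> v m + w m" for m
  proof -
    have int: "integrable P (blocked {..<m})" by (rule integrable_blocked) simp
    \<comment> \<open>The square is expanded around the conditional mean \<open>\<tau> m\<close>;
      the cross term integrates to zero.\<close>
    have "(\<integral>\<omega>. (blocked {..<m} \<omega> - \<tau> n)\<^sup>2 \<partial>P)
        = (\<integral>\<omega>. (blocked {..<m} \<omega> - \<tau> m)\<^sup>2 + (2 * (\<tau> m - \<tau> n) * (blocked {..<m} \<omega> - \<tau> m) + (\<tau> m - \<tau> n)\<^sup>2) \<partial>P)"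
      by (intro Bochner_Integration.integral_cong refl) (simp add: power2_eq_square algebra_simps)
    also have "\<dots> = P.variance (blocked {..<m}) + (\<tau> m - \<tau> n)\<^sup>2"
    proof -
      have "integrable P (\<lambda>\<omega>. (blocked {..<m} \<omega> - \<tau> m)\<^sup>2)"
      proof (rule integrable_bounded)
        show "\<bar>(blocked {..<m} \<omega> - \<tau> m)\<^sup>2\<bar> \<le> (real m ^ (k + 1) + \<bar>\<tau> m\<bar>)\<^sup>2" for \<omega>
        proof -
          have "\<bar>blocked {..<m} \<omega> - \<tau> m\<bar> \<le> real m ^ (k + 1) + \<bar>\<tau> m\<bar>"
            using b[of m \<omega>] abs_triangle_ineq4[of "blocked {..<m} \<omega>" "\<tau> m"] by linarith
          from power_mono[OF this abs_ge_zero, of 2] show ?thesis by simp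
        qed
      qed simp
      then show ?thesis
        using int by (subst Bochner_Integration.integral_add) (use P.prob_space in \<open>auto simp: \<tau>_def\<close>)
    qed
    also have "\<dots> \<le> v m + w m"
    proof (rule add_mono)
      show "P.variance (blocked {..<m}) \<le> v m" unfolding v_def by (rule variance_blocked_le)
      have "\<bar>\<tau> m - \<tau> n\<bar>\<^sup>2 \<le> (real (k + 2) * \<bar>real m - real n\<bar> * (real (m + n) * \<beta>) ^ (k + 1))\<^sup>2"
        unfolding \<tau>_def by (intro power_mono expectation_blocked_diff_le) auto
      also have "\<dots> = w m"
        unfolding w_def power_mult_distrib power_even_eq by (simp add: mult_ac)
      finally show "(\<tau> m - \<tau> n)\<^sup>2 \<le> w m" by simp
    qed
    finally show ?thesis .
  qed
  have "I.variance rB \<le> I.expectation (\<lambda>\<omega>. (rB \<omega> - \<tau> n)\<^sup>2)"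
    by (rule I.variance_le[OF integrable_rB])
  also have "\<dots> = measure_pmf.expectation \<nu> (\<lambda>m. \<integral>\<omega>. (blocked {..<m} \<omega> - \<tau> n)\<^sup>2 \<partial>P)"
  proof (rule expectation_indexed[where F="\<lambda>m \<omega>. (blocked {..<m} \<omega> - \<tau> n)\<^sup>2"])
    show "\<bar>(blocked {..<m} \<omega> - \<tau> n)\<^sup>2\<bar> \<le> 2 * real m ^ (2 * (k + 1)) + 2 * (\<tau> n)\<^sup>2" for m \<omega>
    proof -
      have "(blocked {..<m} \<omega> - \<tau> n)\<^sup>2 \<le> 2 * (blocked {..<m} \<omega>)\<^sup>2 + 2 * (\<tau> n)\<^sup>2"
        using zero_le_power2[of "blocked {..<m} \<omega> + \<tau> n"] by (simp add: power2_eq_square algebra_simps)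
      moreover have "(blocked {..<m} \<omega>)\<^sup>2 \<le> real m ^ (2 * (k + 1))"
        using power_mono[OF b[of m \<omega>] abs_ge_zero, of 2] by (simp only: power_even_eq power2_abs)
      ultimately show ?thesis by simp
    qed
    show "integrable (measure_pmf \<nu>) (\<lambda>m. 2 * real m ^ (2 * (k + 1)) + 2 * (\<tau> n)\<^sup>2)"
      by (intro Bochner_Integration.integrable_add integrable_mult_right moments) simp
  qed simp
  also have "\<dots> \<le> measure_pmf.expectation \<nu> (\<lambda>m. v m + w m)"
  proof (rule integral_mono_AE')
    show "integrable (measure_pmf \<nu>) (\<lambda>m. v m + w m)"
      by (rule Bochner_Integration.integrable_add[OF intv intw])
  qed (auto intro!: AE_pmfI pt order_trans[OF _ pt])
  also have "\<dots> = measure_pmf.expectation \<nu> v + measure_pmf.expectation \<nu> w"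
    using intv intw by simp
  finally show ?thesis unfolding v_def w_def by simp
qed

text \<open>The smallest union size contributes the mean, the largest combines with the squared mean
  into the defect controlled by \<open>D\<close>, and every size in between belongs to simplices
  sharing a vertex. \<open>C\<close> and \<open>D\<close> record how the moments of the number of
  points grow with \<open>n\<close>.\<close>

lemma variance_rU_approx:
  assumes C: "\<And>s. measure_pmf.expectation \<nu> (\<lambda>m. real m ^ s) \<le> C s * real n ^ s"
    and D: "\<bar>measure_pmf.expectation \<nu> (\<lambda>m. real (m choose (2 * (k + 1)))) * real (2 * (k + 1) choose (k + 1))
       - (measure_pmf.expectation \<nu> (\<lambda>m. real (m choose (k + 1))))\<^sup>2\<bar> \<le> D * real n ^ (2 * k + 1)"
  shows "\<bar>I.variance rU - measure_pmf.expectation \<nu> (\<lambda>m. real (m choose (k + 1))) * q\<bar>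
    \<le> (\<Sum>s\<in>{k + 2..2 * k + 1}. C s * real n ^ s * (4 ^ s * \<beta> ^ (s - 1))) + D * real n ^ (2 * k + 1) * \<beta> ^ (2 * k)"
proof -
  let ?w = "\<lambda>s. measure_pmf.expectation \<nu> (\<lambda>m. real (m choose s))"
  let ?mid = "\<Sum>s\<in>{k + 2..2 * k + 1}. ?w s * pair_mean s"
  let ?top = "(?w (2 * (k + 1)) * real (2 * (k + 1) choose (k + 1)) - (?w (k + 1))\<^sup>2) * q\<^sup>2"
  have "{k + 1..2 * (k + 1)} = insert (k + 1) (insert (2 * (k + 1)) {k + 2..2 * k + 1})" by auto
  then have sum: "(\<Sum>s\<in>{k + 1..2 * (k + 1)}. ?w s * pair_mean s)
      = ?w (k + 1) * pair_mean (k + 1) + (?w (2 * (k + 1)) * pair_mean (2 * (k + 1)) + ?mid)"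
    by (simp only:) (subst sum.insert, simp, simp, subst sum.insert, auto)
  have eq: "I.variance rU - ?w (k + 1) * q = ?mid + ?top"
    unfolding variance_rU sum pair_mean_bot pair_mean_top by (simp add: power2_eq_square algebra_simps)
  have w0: "0 \<le> ?w s" for s by (rule Bochner_Integration.integral_nonneg) simp
  have wC: "?w s \<le> C s * real n ^ s" for s
  proof -
    have "?w s \<le> measure_pmf.expectation \<nu> (\<lambda>m. real m ^ s)"
      using choose_le_power by (intro integral_mono integrable_choose moments) (simp flip: of_nat_power)
    then show ?thesis using C[of s] by linarith
  qed
  have "?mid \<le> (\<Sum>s\<in>{k + 2..2 * k + 1}. C s * real n ^ s * (4 ^ s * \<beta> ^ (s - 1)))"
    using w0 by (intro sum_mono mult_mono wC pair_mean_le pair_mean_nonneg) (auto intro: order_trans[OF w0 wC])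
  moreover have "0 \<le> ?mid" using w0 by (intro sum_nonneg mult_nonneg_nonneg pair_mean_nonneg)
  moreover have "\<bar>?top\<bar> \<le> D * real n ^ (2 * k + 1) * \<beta> ^ (2 * k)"
  proof -
    have "q\<^sup>2 \<le> (\<beta> ^ k)\<^sup>2" using q_le q_nonneg by (intro power_mono)
    then have "q\<^sup>2 \<le> \<beta> ^ (2 * k)" by (simp add: power_even_eq)
    then show ?thesis unfolding abs_mult using D by (intro mult_mono) auto
  qed
  ultimately show ?thesis unfolding eq by linarith
qed

lemma variance_rB_bound:
  assumes C: "\<And>s. measure_pmf.expectation \<nu> (\<lambda>m. real m ^ s) \<le> C s * real n ^ s"
    and E: "measure_pmf.expectation \<nu> (\<lambda>m. (real m - real n)\<^sup>2 * (real m + real n) ^ (2 * (k + 1)))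
      \<le> E * real n ^ (2 * k + 3)"
    and n: "0 < n"
  shows "I.variance rB \<le>
     (\<Sum>s\<in>{k + 1..2 * (k + 1)}. 2 * (real (k + 2))\<^sup>2 * (4 * \<beta>) ^ s * (C (Suc s) * real n ^ Suc s))
     + (real (k + 2))\<^sup>2 * \<beta> ^ (2 * (k + 1)) * (E * real n ^ (2 * k + 3))"
proof -
  have v: "(\<lambda>m. 2 * real m * (real (k + 2))\<^sup>2 * (\<Sum>s\<in>{k + 1..2 * (k + 1)}. (4 * real m * \<beta>) ^ s))
    = (\<lambda>m. \<Sum>s\<in>{k + 1..2 * (k + 1)}. (2 * (real (k + 2))\<^sup>2 * (4 * \<beta>) ^ s) * real m ^ Suc s)"
    unfolding sum_distrib_left by (intro ext sum.cong refl) (simp add: power_mult_distrib mult_ac)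
  have "measure_pmf.expectation \<nu> (\<lambda>m. \<Sum>s\<in>{k + 1..2 * (k + 1)}. (2 * (real (k + 2))\<^sup>2 * (4 * \<beta>) ^ s) * real m ^ Suc s)
    = (\<Sum>s\<in>{k + 1..2 * (k + 1)}. (2 * (real (k + 2))\<^sup>2 * (4 * \<beta>) ^ s) * measure_pmf.expectation \<nu> (\<lambda>m. real m ^ Suc s))"
    by (subst Bochner_Integration.integral_sum) (intro integrable_mult_right moments, simp only: integral_mult_right_zero)
  also have "\<dots> \<le> (\<Sum>s\<in>{k + 1..2 * (k + 1)}. 2 * (real (k + 2))\<^sup>2 * (4 * \<beta>) ^ s * (C (Suc s) * real n ^ Suc s))"
    using \<beta>_nonneg by (intro sum_mono mult_left_mono C) auto
  moreover have "(real (k + 2))\<^sup>2 * \<beta> ^ (2 * (k + 1)) * measure_pmf.expectation \<nu> (\<lambda>m. (real m - real n)\<^sup>2 * (real m + real n) ^ (2 * (k + 1)))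
    \<le> (real (k + 2))\<^sup>2 * \<beta> ^ (2 * (k + 1)) * (E * real n ^ (2 * k + 3))"
    using \<beta>_nonneg by (intro mult_left_mono E) auto
  ultimately show ?thesis using variance_rB_le[OF n] unfolding v by linarith
qed

lemma variance_unblocked_bound:
  "\<bar>I.variance (\<lambda>\<omega>. unblocked {..<fst \<omega>} (snd \<omega>)) - I.variance rU\<bar>
     \<le> 2 * sqrt (I.variance rU * I.variance rB) + I.variance rB"
  unfolding unblocked_def by (rule I.variance_diff_bound[OF integrable_rU integrable_rB])

end

end

lemma tendsto_power_zero:
  fixes x :: "nat \<Rightarrow> real"
  assumes "x \<longlonglongrightarrow> 0" "0 < j"
  shows "(\<lambda>n. x n ^ j) \<longlonglongrightarrow> 0"
  using tendsto_power[OF assms(1), of j] unfolding zero_power[OF assms(2)] .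

text \<open>The hypotheses on \<nu> are exactly what the bounds for a single n require, with
  constants uniform in n. Dividing these bounds by the normaliser turns the errors into positive
  powers of n r^d, while the mean of the U-statistic supplies the limit as a product of the limits
  \<open>w\<close> and \<open>q\<close>.\<close>

theorem variance_unblocked_asymptotics:
  fixes M :: "'b measure" and H :: "nat \<Rightarrow> 'b set \<Rightarrow> bool" and G near
    and \<nu> :: "nat \<Rightarrow> nat pmf" and r :: "nat \<Rightarrow> real" and C :: "nat \<Rightarrow> real"
  assumes lc: "\<And>n. local_count M (H n) G (near n) k (c * r n ^ d)"
    and r: "\<And>n. 0 < r n" and x: "(\<lambda>n. real n * r n ^ d) \<longlonglongrightarrow> 0" and k: "1 \<le> k"
    and moments: "\<And>n p. 0 < n \<Longrightarrow> integrable (measure_pmf (\<nu> n)) (\<lambda>m. real m ^ p)"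
    and C: "\<And>n p. 0 < n \<Longrightarrow> measure_pmf.expectation (\<nu> n) (\<lambda>m. real m ^ p) \<le> C p * real n ^ p"
    and D: "\<And>n. 0 < n \<Longrightarrow> \<bar>measure_pmf.expectation (\<nu> n) (\<lambda>m. real (m choose (2 * (k + 1)))) * real (2 * (k + 1) choose (k + 1))
       - (measure_pmf.expectation (\<nu> n) (\<lambda>m. real (m choose (k + 1))))\<^sup>2\<bar> \<le> D * real n ^ (2 * k + 1)"
    and E: "\<And>n. 0 < n \<Longrightarrow> measure_pmf.expectation (\<nu> n) (\<lambda>m. (real m - real n)\<^sup>2 * (real m + real n) ^ (2 * (k + 1)))
      \<le> E * real n ^ (2 * k + 3)"
    and w: "(\<lambda>n. measure_pmf.expectation (\<nu> n) (\<lambda>m. real (m choose (k + 1))) / real n ^ (k + 1)) \<longlonglongrightarrow> 1 / fact (k + 1)"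
    and q: "(\<lambda>n. local_count.q M (H n) k / r n ^ (d * k)) \<longlonglongrightarrow> Q"
  shows "(\<lambda>n. prob_space.variance (measure_pmf (\<nu> n) \<Otimes>\<^sub>M Pi\<^sub>M UNIV (\<lambda>_. M))
            (\<lambda>\<omega>. local_count.unblocked (H n) G k {..<fst \<omega>} (snd \<omega>)) / (real n ^ (k + 1) * r n ^ (d * k)))
          \<longlonglongrightarrow> 1 / fact (k + 1) * Q"
proof -
  define \<Omega> where "\<Omega> n = measure_pmf (\<nu> n) \<Otimes>\<^sub>M Pi\<^sub>M UNIV (\<lambda>_::nat. M)" for n
  define a where "a n = real n ^ (k + 1) * r n ^ (d * k)" for n
  define X where "X n = real n * r n ^ d" for n
  define VU where "VU n = prob_space.variance (\<Omega> n) (\<lambda>\<omega>. local_count.U_stat (H n) k {..<fst \<omega>} (snd \<omega>))" for n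
  define VB where "VB n = prob_space.variance (\<Omega> n) (\<lambda>\<omega>. local_count.blocked (H n) G k {..<fst \<omega>} (snd \<omega>))" for n
  define VN where "VN n = prob_space.variance (\<Omega> n) (\<lambda>\<omega>. local_count.unblocked (H n) G k {..<fst \<omega>} (snd \<omega>))" for n
  define w1 where "w1 n = measure_pmf.expectation (\<nu> n) (\<lambda>m. real (m choose (k + 1)))" for n
  have X0: "X \<longlonglongrightarrow> 0" using x unfolding X_def .
  have a_pos: "0 < a n" if "0 < n" for n using r that by (simp add: a_def)
  \<comment> \<open>This rests on a = n X^k; with j = 1 the factors of n cancel and a pure power of
    X remains. The case n = 0 is excluded because the normaliser vanishes there.\<close>
  have scale: "real n ^ (s + j) * r n ^ (d * s) / a n = X n ^ (s - k) * real n ^ j / real n" if "0 < n" "k \<le> s" for n s j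
  proof -
    have "real n ^ (s + j) * r n ^ (d * s) * real n = X n ^ (s - k) * real n ^ j * a n"
    proof -
      have "s = (s - k) + k" using that by simp
      then obtain t where t: "s = t + k" "t = s - k" by blast
      show ?thesis unfolding t(2)[symmetric] unfolding t(1) a_def X_def
        by (simp add: power_add power_mult_distrib power_mult[symmetric] distrib_left mult_ac)
    qed
    then show ?thesis using a_pos[OF that(1)] that by (simp add: field_simps)
  qed
  have VU_bound: "\<bar>VU n / a n - w1 n * local_count.q M (H n) k / a n\<bar>
     \<le> (\<Sum>s\<in>{k + 2..2 * k + 1}. C s * (4 ^ s * c ^ (s - 1)) * X n ^ (s - 1 - k)) + D * c ^ (2 * k) * X n ^ k" if n: "0 < n" for n
  proof -
    interpret local_count M "H n" G "near n" k "c * r n ^ d" by (rule lc)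
    have "\<bar>VU n - w1 n * q\<bar> \<le> (\<Sum>s\<in>{k + 2..2 * k + 1}. C s * real n ^ s * (4 ^ s * (c * r n ^ d) ^ (s - 1)))
         + D * real n ^ (2 * k + 1) * (c * r n ^ d) ^ (2 * k)"
      unfolding VU_def w1_def \<Omega>_def
      by (rule variance_rU_approx[OF moments[OF n] C[OF n] D[OF n]])
    then have "\<bar>VU n - w1 n * q\<bar> / a n \<le> ((\<Sum>s\<in>{k + 2..2 * k + 1}. C s * real n ^ s * (4 ^ s * (c * r n ^ d) ^ (s - 1)))
         + D * real n ^ (2 * k + 1) * (c * r n ^ d) ^ (2 * k)) / a n"
      using a_pos[OF n] by (intro divide_right_mono) auto
    also have "\<dots> = (\<Sum>s\<in>{k + 2..2 * k + 1}. C s * (4 ^ s * c ^ (s - 1)) * (real n ^ (s - 1 + 1) * r n ^ (d * (s - 1)) / a n))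
         + D * c ^ (2 * k) * (real n ^ (2 * k + 1) * r n ^ (d * (2 * k)) / a n)"
      unfolding add_divide_distrib sum_divide_distrib
      by (intro arg_cong2[where f="(+)"] sum.cong refl) (auto simp: power_mult_distrib power_mult[symmetric])
    also have "\<dots> = (\<Sum>s\<in>{k + 2..2 * k + 1}. C s * (4 ^ s * c ^ (s - 1)) * X n ^ (s - 1 - k)) + D * c ^ (2 * k) * X n ^ k"
    proof (intro arg_cong2[where f="(+)"] sum.cong refl)
      fix s assume "s \<in> {k + 2..2 * k + 1}"
      then have "k \<le> s - 1" by auto
      from scale[OF n this, of 1] n
      show "C s * (4 ^ s * c ^ (s - 1)) * (real n ^ (s - 1 + 1) * r n ^ (d * (s - 1)) / a n)
        = C s * (4 ^ s * c ^ (s - 1)) * X n ^ (s - 1 - k)" by (simp only:) simp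
    next
      show "D * c ^ (2 * k) * (real n ^ (2 * k + 1) * r n ^ (d * (2 * k)) / a n) = D * c ^ (2 * k) * X n ^ k"
        using scale[OF n, of "2 * k" 1] n by (simp only:) simp
    qed
    finally show ?thesis using a_pos[OF n] by (simp flip: diff_divide_distrib)
  qed
  have VU_lim: "(\<lambda>n. VU n / a n) \<longlonglongrightarrow> 1 / fact (k + 1) * Q"
  proof -
    have "(\<lambda>n. (\<Sum>s\<in>{k + 2..2 * k + 1}. C s * (4 ^ s * c ^ (s - 1)) * X n ^ (s - 1 - k)) + D * c ^ (2 * k) * X n ^ k)
      \<longlonglongrightarrow> (\<Sum>s\<in>{k + 2..2 * k + 1}. C s * (4 ^ s * c ^ (s - 1)) * 0) + D * c ^ (2 * k) * 0"
      \<comment> \<open>All exponents are positive: s - 1 - k is at least 1 for s from k + 2 on, and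
        X^k, from the disjoint pairs, tends to zero because k is at least 1.\<close>
      using k by (intro tendsto_add tendsto_sum tendsto_mult tendsto_const tendsto_power_zero X0) auto
    then have bound0: "(\<lambda>n. (\<Sum>s\<in>{k + 2..2 * k + 1}. C s * (4 ^ s * c ^ (s - 1)) * X n ^ (s - 1 - k)) + D * c ^ (2 * k) * X n ^ k)
      \<longlonglongrightarrow> 0" by simp
    have "(\<lambda>n. VU n / a n - w1 n * local_count.q M (H n) k / a n) \<longlonglongrightarrow> 0"
    proof (rule Lim_null_comparison[OF _ bound0], rule eventually_sequentiallyI[of 1])
      fix n :: nat assume "1 \<le> n"
      then have "0 < n" by simp
      from VU_bound[OF this]
      show "norm (VU n / a n - w1 n * local_count.q M (H n) k / a n) \<le>
        (\<Sum>s\<in>{k + 2..2 * k + 1}. C s * (4 ^ s * c ^ (s - 1)) * X n ^ (s - 1 - k)) + D * c ^ (2 * k) * X n ^ k"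
        unfolding real_norm_def .
    qed
    moreover have "(\<lambda>n. w1 n * local_count.q M (H n) k / a n) \<longlonglongrightarrow> 1 / fact (k + 1) * Q"
      using tendsto_mult[OF w q] by (simp add: w1_def a_def)
    ultimately show ?thesis using tendsto_add by fastforce
  qed
  have VB_bound: "VB n / a n \<le> (\<Sum>s\<in>{k + 1..2 * (k + 1)}. 2 * (real (k + 2))\<^sup>2 * (4 * c) ^ s * C (Suc s) * X n ^ (s - k))
     + (real (k + 2))\<^sup>2 * c ^ (2 * (k + 1)) * E * X n ^ (k + 2)" and VB_nonneg: "0 \<le> VB n" if n: "0 < n" for n
  proof -
    interpret local_count M "H n" G "near n" k "c * r n ^ d" by (rule lc)
    show "0 \<le> VB n" unfolding VB_def by simp
    have "VB n \<le> (\<Sum>s\<in>{k + 1..2 * (k + 1)}. 2 * (real (k + 2))\<^sup>2 * (4 * (c * r n ^ d)) ^ s * (C (Suc s) * real n ^ Suc s))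
     + (real (k + 2))\<^sup>2 * (c * r n ^ d) ^ (2 * (k + 1)) * (E * real n ^ (2 * k + 3))"
      unfolding VB_def \<Omega>_def by (rule variance_rB_bound[OF moments[OF n] C[OF n] E[OF n] n])
    then have "VB n / a n \<le> ((\<Sum>s\<in>{k + 1..2 * (k + 1)}. 2 * (real (k + 2))\<^sup>2 * (4 * (c * r n ^ d)) ^ s * (C (Suc s) * real n ^ Suc s))
     + (real (k + 2))\<^sup>2 * (c * r n ^ d) ^ (2 * (k + 1)) * (E * real n ^ (2 * k + 3))) / a n"
      using a_pos[OF n] by (intro divide_right_mono) auto
    also have "\<dots> = (\<Sum>s\<in>{k + 1..2 * (k + 1)}. 2 * (real (k + 2))\<^sup>2 * (4 * c) ^ s * C (Suc s) * (real n ^ (s + 1) * r n ^ (d * s) / a n))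
     + (real (k + 2))\<^sup>2 * c ^ (2 * (k + 1)) * E * (real n ^ (2 * (k + 1) + 1) * r n ^ (d * (2 * (k + 1))) / a n)"
      unfolding add_divide_distrib sum_divide_distrib
    proof (intro arg_cong2[where f="(+)"] sum.cong refl)
      fix s
      show "2 * (real (k + 2))\<^sup>2 * (4 * (c * r n ^ d)) ^ s * (C (Suc s) * real n ^ Suc s) / a n =
        2 * (real (k + 2))\<^sup>2 * (4 * c) ^ s * C (Suc s) * (real n ^ (s + 1) * r n ^ (d * s) / a n)"
        by (simp add: power_mult_distrib power_mult[symmetric] mult_ac)
      have "2 * k + 3 = 2 * (k + 1) + 1" by simp
      then show "(real (k + 2))\<^sup>2 * (c * r n ^ d) ^ (2 * (k + 1)) * (E * real n ^ (2 * k + 3)) / a n =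
        (real (k + 2))\<^sup>2 * c ^ (2 * (k + 1)) * E * (real n ^ (2 * (k + 1) + 1) * r n ^ (d * (2 * (k + 1))) / a n)"
        by (simp only: power_mult_distrib power_mult[symmetric]) simp
    qed
    also have "\<dots> = (\<Sum>s\<in>{k + 1..2 * (k + 1)}. 2 * (real (k + 2))\<^sup>2 * (4 * c) ^ s * C (Suc s) * X n ^ (s - k))
     + (real (k + 2))\<^sup>2 * c ^ (2 * (k + 1)) * E * X n ^ (k + 2)"
    proof (intro arg_cong2[where f="(+)"] sum.cong refl)
      fix s assume "s \<in> {k + 1..2 * (k + 1)}"
      then have "k \<le> s" by auto
      from scale[OF n this, of 1] n
      show "2 * (real (k + 2))\<^sup>2 * (4 * c) ^ s * C (Suc s) * (real n ^ (s + 1) * r n ^ (d * s) / a n)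
        = 2 * (real (k + 2))\<^sup>2 * (4 * c) ^ s * C (Suc s) * X n ^ (s - k)" by (simp only:) simp
    next
      have e: "2 * (k + 1) - k = k + 2" and le: "k \<le> 2 * (k + 1)" by simp_all
      have "X n ^ (k + 2) * real n ^ 1 / real n = X n ^ (k + 2)" using n by simp
      with scale[OF n le, of 1, unfolded e] show "(real (k + 2))\<^sup>2 * c ^ (2 * (k + 1)) * E * (real n ^ (2 * (k + 1) + 1) * r n ^ (d * (2 * (k + 1))) / a n)
        = (real (k + 2))\<^sup>2 * c ^ (2 * (k + 1)) * E * X n ^ (k + 2)"
        by (simp only:)
    qed
    finally show "VB n / a n \<le> (\<Sum>s\<in>{k + 1..2 * (k + 1)}. 2 * (real (k + 2))\<^sup>2 * (4 * c) ^ s * C (Suc s) * X n ^ (s - k))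
     + (real (k + 2))\<^sup>2 * c ^ (2 * (k + 1)) * E * X n ^ (k + 2)" .
  qed
  have VB_lim: "(\<lambda>n. VB n / a n) \<longlonglongrightarrow> 0"
  proof (rule tendsto_sandwich[where f="\<lambda>_. 0"])
    have "(\<lambda>n. (\<Sum>s\<in>{k + 1..2 * (k + 1)}. 2 * (real (k + 2))\<^sup>2 * (4 * c) ^ s * C (Suc s) * X n ^ (s - k))
       + (real (k + 2))\<^sup>2 * c ^ (2 * (k + 1)) * E * X n ^ (k + 2))
      \<longlonglongrightarrow> (\<Sum>s\<in>{k + 1..2 * (k + 1)}. 2 * (real (k + 2))\<^sup>2 * (4 * c) ^ s * C (Suc s) * 0) + (real (k + 2))\<^sup>2 * c ^ (2 * (k + 1)) * E * 0"
      by (intro tendsto_add tendsto_sum tendsto_mult[OF tendsto_const] tendsto_power_zero X0) auto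
    then show "(\<lambda>n. (\<Sum>s\<in>{k + 1..2 * (k + 1)}. 2 * (real (k + 2))\<^sup>2 * (4 * c) ^ s * C (Suc s) * X n ^ (s - k))
       + (real (k + 2))\<^sup>2 * c ^ (2 * (k + 1)) * E * X n ^ (k + 2)) \<longlonglongrightarrow> 0" by simp
    show "\<forall>\<^sub>F n in sequentially. 0 \<le> VB n / a n"
      using VB_nonneg a_pos by (intro eventually_sequentiallyI[of 1]) (simp add: less_imp_le)
    show "\<forall>\<^sub>F n in sequentially. VB n / a n \<le> (\<Sum>s\<in>{k + 1..2 * (k + 1)}. 2 * (real (k + 2))\<^sup>2 * (4 * c) ^ s * C (Suc s) * X n ^ (s - k))
     + (real (k + 2))\<^sup>2 * c ^ (2 * (k + 1)) * E * X n ^ (k + 2)"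
      by (rule eventually_sequentiallyI[of 1]) (rule VB_bound, simp)
  qed simp
  have diff: "\<bar>VN n / a n - VU n / a n\<bar> \<le> 2 * sqrt (VU n / a n * (VB n / a n)) + VB n / a n" if n: "0 < n" for n
  proof -
    interpret local_count M "H n" G "near n" k "c * r n ^ d" by (rule lc)
    have "\<bar>VN n - VU n\<bar> \<le> 2 * sqrt (VU n * VB n) + VB n"
      unfolding VN_def VU_def VB_def \<Omega>_def by (rule variance_unblocked_bound[OF moments[OF n]])
    then have "\<bar>VN n - VU n\<bar> / a n \<le> (2 * sqrt (VU n * VB n) + VB n) / a n"
      using a_pos[OF n] by (intro divide_right_mono) auto
    moreover have "sqrt (VU n / a n * (VB n / a n)) = sqrt (VU n * VB n) / a n"
      using a_pos[OF n] by (simp add: real_sqrt_divide)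
    ultimately show ?thesis using a_pos[OF n] by (simp add: add_divide_distrib flip: diff_divide_distrib)
  qed
  \<comment> \<open>The normalised variance of the U-statistic converges and that of the blocked
    count tends to zero, so the geometric mean bounding the covariance vanishes.\<close>
  have "(\<lambda>n. 2 * sqrt (VU n / a n * (VB n / a n)) + VB n / a n) \<longlonglongrightarrow> 2 * sqrt (1 / fact (k + 1) * Q * 0) + 0"
    by (intro tendsto_intros VU_lim VB_lim)
  then have bound0: "(\<lambda>n. 2 * sqrt (VU n / a n * (VB n / a n)) + VB n / a n) \<longlonglongrightarrow> 0" by simp
  have "(\<lambda>n. VN n / a n - VU n / a n) \<longlonglongrightarrow> 0"
  proof (rule Lim_null_comparison[OF _ bound0], rule eventually_sequentiallyI[of 1])
    fix n :: nat assume "1 \<le> n"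
    then have "0 < n" by simp
    from diff[OF this] show "norm (VN n / a n - VU n / a n) \<le> 2 * sqrt (VU n / a n * (VB n / a n)) + VB n / a n"
      unfolding real_norm_def .
  qed
  from tendsto_add[OF this VU_lim] show ?thesis
    by (simp add: VN_def a_def \<Omega>_def)
qed

subsection \<open>Moments of the sample size\<close>

text \<open>The Stein-Chen identity E[M g(M)] = l E[g(M + 1)], an index shift in the Poisson series.
  It drives the recursions for all moments below.\<close>

lemma nn_integral_poisson_mult:
  assumes l: "0 < l"
  shows "(\<integral>\<^sup>+ m. of_nat m * g m \<partial>measure_pmf (poisson_pmf l)) =
    ennreal l * (\<integral>\<^sup>+ m. g (Suc m) \<partial>measure_pmf (poisson_pmf l))"
proof -
  let ?w = "\<lambda>m. ennreal (l ^ m / fact m * exp (- l))"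
  have "(\<integral>\<^sup>+ m. of_nat m * g m \<partial>measure_pmf (poisson_pmf l)) = (\<Sum>m. ?w m * (of_nat m * g m))"
    using l by (simp add: nn_integral_measure_pmf nn_integral_count_space_nat)
  also have "\<dots> = (\<Sum>m. ?w (Suc m) * (of_nat (Suc m) * g (Suc m)))"
    using suminf_offset[of "\<lambda>m. ?w m * (of_nat m * g m)" 1] by (simp add: summableI)
  also have "\<dots> = (\<Sum>m. ennreal l * (?w m * g (Suc m)))"
  proof (rule suminf_cong)
    fix m
    have "?w (Suc m) * of_nat (Suc m) = ennreal (l ^ Suc m / fact (Suc m) * exp (- l) * real (Suc m))"
      using l by (subst ennreal_mult) (auto simp: ennreal_of_nat_eq_real_of_nat)
    also have "l ^ Suc m / fact (Suc m) * exp (- l) * real (Suc m) = l * (l ^ m / fact m * exp (- l))"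
      by (simp add: field_simps del: of_nat_Suc)
    also have "ennreal \<dots> = ennreal l * ?w m"
      using l by (subst ennreal_mult) auto
    finally show "?w (Suc m) * (of_nat (Suc m) * g (Suc m)) = ennreal l * (?w m * g (Suc m))"
      by (simp only: mult.assoc[symmetric])
  qed
  also have "\<dots> = ennreal l * (\<Sum>m. ?w m * g (Suc m))"
    by (rule ennreal_suminf_cmult)
  also have "\<dots> = ennreal l * (\<integral>\<^sup>+ m. g (Suc m) \<partial>measure_pmf (poisson_pmf l))"
    using l by (simp add: nn_integral_measure_pmf nn_integral_count_space_nat)
  finally show ?thesis .
qed

text \<open>The identity lowers the exponent by one at the price of replacing M by M + 1, and
  (m+1)^p <= 2^p (m^p + 1) returns to M.\<close>

lemma poisson_moment_finite:
  assumes l: "0 < l"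
  shows "(\<integral>\<^sup>+ m. of_nat m ^ p \<partial>measure_pmf (poisson_pmf l)) < \<infinity>"
proof (induction p)
  case (Suc p)
  let ?\<nu> = "measure_pmf (poisson_pmf l)"
  have "(\<integral>\<^sup>+ m. of_nat m ^ Suc p \<partial>?\<nu>) = ennreal l * (\<integral>\<^sup>+ m. of_nat (Suc m) ^ p \<partial>?\<nu>)"
    using nn_integral_poisson_mult[OF l, of "\<lambda>m. of_nat m ^ p"] by simp
  also have "\<dots> \<le> ennreal l * (\<integral>\<^sup>+ m. 2 ^ p * (of_nat m ^ p + 1) \<partial>?\<nu>)"
  proof (intro mult_left_mono nn_integral_mono)
    fix m
    have "Suc m ^ p \<le> 2 ^ p * (m ^ p + 1)"
    proof (cases "m = 0")
      case False
      then have "Suc m ^ p \<le> (2 * m) ^ p" by (intro power_mono) auto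
      then show ?thesis by (simp add: power_mult_distrib algebra_simps)
    qed (auto intro: trans_le_add1)
    then have "(of_nat (Suc m ^ p) :: ennreal) \<le> of_nat (2 ^ p * (m ^ p + 1))" by (rule of_nat_mono)
    then show "(of_nat (Suc m) ^ p :: ennreal) \<le> 2 ^ p * (of_nat m ^ p + 1)"
      by (simp add: distrib_left add.commute)
  qed simp
  also have "\<dots> = ennreal l * (2 ^ p * ((\<integral>\<^sup>+ m. of_nat m ^ p \<partial>?\<nu>) + 1))"
    by (simp add: nn_integral_cmult nn_integral_add)
  also have "\<dots> < \<infinity>" using Suc.IH
    by (auto simp: ennreal_mult_less_top ennreal_numeral_less_top power_less_top_ennreal)
  finally show ?case .
qed simp

lemma integrable_poisson_power:
  assumes "0 < l"
  shows "integrable (measure_pmf (poisson_pmf l)) (\<lambda>m. real m ^ p)"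
  using poisson_moment_finite[OF assms, of p]
  by (simp add: integrable_iff_bounded ennreal_of_nat_eq_real_of_nat ennreal_power)

lemma integrable_of_power_bound:
  fixes \<nu> :: "nat pmf" and f :: "nat \<Rightarrow> real"
  assumes "\<And>p. integrable (measure_pmf \<nu>) (\<lambda>m. real m ^ p)" "\<And>m. \<bar>f m\<bar> \<le> C * (real m + D) ^ p"
  shows "integrable (measure_pmf \<nu>) f"
proof (rule Bochner_Integration.integrable_bound)
  show "integrable (measure_pmf \<nu>) (\<lambda>m. C * (real m + D) ^ p)"
    unfolding binomial_ring
    by (intro integrable_mult_right Bochner_Integration.integrable_sum integrable_mult_left assms)
  show "AE m in measure_pmf \<nu>. norm (f m) \<le> norm (C * (real m + D) ^ p)"
    using assms(2) by (intro AE_pmfI) (metis abs_ge_self order_trans real_norm_def)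
qed simp

lemma expectation_poisson_mult:
  assumes l: "0 < l" and g: "\<And>m. 0 \<le> g m" "\<And>m. g m \<le> C * (real m + D) ^ p"
  shows "measure_pmf.expectation (poisson_pmf l) (\<lambda>m. real m * g m) =
    l * measure_pmf.expectation (poisson_pmf l) (\<lambda>m. g (Suc m))"
proof -
  let ?\<nu> = "poisson_pmf l"
  have "(\<integral>\<^sup>+ m. ennreal (real m * g m) \<partial>measure_pmf ?\<nu>) = ennreal l * (\<integral>\<^sup>+ m. ennreal (g (Suc m)) \<partial>measure_pmf ?\<nu>)"
    using nn_integral_poisson_mult[OF l, of "\<lambda>m. ennreal (g m)"]
    by (simp add: ennreal_mult' ennreal_of_nat_eq_real_of_nat)
  then show ?thesis
    using l g(1) by (simp add: integral_eq_nn_integral enn2real_mult)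
qed

text \<open>Absorption, (s+1) C(m, s+1) = m C(m-1, s), makes the Stein-Chen identity shift m - 1
  back to m, so each step contributes the factor l / (s+1).\<close>

lemma expectation_poisson_choose:
  assumes l: "0 < l"
  shows "measure_pmf.expectation (poisson_pmf l) (\<lambda>m. real (m choose s)) = l ^ s / fact s"
proof (induction s)
  case (Suc s)
  let ?E = "measure_pmf.expectation (poisson_pmf l)"
  have "real (Suc s) * ?E (\<lambda>m. real (m choose Suc s)) = ?E (\<lambda>m. real m * real ((m - 1) choose s))"
  proof -
    have "real (Suc s) * real (m choose Suc s) = real m * real ((m - 1) choose s)" for m
    proof (cases m)
      case (Suc n)
      have "Suc s * (Suc n choose Suc s) = Suc n * (n choose s)"
        using Suc_times_binomial_eq[of n s] by (simp add: mult.commute)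
      then show ?thesis using Suc by (metis diff_Suc_1 of_nat_mult)
    qed simp
    then show ?thesis by (metis (no_types, lifting) integral_mult_right_zero Bochner_Integration.integral_cong)
  qed
  also have "\<dots> = l * ?E (\<lambda>m. real ((Suc m - 1) choose s))"
  proof (rule expectation_poisson_mult[OF l])
    fix m :: nat
    have "(m - 1) choose s \<le> m ^ s"
    proof (cases "s \<le> m - 1")
      case True
      then have "(m - 1) choose s \<le> (m - 1) ^ s" by (rule binomial_le_pow)
      also have "\<dots> \<le> m ^ s" by (rule power_mono) auto
      finally show ?thesis .
    qed (simp add: binomial_eq_0)
    then have "real ((m - 1) choose s) \<le> real (m ^ s)" by (simp only: of_nat_le_iff)
    then show "real ((m - 1) choose s) \<le> 1 * (real m + 0) ^ s" by simp
  qed simp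
  also have "\<dots> = l * (l ^ s / fact s)" using Suc.IH by simp
  finally show ?case by (simp add: field_simps del: of_nat_Suc)
qed simp

text \<open>The same recursion with uniform constants; restricting to l at least 1 allows the
  additive 1 to be absorbed into l^p.\<close>

lemma poisson_moment_bound: "\<exists>C \<ge> 0. \<forall>l \<ge> 1. measure_pmf.expectation (poisson_pmf l) (\<lambda>m. real m ^ p) \<le> C * l ^ p"
proof (induction p)
  case 0
  then show ?case by (intro exI[of _ 1]) auto
next
  case (Suc p)
  then obtain C where C: "0 \<le> C" "\<And>l. 1 \<le> l \<Longrightarrow> measure_pmf.expectation (poisson_pmf l) (\<lambda>m. real m ^ p) \<le> C * l ^ p"
    by blast
  show ?case
  proof (intro exI[of _ "2 ^ p * (C + 1)"] conjI allI impI)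
    fix l :: real assume l: "1 \<le> l"
    then have l0: "0 < l" by simp
    let ?E = "measure_pmf.expectation (poisson_pmf l)"
    have int: "integrable (measure_pmf (poisson_pmf l)) (\<lambda>m. (real m + 1) ^ p)"
      by (rule integrable_of_power_bound[OF integrable_poisson_power[OF l0], of _ 1 1 p]) simp
    have "?E (\<lambda>m. real m ^ Suc p) = l * ?E (\<lambda>m. (real m + 1) ^ p)"
      using expectation_poisson_mult[OF l0, of "\<lambda>m. real m ^ p" 1 0 p] by (simp add: add.commute)
    also have "?E (\<lambda>m. (real m + 1) ^ p) \<le> ?E (\<lambda>m. 2 ^ p * (real m ^ p + 1))"
    proof (rule integral_mono[OF int])
      show "integrable (measure_pmf (poisson_pmf l)) (\<lambda>m. 2 ^ p * (real m ^ p + 1))"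
        by (intro integrable_mult_right Bochner_Integration.integrable_add integrable_poisson_power l0) simp
      fix m :: nat
      show "(real m + 1) ^ p \<le> 2 ^ p * (real m ^ p + 1)"
      proof (cases "m = 0")
        case False
        then have "(real m + 1) ^ p \<le> (2 * real m) ^ p" by (intro power_mono) auto
        then show ?thesis by (simp add: power_mult_distrib algebra_simps) (smt (verit) zero_le_power)
      qed (auto intro: order_trans[of _ "2 ^ p"])
    qed
    also have "\<dots> = 2 ^ p * (?E (\<lambda>m. real m ^ p) + 1)"
      by (simp add: integrable_poisson_power l0)
    also have "\<dots> \<le> 2 ^ p * (C * l ^ p + l ^ p)"
      using C(2)[OF l] one_le_power[OF l, of p] by (intro mult_left_mono add_mono) auto
    finally show "?E (\<lambda>m. real m ^ Suc p) \<le> 2 ^ p * (C + 1) * l ^ Suc p"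
      using l by (simp add: algebra_simps mult_left_mono)
  qed (use C in auto)
qed

text \<open>It expresses that M deviates from l by the order of sqrt l only. The raw moments come
  from the Stein-Chen recursion, and the higher powers of l cancel in the binomial
  expansion.\<close>

lemma poisson_fourth_central_moment:
  assumes l: "0 < l"
  shows "measure_pmf.expectation (poisson_pmf l) (\<lambda>m. (real m - l) ^ 4) = 3 * l\<^sup>2 + l"
proof -
  let ?E = "measure_pmf.expectation (poisson_pmf l)"
  note i [simp] = integrable_poisson_power[OF l]
  have i1 [simp]: "integrable (measure_pmf (poisson_pmf l)) real" using i[of 1] by simp
  have step: "?E (\<lambda>m. real m ^ Suc p) = l * ?E (\<lambda>m. (real m + 1) ^ p)" for p
    using expectation_poisson_mult[OF l, of "\<lambda>m. real m ^ p" 1 0 p] by (simp add: add.commute)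
  have 1: "?E (\<lambda>m. real m) = l" using step[of 0] by simp
  have 2: "?E (\<lambda>m. real m ^ 2) = l * (l + 1)" using step[of 1] 1 by (simp add: power2_eq_square)
  have "(\<lambda>m. (real m + 1) ^ 2) = (\<lambda>m. real m ^ 2 + 2 * real m + 1)" by (simp add: fun_eq_iff power2_sum)
  then have 3: "?E (\<lambda>m. real m ^ 3) = l * (l * (l + 1) + 2 * l + 1)"
    using step[of 2] 1 2 by simp
  have "(\<lambda>m. (real m + 1) ^ 3) = (\<lambda>m. real m ^ 3 + 3 * real m ^ 2 + 3 * real m + 1)"
    by (simp add: fun_eq_iff power3_eq_cube power2_eq_square algebra_simps)
  then have 4: "?E (\<lambda>m. real m ^ 4) = l * (l * (l * (l + 1) + 2 * l + 1) + 3 * (l * (l + 1)) + 3 * l + 1)"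
    using step[of 3] 1 2 3 by simp
  have "(\<lambda>m. (real m - l) ^ 4) =
     (\<lambda>m. real m ^ 4 - 4 * l * real m ^ 3 + 6 * l\<^sup>2 * real m ^ 2 - 4 * l ^ 3 * real m + l ^ 4)"
    by (simp add: fun_eq_iff power4_eq_xxxx power3_eq_cube power2_eq_square algebra_simps)
  then have "?E (\<lambda>m. (real m - l) ^ 4) =
     ?E (\<lambda>m. real m ^ 4) - 4 * l * ?E (\<lambda>m. real m ^ 3) + 6 * l\<^sup>2 * ?E (\<lambda>m. real m ^ 2) - 4 * l ^ 3 * ?E (\<lambda>m. real m) + l ^ 4"
    by simp
  also have "\<dots> = 3 * l\<^sup>2 + l"
    unfolding 1 2 3 4 by (simp add: power4_eq_xxxx power3_eq_cube power2_eq_square algebra_simps)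
  finally show ?thesis .
qed

text \<open>The two deviation factors must cost only one power of l, not two. The product is
  separated into the fourth central moment, of order l^2, and a moment of M + l, of order
  l^(2p).\<close>

lemma poisson_fluctuation_bound:
  "\<exists>C. \<forall>l \<ge> 1. measure_pmf.expectation (poisson_pmf l) (\<lambda>m. (real m - l)\<^sup>2 * (real m + l) ^ p) \<le> C * l ^ (p + 1)"
proof -
  obtain C where C: "0 \<le> C" "\<And>l. 1 \<le> l \<Longrightarrow> measure_pmf.expectation (poisson_pmf l) (\<lambda>m. real m ^ (2 * p)) \<le> C * l ^ (2 * p)"
    using poisson_moment_bound[of "2 * p"] by blast
  show ?thesis
  \<comment> \<open>The 4 comes from 3 l^2 + l <= 4 l^2, the other summand from the moment bound for
    M + l, and the division by 2 from ab <= (a^2 + b^2) / 2.\<close>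
  proof (intro exI[of _ "(4 + 2 ^ (2 * p) * (C + 1)) / 2"] allI impI)
    fix l :: real assume l: "1 \<le> l"
    then have l0: "0 < l" by simp
    let ?E = "measure_pmf.expectation (poisson_pmf l)"
    have bnd: "\<bar>real m - l\<bar> \<le> real m + l" for m using l0 by (simp add: abs_le_iff)
    note int = integrable_of_power_bound[OF integrable_poisson_power[OF l0]]
    have i1: "integrable (measure_pmf (poisson_pmf l)) (\<lambda>m. (real m - l)\<^sup>2 * (real m + l) ^ p)"
    proof (rule int[of _ 1 l "2 + p"])
      fix m
      have "\<bar>(real m - l)\<^sup>2 * (real m + l) ^ p\<bar> = \<bar>real m - l\<bar>\<^sup>2 * (real m + l) ^ p"
        using l0 by (simp add: abs_mult)
      also have "\<dots> \<le> (real m + l)\<^sup>2 * (real m + l) ^ p"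
        using bnd[of m] l0 by (intro mult_right_mono power_mono) auto
      finally show "\<bar>(real m - l)\<^sup>2 * (real m + l) ^ p\<bar> \<le> 1 * (real m + l) ^ (2 + p)"
        by (simp only: power_add mult_1)
    qed
    have i2: "integrable (measure_pmf (poisson_pmf l)) (\<lambda>m. (real m - l) ^ 4)"
    proof (rule int[of _ 1 l 4])
      fix m show "\<bar>(real m - l) ^ 4\<bar> \<le> 1 * (real m + l) ^ 4"
        using power_mono[OF bnd[of m], of 4] by (simp add: power_abs)
    qed
    have i3: "integrable (measure_pmf (poisson_pmf l)) (\<lambda>m. (real m + l) ^ (2 * p))"
      by (rule int[of _ 1 l "2 * p"]) (use l0 in simp)
    have "2 * l ^ (p + 1) * ?E (\<lambda>m. (real m - l)\<^sup>2 * (real m + l) ^ p)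
        = ?E (\<lambda>m. 2 * l ^ (p + 1) * ((real m - l)\<^sup>2 * (real m + l) ^ p))" by simp
    also have "\<dots> \<le> ?E (\<lambda>m. l ^ (2 * p) * (real m - l) ^ 4 + l\<^sup>2 * (real m + l) ^ (2 * p))"
    proof (rule integral_mono)
      fix m :: nat
      \<comment> \<open>The weights l^p and l are chosen so that both squares have mean of order
        l^(2p+2).\<close>
      have "2 * ((real m - l)\<^sup>2 * l ^ p) * (l * (real m + l) ^ p) \<le>
        ((real m - l)\<^sup>2 * l ^ p)\<^sup>2 + (l * (real m + l) ^ p)\<^sup>2" by (rule sum_squares_bound)
      then show "2 * l ^ (p + 1) * ((real m - l)\<^sup>2 * (real m + l) ^ p) \<le>
        l ^ (2 * p) * (real m - l) ^ 4 + l\<^sup>2 * (real m + l) ^ (2 * p)"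
        by (simp add: power_mult_distrib power_mult[symmetric] mult_ac)
    qed (use i1 i2 i3 in auto)
    also have "\<dots> = l ^ (2 * p) * (3 * l\<^sup>2 + l) + l\<^sup>2 * ?E (\<lambda>m. (real m + l) ^ (2 * p))"
      using i2 i3 by (simp add: poisson_fourth_central_moment[OF l0])
    also have "\<dots> \<le> l ^ (2 * p) * (4 * l\<^sup>2) + l\<^sup>2 * (2 ^ (2 * p) * (C + 1) * l ^ (2 * p))"
    proof (intro add_mono mult_left_mono)
      show "3 * l\<^sup>2 + l \<le> 4 * l\<^sup>2" using l by (simp add: power2_eq_square)
      have "?E (\<lambda>m. (real m + l) ^ (2 * p)) \<le> ?E (\<lambda>m. 2 ^ (2 * p) * (real m ^ (2 * p) + l ^ (2 * p)))"
      proof (rule integral_mono[OF i3])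
        fix m :: nat
        have "(real m + l) ^ (2 * p) \<le> (2 * max (real m) l) ^ (2 * p)"
          using l0 by (intro power_mono) auto
        also have "\<dots> \<le> 2 ^ (2 * p) * (real m ^ (2 * p) + l ^ (2 * p))"
          using l0 by (auto simp: power_mult_distrib max_def)
        finally show "(real m + l) ^ (2 * p) \<le> 2 ^ (2 * p) * (real m ^ (2 * p) + l ^ (2 * p))" .
      qed (intro integrable_mult_right Bochner_Integration.integrable_add integrable_poisson_power l0, simp)
      also have "\<dots> = 2 ^ (2 * p) * (?E (\<lambda>m. real m ^ (2 * p)) + l ^ (2 * p))"
        using integrable_poisson_power[OF l0] by simp
      also have "\<dots> \<le> 2 ^ (2 * p) * (C * l ^ (2 * p) + l ^ (2 * p))"
        using C(2)[OF l] by simp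
      finally show "?E (\<lambda>m. (real m + l) ^ (2 * p)) \<le> 2 ^ (2 * p) * (C + 1) * l ^ (2 * p)"
        by (simp add: algebra_simps)
    qed (use l0 in auto)
    also have "\<dots> = 2 * l ^ (p + 1) * ((4 + 2 ^ (2 * p) * (C + 1)) / 2 * l ^ (p + 1))"
    proof -
      have "l ^ (p + 1) * l ^ (p + 1) = l\<^sup>2 * l ^ (2 * p)"
        by (simp flip: power_add add: mult_2)
      moreover have "2 * x * (K / 2 * x) = K * (x * x)" for x K :: real by simp
      ultimately show ?thesis by (simp only:) (simp add: algebra_simps)
    qed
    finally show "?E (\<lambda>m. (real m - l)\<^sup>2 * (real m + l) ^ p) \<le> (4 + 2 ^ (2 * p) * (C + 1)) / 2 * l ^ (p + 1)"
      using l0 by simp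
  qed
qed

section \<open>Asymptotics of binomial coefficients for a fixed number of points\<close>

lemma choose_asymptotics: "(\<lambda>n. real (n choose p) / real n ^ p) \<longlonglongrightarrow> 1 / fact p"
proof -
  have "(\<lambda>n. (\<Prod>i = 0..<p. 1 - real i / real n) / fact p) \<longlonglongrightarrow> (\<Prod>i = 0..<p. 1 - 0) / fact p"
    by (intro tendsto_intros lim_const_over_n) simp_all
  moreover have "\<forall>\<^sub>F n in sequentially. real (n choose p) / real n ^ p = (\<Prod>i = 0..<p. 1 - real i / real n) / fact p"
  proof (rule eventually_sequentiallyI[of 1])
    fix n :: nat assume n: "1 \<le> n"
    have "real (n choose p) = (\<Prod>i = 0..<p. real n - real i) / fact p"
      by (simp add: binomial_gbinomial gbinomial_prod_rev)
    also have "(\<Prod>i = 0..<p. real n - real i) = (\<Prod>i = 0..<p. real n * (1 - real i / real n))"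
      using n by (intro prod.cong) (auto simp: field_simps)
    also have "\<dots> = real n ^ p * (\<Prod>i = 0..<p. 1 - real i / real n)" by (simp add: prod.distrib)
    finally show "real (n choose p) / real n ^ p = (\<Prod>i = 0..<p. 1 - real i / real n) / fact p"
      using n by simp
  qed
  ultimately show ?thesis by (simp add: tendsto_cong)
qed

text \<open>Pascal's rule applied \<open>d\<close> times; each application adds a binomial
  coefficient bounded by (m+d)^p.\<close>

lemma choose_shift_le: "(m + d) choose Suc p \<le> (m choose Suc p) + d * (m + d) ^ p"
proof (induction d)
  case (Suc d)
  have "(m + d) choose p \<le> (m + Suc d) ^ p"
    using choose_le_power[of "m + d" p] power_mono[of "m + d" "m + Suc d" p] by linarith
  moreover have "d * (m + d) ^ p \<le> d * (m + Suc d) ^ p" by (intro mult_left_mono power_mono) auto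
  moreover have "(m + Suc d) choose Suc p = ((m + d) choose p) + ((m + d) choose Suc p)" by simp
  moreover have "Suc d * (m + Suc d) ^ p = d * (m + Suc d) ^ p + (m + Suc d) ^ p" by simp
  ultimately show ?case using Suc.IH by linarith
qed simp

text \<open>The first product counts the ordered pairs of disjoint \<open>(p+1)\<close>-subsets of an \<open>n\<close>-set, so the
  defect counts the pairs that meet.\<close>

lemma choose_square_defect:
  "\<bar>real (n choose (2 * Suc p)) * real (2 * Suc p choose Suc p) - (real (n choose Suc p))\<^sup>2\<bar> \<le> real (Suc p) * real n ^ (2 * p + 1)"
proof (cases "2 * Suc p \<le> n")
  case True
  let ?m = "n - Suc p"
  \<comment> \<open>Choosing a block of 2(p+1) elements and splitting it amounts to choosing the two
    halves one after the other.\<close>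
  have eq: "(n choose (2 * Suc p)) * (2 * Suc p choose Suc p) = (n choose Suc p) * (?m choose Suc p)"
    using choose_mult[of "Suc p" "2 * Suc p" n] True by simp
  have le1: "n choose Suc p \<le> (?m choose Suc p) + Suc p * n ^ p"
  proof -
    have e: "?m + Suc p = n" using True by simp
    show ?thesis using choose_shift_le[of ?m "Suc p" p] unfolding e .
  qed
  have le2: "?m choose Suc p \<le> n choose Suc p" by (rule binomial_right_mono) simp
  have "\<bar>real (n choose (2 * Suc p)) * real (2 * Suc p choose Suc p) - (real (n choose Suc p))\<^sup>2\<bar>
    = \<bar>real (n choose Suc p) * (real (?m choose Suc p) - real (n choose Suc p))\<bar>"
  proof -
    have eqr: "real (n choose (2 * Suc p)) * real (2 * Suc p choose Suc p) = real (n choose Suc p) * real (?m choose Suc p)"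
      using eq by (simp only: of_nat_mult[symmetric])
    show ?thesis unfolding eqr by (simp only: right_diff_distrib power2_eq_square)
  qed
  also have "\<dots> = real (n choose Suc p) * (real (n choose Suc p) - real (?m choose Suc p))"
    using le2 by (simp add: abs_mult)
  also have "\<dots> \<le> real n ^ Suc p * (real (Suc p) * real n ^ p)"
  proof (intro mult_mono)
    show "real (n choose Suc p) \<le> real n ^ Suc p"
      using choose_le_power[of n "Suc p"] by (simp only: of_nat_le_iff of_nat_power[symmetric])
    have "real (n choose Suc p) \<le> real ((?m choose Suc p) + Suc p * n ^ p)" using le1 by (simp only: of_nat_le_iff)
    then show "real (n choose Suc p) - real (?m choose Suc p) \<le> real (Suc p) * real n ^ p"
      by (simp only: of_nat_add of_nat_mult of_nat_power)
  qed (use le2 in auto)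
  also have "\<dots> = real (Suc p) * real n ^ (2 * p + 1)"
    by (simp add: power_add mult_2)
  finally show ?thesis .
next
  \<comment> \<open>No two disjoint subsets fit, so only the square remains. One of its factors is
    bounded through the shift by p + 1 from a set too small to contain any (p+1)-subset.\<close>
  case False
  have "real (n choose Suc p) \<le> real n ^ Suc p"
    using choose_le_power[of n "Suc p"] by (simp only: of_nat_le_iff of_nat_power[symmetric])
  moreover have "real (n choose Suc p) \<le> real (Suc p) * real n ^ p"
  proof -
    have "n choose Suc p \<le> Suc p * n ^ p"
    proof (cases "Suc p \<le> n")
      case True
      then have "n - Suc p + Suc p = n" "(n - Suc p) choose Suc p = 0" using False by auto
      then show ?thesis using choose_shift_le[of "n - Suc p" "Suc p" p] by (simp only: add_0)
    qed (simp add: binomial_eq_0)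
    then have "real (n choose Suc p) \<le> real (Suc p * n ^ p)" by (simp only: of_nat_le_iff)
    then show ?thesis by (simp only: of_nat_mult of_nat_power)
  qed
  ultimately have "real (n choose Suc p) * real (n choose Suc p) \<le> real n ^ Suc p * (real (Suc p) * real n ^ p)"
    by (intro mult_mono) auto
  also have "\<dots> = real (Suc p) * real n ^ (2 * p + 1)"
    by (simp add: power_add mult_2)
  finally have "(real (n choose Suc p))\<^sup>2 \<le> real (Suc p) * real n ^ (2 * p + 1)" by (simp add: power2_eq_square)
  moreover have z: "n choose (2 * Suc p) = 0" using False by (intro binomial_eq_0) simp
  ultimately show ?thesis
    unfolding z by (simp only: of_nat_0 mult_zero_left diff_0 abs_minus_cancel abs_power2)
qed

subsection \<open>The count of critical points\<close>

text \<open>Each index is the earliest one carrying its point. This selects exactly one index set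
  for every set of sample points, even when the sample has repetitions.\<close>

definition first_occurrence :: "(nat \<Rightarrow> 'b) \<Rightarrow> nat set \<Rightarrow> bool" where
  "first_occurrence \<omega> I \<longleftrightarrow> (\<forall>i\<in>I. \<forall>j<i. \<omega> j \<noteq> \<omega> i)"

lemma first_occurrence_inj: "first_occurrence \<omega> I \<Longrightarrow> inj_on \<omega> I"
  unfolding first_occurrence_def inj_on_def by (metis linorder_neqE_nat)

text \<open>The inverse sends a set of points to the set of their least indices; minimality forces
  two first-occurrence sets with equal image to agree.\<close>

lemma bij_betw_first_occurrence:
  "bij_betw ((`) \<omega>) {I \<in> ksubsets p {..<m}. first_occurrence \<omega> I} {Y. Y \<subseteq> \<omega> ` {..<m} \<and> card Y = p}"
proof (rule bij_betwI')
  fix I I' assume I: "I \<in> {I \<in> ksubsets p {..<m}. first_occurrence \<omega> I}" and I': "I' \<in> {I \<in> ksubsets p {..<m}. first_occurrence \<omega> I}"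
  have sub: "A \<subseteq> B" if AB: "first_occurrence \<omega> A" "first_occurrence \<omega> B" "\<omega> ` A = \<omega> ` B" for A B
  proof
    fix a assume a: "a \<in> A"
    then obtain b where b: "b \<in> B" "\<omega> a = \<omega> b" using AB(3) by blast
    have "a = b" using AB a b unfolding first_occurrence_def by (metis linorder_neqE_nat)
    then show "a \<in> B" using b by simp
  qed
  show "(\<omega> ` I = \<omega> ` I') = (I = I')"
    using sub[of I I'] sub[of I' I] I I' by auto
next
  fix I assume "I \<in> {I \<in> ksubsets p {..<m}. first_occurrence \<omega> I}"
  then show "\<omega> ` I \<in> {Y. Y \<subseteq> \<omega> ` {..<m} \<and> card Y = p}"
    using first_occurrence_inj[of \<omega> I] by (auto simp: ksubsets_def card_image)
next
  fix Y assume Y: "Y \<in> {Y. Y \<subseteq> \<omega> ` {..<m} \<and> card Y = p}"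
  define I where "I = (\<lambda>y. LEAST i. \<omega> i = y) ` Y"
  have L: "\<omega> (LEAST i. \<omega> i = y) = y" "(LEAST i. \<omega> i = y) < m" if y: "y \<in> Y" for y
  proof -
    obtain i where i: "i < m" "\<omega> i = y" using Y y by auto
    then show "\<omega> (LEAST i. \<omega> i = y) = y" by (intro LeastI[where P="\<lambda>i. \<omega> i = y"])
    have "(LEAST i. \<omega> i = y) \<le> i" using i by (intro Least_le)
    then show "(LEAST i. \<omega> i = y) < m" using i by simp
  qed
  have img: "\<omega> ` I = Y" unfolding I_def using L by force
  have fo: "first_occurrence \<omega> I"
    unfolding first_occurrence_def I_def using L by (auto dest: not_less_Least)
  have "card I = p" using first_occurrence_inj[OF fo] img Y by (metis (mono_tags) card_image mem_Collect_eq)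
  moreover have "I \<subseteq> {..<m}" unfolding I_def using L by auto
  ultimately show "\<exists>I\<in>{I \<in> ksubsets p {..<m}. first_occurrence \<omega> I}. Y = \<omega> ` I"
    using fo img by (auto simp: ksubsets_def)
qed

text \<open>Unlike the almost sure formula for distinct points, this one holds for every \<open>\<omega>\<close>; it is
  needed because the integrand in the variance has to be measurable everywhere.\<close>

lemma crit_count_image:
  fixes \<omega> :: "nat \<Rightarrow> 'a::euclidean_space"
  shows "crit_count k r (\<omega> ` {..<m}) = (\<Sum>I\<in>ksubsets (k + 1) {..<m}. of_bool (first_occurrence \<omega> I \<and>
     critical_simplex k r (\<omega> ` I) \<and> (\<forall>j<m. \<omega> j \<in> \<omega> ` I \<or> \<not> encloses (\<omega> ` I) (\<omega> j))))"
proof -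
  let ?ok = "\<lambda>Y. critical_simplex k r Y \<and> (\<forall>j<m. \<omega> j \<in> Y \<or> \<not> encloses Y (\<omega> j))"
  let ?A = "{I \<in> ksubsets (k + 1) {..<m}. first_occurrence \<omega> I \<and> ?ok (\<omega> ` I)}"
  let ?B = "{Y. Y \<subseteq> \<omega> ` {..<m} \<and> critical_simplex k r Y \<and> (\<forall>p\<in>\<omega> ` {..<m} - Y. \<not> encloses Y p)}"
  note bij = bij_betw_first_occurrence[of \<omega> "k + 1" m]
  have "bij_betw ((`) \<omega>) ?A ?B"
    unfolding bij_betw_def
  proof
    show "inj_on ((`) \<omega>) ?A" using bij_betw_imp_inj_on[OF bij] by (rule inj_on_subset) auto
    have B: "?B = {Y \<in> {Y. Y \<subseteq> \<omega> ` {..<m} \<and> card Y = k + 1}. ?ok Y}"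
      by (auto simp: critical_simplex_def)
    show "(`) \<omega> ` ?A = ?B"
      unfolding B bij_betw_imp_surj_on[OF bij, symmetric] by auto
  qed
  then have "crit_count k r (\<omega> ` {..<m}) = real (card ?A)"
    by (subst crit_count_eq_card) (auto simp: bij_betw_same_card)
  also have "\<dots> = (\<Sum>I\<in>ksubsets (k + 1) {..<m}. of_bool (first_occurrence \<omega> I \<and> ?ok (\<omega> ` I)))"
    by (subst sum_of_bool_eq) (auto simp: Int_def)
  finally show ?thesis .
qed

lemma Var_cong_AE:
  assumes "X \<in> borel_measurable N" "Y \<in> borel_measurable N" "AE \<omega> in N. X \<omega> = Y \<omega>"
  shows "Var N X = Var N Y"
proof -
  have "(\<integral>\<omega>. X \<omega> \<partial>N) = (\<integral>\<omega>. Y \<omega> \<partial>N)" by (rule integral_cong_AE[OF assms])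
  then show ?thesis unfolding Var_def
    using assms by (intro integral_cong_AE) auto
qed

section \<open>The geometric instance and the almost sure form of the count\<close>

context bounded_density
begin

text \<open>The bound on the density times the volume of a ball of radius 2.\<close>

definition ball_const :: real where
  "ball_const = F * (2 ^ DIM('a) * measure lborel (ball (0 :: 'a) 1))"

lemma measure_\<mu>_ball:
  assumes "0 < r"
  shows "measure \<mu> {y. dist x y \<le> 2 * r} \<le> ball_const * r ^ DIM('a)"
proof -
  have cb: "{y. dist x y \<le> 2 * r} = cball x (2 * r)" by auto
  have fin: "emeasure lborel (cball x (2 * r)) \<noteq> \<infinity>"
    using emeasure_lborel_cball_finite[of x "2 * r"] by simp
  have "emeasure \<mu> (cball x (2 * r)) = (\<integral>\<^sup>+ y. ennreal (f y) * indicator (cball x (2 * r)) y \<partial>lborel)"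
    by (rule emeasure_density) auto
  also have "\<dots> \<le> (\<integral>\<^sup>+ y. ennreal F * indicator (cball x (2 * r)) y \<partial>lborel)"
    by (intro nn_integral_mono mult_right_mono ennreal_leI f_le) simp
  also have "\<dots> = ennreal F * emeasure lborel (cball x (2 * r))"
    by (rule nn_integral_cmult_indicator) simp
  also have "\<dots> = ennreal (F * measure lborel (cball x (2 * r)))"
    using F_ge1 fin by (subst emeasure_eq_ennreal_measure) (auto simp: ennreal_mult)
  also have "F * measure lborel (cball x (2 * r)) = ball_const * r ^ DIM('a)"
    using assms content_ball_conv_unit_ball[of "2 * r" x] content_cball_conv_ball[of x "2 * r"]
    by (simp add: ball_const_def power_mult_distrib mult_ac)
  finally have "emeasure \<mu> (cball x (2 * r)) \<le> ennreal (ball_const * r ^ DIM('a))" .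
  moreover have "0 \<le> ball_const * r ^ DIM('a)"
    using assms F_ge1 by (auto simp: ball_const_def)
  ultimately show ?thesis
    unfolding cb measure_def by (simp add: enn2real_leI)
qed

sublocale iid_sequence \<mu>
proof -
  interpret prob_space \<mu> by (rule prob_\<mu>)
  show "iid_sequence \<mu>" by unfold_locales simp
qed

lemma sets_P_eq: "sets P = sets borel"
proof -
  have "sets P = sets (PiM UNIV (\<lambda>_::nat. borel :: 'a measure))" by (intro sets_PiM_cong) auto
  then show ?thesis by (simp add: sets_PiM_equal_borel)
qed

text \<open>Vertices and enclosed points all lie in one closed ball of radius at most
  \<open>r\<close>, hence within \<open>2 * r\<close> of each other.\<close>

lemma local_count_critical_simplex:
  assumes "0 < r"
  shows "local_count \<mu> (critical_simplex k r) encloses (\<lambda>x y. dist x y \<le> 2 * r) k (ball_const * r ^ DIM('a))"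
proof
  show "Measurable.pred P (\<lambda>\<omega>. critical_simplex k r (\<omega> ` I))" if "finite I" "card I = k + 1" for I
    using borel_critical_simplex[OF that, of r] by (simp add: pred_def sets_P_eq)
  show "Measurable.pred P (\<lambda>\<omega>. critical_simplex k r (\<omega> ` I) \<and> encloses (\<omega> ` I) (\<omega> j))"
    if "finite I" "card I = k + 1" for I j
    using borel_critical_simplex_encloses[OF that, of r j] by (simp add: pred_def sets_P_eq)
  show "Measurable.pred (\<mu> \<Otimes>\<^sub>M \<mu>) (\<lambda>(x, y). dist x y \<le> 2 * r)"
    by (simp add: case_prod_beta)
  show "dist x y \<le> 2 * r" if "critical_simplex k r Y" "x \<in> Y" "y \<in> Y" for Y x y
    using that by (rule critical_simplex_dist_le)
  show "dist p y \<le> 2 * r \<and> dist y p \<le> 2 * r" if "critical_simplex k r Y" "encloses Y p" "y \<in> Y" for Y p y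
    using encloses_dist_le[OF that] by (simp add: dist_commute)
  show "measure \<mu> {y. dist x y \<le> 2 * r} \<le> ball_const * r ^ DIM('a)" for x
    by (rule measure_\<mu>_ball[OF assms])
qed

text \<open>Coinciding points are near at every scale, so a coincidence has probability at most a
  constant times r^d for all r > 0, hence zero; there are only countably many pairs of
  indices.\<close>

lemma AE_inj: "AE \<omega> in P. inj \<omega>"
proof -
  have "AE \<omega> in P. \<omega> i \<noteq> \<omega> j" if ij: "i \<noteq> j" for i j
  proof -
    let ?X = "\<lambda>\<omega>. of_bool (\<omega> i = \<omega> j) :: real"
    have [measurable]: "Measurable.pred P (\<lambda>\<omega>. \<omega> i = \<omega> j)"
    proof -
      have [measurable]: "(\<lambda>\<omega>. \<omega> l) \<in> borel_measurable P" for l by measurable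
      have "Measurable.pred P (\<lambda>\<omega>. dist (\<omega> i) (\<omega> j) = 0)" by measurable
      then show ?thesis by simp
    qed
    have int: "integrable P ?X" by (rule integrable_bounded[of _ 1]) auto
    have le: "(\<integral>\<omega>. ?X \<omega> \<partial>P) \<le> ball_const * r ^ DIM('a)" if r: "0 < r" for r :: real
    proof -
      \<comment> \<open>The index 1 is an arbitrary choice; only the cluster bound of the interface
        is wanted.\<close>
      interpret local_count \<mu> "critical_simplex 1 r" encloses "\<lambda>x y. dist x y \<le> 2 * r" 1 "ball_const * r ^ DIM('a)"
        by (rule local_count_critical_simplex[OF r])
      have "(\<integral>\<omega>. ?X \<omega> \<partial>P) \<le> (\<integral>\<omega>. cluster i {j} \<omega> \<partial>P)"
        using r by (intro integral_mono int integrable_bounded[of _ 1]) (auto simp: cluster_def)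
      also have "\<dots> \<le> ball_const * r ^ DIM('a)" using expectation_cluster_le[of "{j}" i] ij by simp
      finally show ?thesis .
    qed
    have "(\<lambda>n. ball_const * (inverse (real (Suc n))) ^ DIM('a)) \<longlonglongrightarrow> ball_const * 0 ^ DIM('a)"
      by (intro tendsto_intros LIMSEQ_inverse_real_of_nat)
    moreover have "ball_const * 0 ^ DIM('a) = 0" by simp
    ultimately have "(\<lambda>n. ball_const * (inverse (real (Suc n))) ^ DIM('a)) \<longlonglongrightarrow> 0" by (simp only:)
    then have "(\<integral>\<omega>. ?X \<omega> \<partial>P) \<le> 0"
      by (rule LIMSEQ_le_const) (use le in auto)
    moreover have "0 \<le> (\<integral>\<omega>. ?X \<omega> \<partial>P)" by simp
    ultimately have "(\<integral>\<omega>. ?X \<omega> \<partial>P) = 0" by linarith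
    then have "AE \<omega> in P. ?X \<omega> = 0"
      using integral_nonneg_eq_0_iff_AE[OF int] by simp
    then show ?thesis by eventually_elim simp
  qed
  then have "AE \<omega> in P. \<forall>i j. i \<noteq> j \<longrightarrow> \<omega> i \<noteq> \<omega> j"
    unfolding AE_all_countable by auto
  then show ?thesis by eventually_elim (auto simp: inj_def)
qed

lemma AE_inj_indexed: "AE \<omega> in indexed \<nu>. inj (snd \<omega>)"
proof -
  have "AE \<omega> in distr (indexed \<nu>) P snd. inj \<omega>"
  proof -
    have eq: "distr (indexed \<nu>) P snd = P"
    proof (rule measure_eqI)
      fix A assume "A \<in> sets (distr (indexed \<nu>) P snd)"
      then have A: "A \<in> sets P" by simp
      have "snd -` A \<inter> space (indexed \<nu>) = space (measure_pmf \<nu>) \<times> A"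
        by (auto simp: space_pair_measure)
      then show "emeasure (distr (indexed \<nu>) P snd) A = emeasure P A"
        using A by (simp add: emeasure_distr P.emeasure_pair_measure_Times measure_pmf.emeasure_space_1[simplified])
    qed simp
    show ?thesis unfolding eq by (rule AE_inj)
  qed
  then show ?thesis by (rule AE_distrD[rotated]) simp
qed

lemma crit_count_measurable:
  assumes "0 < r"
  shows "(\<lambda>\<omega>. crit_count k r (\<omega> ` {..<m})) \<in> borel_measurable P"
  unfolding crit_count_image
proof (rule borel_measurable_sum)
  interpret local_count \<mu> "critical_simplex k r" encloses "\<lambda>x y. dist x y \<le> 2 * r" k "ball_const * r ^ DIM('a)"
    by (rule local_count_critical_simplex[OF assms])
  fix I assume I: "I \<in> ksubsets (k + 1) {..<m}"
  then have cI: "card I = k + 1" by (rule ksubsetsD)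
  have fI [simp]: "finite I" by (rule finite_ksubset[OF _ I]) simp
  have [measurable]: "Measurable.pred P (\<lambda>\<omega>. \<omega> i = \<omega> j)" for i j
  proof -
    have [measurable]: "(\<lambda>\<omega>. \<omega> l) \<in> borel_measurable P" for l by measurable
    have "Measurable.pred P (\<lambda>\<omega>. dist (\<omega> i) (\<omega> j) = 0)" by measurable
    then show ?thesis by simp
  qed
  note [measurable] = meas_H[OF fI cI] meas_HG[OF fI cI]
  \<comment> \<open>Enclosing is known to be measurable only together with criticality. Since
    criticality is a conjunct already, it may be inserted under the negation without changing the
    event.\<close>
  have eq: "first_occurrence \<omega> I \<and> critical_simplex k r (\<omega> ` I) \<and> (\<forall>j<m. \<omega> j \<in> \<omega> ` I \<or> \<not> encloses (\<omega> ` I) (\<omega> j))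
    \<longleftrightarrow> (\<forall>i\<in>I. \<forall>j\<in>{..<i}. \<omega> j \<noteq> \<omega> i) \<and> critical_simplex k r (\<omega> ` I) \<and>
      (\<forall>j\<in>{..<m}. (\<exists>i\<in>I. \<omega> j = \<omega> i) \<or> \<not> (critical_simplex k r (\<omega> ` I) \<and> encloses (\<omega> ` I) (\<omega> j)))" for \<omega>
    by (auto simp: first_occurrence_def image_iff)
  show "(\<lambda>\<omega>. of_bool (first_occurrence \<omega> I \<and> critical_simplex k r (\<omega> ` I) \<and>
      (\<forall>j<m. \<omega> j \<in> \<omega> ` I \<or> \<not> encloses (\<omega> ` I) (\<omega> j)))) \<in> borel_measurable P"
    unfolding eq by measurable
qed

lemma crit_count_eq_unblocked:
  fixes \<omega> :: "nat \<Rightarrow> 'a"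
  assumes "0 < r" "inj \<omega>"
  shows "crit_count k r (\<omega> ` {..<m}) = local_count.unblocked (critical_simplex k r) encloses k {..<m} \<omega>"
proof -
  interpret local_count \<mu> "critical_simplex k r" encloses "\<lambda>x y. dist x y \<le> 2 * r" k "ball_const * r ^ DIM('a)"
    by (rule local_count_critical_simplex[OF assms(1)])
  show ?thesis
    unfolding crit_count_image unblocked_def U_stat_def blocked_def sum_subtractf[symmetric]
  proof (rule sum.cong[OF refl])
    fix I assume "I \<in> ksubsets (k + 1) {..<m}"
    have fo: "first_occurrence \<omega> I" using assms(2) by (auto simp: first_occurrence_def inj_def)
    have "(\<forall>j<m. \<omega> j \<in> \<omega> ` I \<or> \<not> encloses (\<omega> ` I) (\<omega> j)) \<longleftrightarrow> \<not> (\<exists>j\<in>{..<m} - I. encloses (\<omega> ` I) (\<omega> j))"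
      using assms(2) by (auto simp: inj_image_mem_iff)
    then show "of_bool (first_occurrence \<omega> I \<and> critical_simplex k r (\<omega> ` I) \<and> (\<forall>j<m. \<omega> j \<in> \<omega> ` I \<or> \<not> encloses (\<omega> ` I) (\<omega> j)))
      = (of_bool (critical_simplex k r (\<omega> ` I)) - of_bool (critical_simplex k r (\<omega> ` I) \<and> (\<exists>j\<in>{..<m} - I. encloses (\<omega> ` I) (\<omega> j))) :: real)"
      using fo by auto
  qed
qed

lemma sample_space_eq: "sample_space f n = indexed (poisson_pmf (real n))"
  by (simp add: sample_space_def)

lemma measurable_unblocked:
  assumes "0 < r" "finite L"
  shows "local_count.unblocked (critical_simplex k r) encloses k L \<in> borel_measurable P"
proof -
  interpret local_count \<mu> "critical_simplex k r" encloses "\<lambda>x y. dist x y \<le> 2 * r" k "ball_const * r ^ DIM('a)"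
    by (rule local_count_critical_simplex[OF assms(1)])
  show ?thesis unfolding unblocked_def[abs_def] using assms(2) by measurable
qed

lemma Var_poisson_sample:
  assumes "0 < r"
  shows "Var (sample_space f n) (\<lambda>\<omega>. crit_count k r (poisson_sample \<omega>)) =
    Var (indexed (poisson_pmf (real n))) (\<lambda>\<omega>. local_count.unblocked (critical_simplex k r) encloses k {..<fst \<omega>} (snd \<omega>))"
  unfolding sample_space_eq poisson_sample_def
proof (rule Var_cong_AE)
  show "(\<lambda>\<omega>. crit_count k r (snd \<omega> ` {..<fst \<omega>})) \<in> borel_measurable (indexed (poisson_pmf (real n)))"
    by (rule measurable_indexed[OF crit_count_measurable[OF assms]])
  show "(\<lambda>\<omega>. local_count.unblocked (critical_simplex k r) encloses k {..<fst \<omega>} (snd \<omega>)) \<in> borel_measurable (indexed (poisson_pmf (real n)))"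
    by (rule measurable_indexed[OF measurable_unblocked[OF assms]]) simp
  show "AE \<omega> in indexed (poisson_pmf (real n)). crit_count k r (snd \<omega> ` {..<fst \<omega>}) =
     local_count.unblocked (critical_simplex k r) encloses k {..<fst \<omega>} (snd \<omega>)"
    using AE_inj_indexed by eventually_elim (rule crit_count_eq_unblocked[OF assms])
qed

lemma Var_indexed_const:
  fixes X :: "nat \<Rightarrow> (nat \<Rightarrow> 'a) \<Rightarrow> real"
  assumes [measurable]: "\<And>m. X m \<in> borel_measurable P" and b: "\<And>\<omega>. \<bar>X n \<omega>\<bar> \<le> C"
  shows "Var (indexed \<nu>) (\<lambda>\<omega>. X n (snd \<omega>)) = P.variance (X n)"
proof -
  have 1: "(\<integral>\<omega>. X n (snd \<omega>) \<partial>indexed \<nu>) = (\<integral>\<omega>. X n \<omega> \<partial>P)"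
    by (subst expectation_indexed[where F="\<lambda>_. X n" and b="\<lambda>_. C"]) (use b in auto)
  have b2: "\<bar>(X n \<omega> - c)\<^sup>2\<bar> \<le> (C + \<bar>c\<bar>)\<^sup>2" for \<omega> c
  proof -
    have "\<bar>X n \<omega> - c\<bar> \<le> C + \<bar>c\<bar>" using b[of \<omega>] by linarith
    from power_mono[OF this abs_ge_zero, of 2] show ?thesis by simp
  qed
  show ?thesis unfolding Var_def 1
    by (subst expectation_indexed[where F="\<lambda>_ \<omega>. (X n \<omega> - c)\<^sup>2" and b="\<lambda>_. (C + \<bar>c\<bar>)\<^sup>2" for c]) (use b2 in auto)
qed

text \<open>The fixed-size count depends only on the sequence, so the Poisson first component of the
  sample space can be exchanged for the point mass at n. This gives both sampling schemes the same
  form, with a law of the sample size as parameter.\<close>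

lemma Var_binomial_sample:
  assumes r: "0 < r"
  shows "Var (sample_space f n) (\<lambda>\<omega>. crit_count k r (binomial_sample n \<omega>)) =
    Var (indexed (return_pmf n)) (\<lambda>\<omega>. local_count.unblocked (critical_simplex k r) encloses k {..<fst \<omega>} (snd \<omega>))"
proof -
  interpret local_count \<mu> "critical_simplex k r" encloses "\<lambda>x y. dist x y \<le> 2 * r" k "ball_const * r ^ DIM('a)"
    by (rule local_count_critical_simplex[OF r])
  have m [measurable]: "unblocked {..<m} \<in> borel_measurable P" for m
    by (rule measurable_unblocked[OF r]) simp
  have b: "\<bar>unblocked {..<m} \<omega>\<bar> \<le> real m ^ (k + 1)" for m \<omega>
    using U_stat_bounds[of "{..<m}" \<omega>] blocked_nonneg[of "{..<m}" \<omega>] blocked_le_U_stat[of "{..<m}" \<omega>]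
    by (simp add: unblocked_def)
  have "Var (sample_space f n) (\<lambda>\<omega>. crit_count k r (binomial_sample n \<omega>)) =
    Var (indexed (poisson_pmf (real n))) (\<lambda>\<omega>. unblocked {..<n} (snd \<omega>))"
    unfolding sample_space_eq binomial_sample_def
  proof (rule Var_cong_AE)
    show "(\<lambda>\<omega>. crit_count k r (snd \<omega> ` {..<n})) \<in> borel_measurable (indexed (poisson_pmf (real n)))"
      by (rule measurable_indexed[OF crit_count_measurable[OF r]])
    show "(\<lambda>\<omega>. unblocked {..<n} (snd \<omega>)) \<in> borel_measurable (indexed (poisson_pmf (real n)))"
      by (rule measurable_indexed[OF m])
    show "AE \<omega> in indexed (poisson_pmf (real n)). crit_count k r (snd \<omega> ` {..<n}) = unblocked {..<n} (snd \<omega>)"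
      using AE_inj_indexed by eventually_elim (rule crit_count_eq_unblocked[OF r])
  qed
  also have "\<dots> = P.variance (unblocked {..<n})"
    by (rule Var_indexed_const[where X="\<lambda>m. unblocked {..<m}", OF m b])
  also have "\<dots> = Var (indexed (return_pmf n)) (\<lambda>\<omega>. unblocked {..<n} (snd \<omega>))"
    by (rule Var_indexed_const[where X="\<lambda>m. unblocked {..<m}", OF m b, symmetric])
  also have "\<dots> = Var (indexed (return_pmf n)) (\<lambda>\<omega>. unblocked {..<fst \<omega>} (snd \<omega>))"
  proof (rule Var_cong_AE)
    show "(\<lambda>\<omega>. unblocked {..<n} (snd \<omega>)) \<in> borel_measurable (indexed (return_pmf n))"
      by (rule measurable_indexed[OF m])
    show "(\<lambda>\<omega>. unblocked {..<fst \<omega>} (snd \<omega>)) \<in> borel_measurable (indexed (return_pmf n))"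
      by (rule measurable_indexed[OF m])
    have "AE m in distr (indexed (return_pmf n)) (measure_pmf (return_pmf n)) fst. m = n"
      by (subst P.distr_pair_fst) (simp add: AE_measure_pmf_iff)
    then have "AE \<omega> in indexed (return_pmf n). fst \<omega> = n" by (rule AE_distrD[rotated]) simp
    then show "AE \<omega> in indexed (return_pmf n). unblocked {..<n} (snd \<omega>) = unblocked {..<fst \<omega>} (snd \<omega>)"
      by eventually_elim simp
  qed
  finally show ?thesis .
qed

lemma variance_limit:
  fixes \<nu> :: "nat \<Rightarrow> nat pmf" and r :: "nat \<Rightarrow> real"
  assumes r: "\<And>n. 0 < r n" "r \<longlonglongrightarrow> 0" "(\<lambda>n. real n * r n ^ DIM('a)) \<longlonglongrightarrow> 0" and k: "1 \<le> k"
    and moments: "\<And>n p. 0 < n \<Longrightarrow> integrable (measure_pmf (\<nu> n)) (\<lambda>m. real m ^ p)"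
    and C: "\<And>p. \<exists>C. \<forall>n>0. measure_pmf.expectation (\<nu> n) (\<lambda>m. real m ^ p) \<le> C * real n ^ p"
    and D: "\<And>n. 0 < n \<Longrightarrow> \<bar>measure_pmf.expectation (\<nu> n) (\<lambda>m. real (m choose (2 * (k + 1)))) * real (2 * (k + 1) choose (k + 1))
       - (measure_pmf.expectation (\<nu> n) (\<lambda>m. real (m choose (k + 1))))\<^sup>2\<bar> \<le> D * real n ^ (2 * k + 1)"
    and E: "\<And>n. 0 < n \<Longrightarrow> measure_pmf.expectation (\<nu> n) (\<lambda>m. (real m - real n)\<^sup>2 * (real m + real n) ^ (2 * (k + 1)))
      \<le> E * real n ^ (2 * k + 3)"
    and w: "(\<lambda>n. measure_pmf.expectation (\<nu> n) (\<lambda>m. real (m choose (k + 1))) / real n ^ (k + 1)) \<longlonglongrightarrow> 1 / fact (k + 1)"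
  shows "(\<lambda>n. Var (indexed (\<nu> n)) (\<lambda>\<omega>. local_count.unblocked (critical_simplex k (r n)) encloses k {..<fst \<omega>} (snd \<omega>))
     / (real n ^ (k + 1) * r n ^ (DIM('a) * k))) \<longlonglongrightarrow> mu_const f k"
proof -
  obtain C' where C': "\<And>p n. 0 < n \<Longrightarrow> measure_pmf.expectation (\<nu> n) (\<lambda>m. real m ^ p) \<le> C' p * real n ^ p"
    using C by metis
  have q: "(\<lambda>n. local_count.q \<mu> (critical_simplex k (r n)) k / r n ^ (DIM('a) * k))
    \<longlonglongrightarrow> (\<integral>x. f x ^ (k + 1) \<partial>lborel) * (\<integral>z. h1 k z \<partial>PiM {..<k} (\<lambda>_. lborel :: 'a measure))"
    using simplex_probability_limit[OF r(2,1), of k]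
    by (simp add: local_count.q_def[OF local_count_critical_simplex[OF r(1)]])
  show ?thesis
    using variance_unblocked_asymptotics[OF local_count_critical_simplex[OF r(1)] r(1,3) k moments C' D E w q]
    unfolding Var_def mu_const_def by (simp add: mult.assoc)
qed

end

theorem theorem3p2:
  fixes f :: "'a::euclidean_space \<Rightarrow> real"
    and r :: "nat \<Rightarrow> real"
    and k :: nat
  assumes f_meas: "f \<in> borel_measurable lborel"
    and f_nonneg: "\<And>x. 0 \<le> f x"
    and f_bdd: "bounded (range f)"
    and f_dens: "(\<integral>\<^sup>+ x. ennreal (f x) \<partial>lborel) = 1"
    and r_pos: "\<And>n. 0 < r n"
    and r_lim: "r \<longlonglongrightarrow> 0"
    and nr_lim: "(\<lambda>n. real n * r n ^ DIM('a)) \<longlonglongrightarrow> 0"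
    and k_ge: "1 \<le> k" and k_le: "k \<le> DIM('a)"
  shows "(\<lambda>n. Var (sample_space f n) (\<lambda>\<omega>. crit_count k (r n) (binomial_sample n \<omega>))
              / (real n ^ (k + 1) * r n ^ (DIM('a) * k))) \<longlonglongrightarrow> mu_const f k \<and>
         (\<lambda>n. Var (sample_space f n) (\<lambda>\<omega>. crit_count k (r n) (poisson_sample \<omega>))
              / (real n ^ (k + 1) * r n ^ (DIM('a) * k))) \<longlonglongrightarrow> mu_const f k"
proof -
  obtain B where B: "\<And>x. norm (f x) \<le> B" using f_bdd by (auto simp: bounded_iff)
  \<comment> \<open>The bound is raised to at least 1, as the estimate for differences of products
    requires.\<close>
  interpret bounded_density f "max 1 B"
  proof
    show "f x \<le> max 1 B" for x using B[of x] by simp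
  qed (use f_meas f_nonneg f_dens in auto)
  show ?thesis
  proof
    have "(\<lambda>n. Var (indexed (return_pmf n)) (\<lambda>\<omega>. local_count.unblocked (critical_simplex k (r n)) encloses k {..<fst \<omega>} (snd \<omega>))
       / (real n ^ (k + 1) * r n ^ (DIM('a) * k))) \<longlonglongrightarrow> mu_const f k"
    \<comment> \<open>A constant sample size does not fluctuate, hence \<open>E\<close> is 0;
      \<open>D\<close> comes from the pairs of index sets that meet.\<close>
    proof (rule variance_limit[where D="real (Suc k)" and E=0])
      show "integrable (measure_pmf (return_pmf n)) (\<lambda>m. real m ^ p)" for n p
        by (rule integrable_measure_pmf_finite) simp
      show "\<exists>C. \<forall>n>0. measure_pmf.expectation (return_pmf n) (\<lambda>m. real m ^ p) \<le> C * real n ^ p" for p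
        by (intro exI[of _ 1]) simp
      show "\<bar>measure_pmf.expectation (return_pmf n) (\<lambda>m. real (m choose (2 * (k + 1)))) * real (2 * (k + 1) choose (k + 1))
         - (measure_pmf.expectation (return_pmf n) (\<lambda>m. real (m choose (k + 1))))\<^sup>2\<bar> \<le> real (Suc k) * real n ^ (2 * k + 1)" for n
        using choose_square_defect[of n k] by (simp only: expectation_return_pmf Suc_eq_plus1)
      show "(\<lambda>n. measure_pmf.expectation (return_pmf n) (\<lambda>m. real (m choose (k + 1))) / real n ^ (k + 1)) \<longlonglongrightarrow> 1 / fact (k + 1)"
        using choose_asymptotics[of "k + 1"] by (simp only: expectation_return_pmf)
    qed (use r_pos r_lim nr_lim k_ge in auto)
    then show "(\<lambda>n. Var (sample_space f n) (\<lambda>\<omega>. crit_count k (r n) (binomial_sample n \<omega>))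
              / (real n ^ (k + 1) * r n ^ (DIM('a) * k))) \<longlonglongrightarrow> mu_const f k"
      by (simp only: Var_binomial_sample[OF r_pos])
  next
    obtain E where E: "\<And>l. 1 \<le> l \<Longrightarrow> measure_pmf.expectation (poisson_pmf l) (\<lambda>m. (real m - l)\<^sup>2 * (real m + l) ^ (2 * (k + 1))) \<le> E * l ^ (2 * (k + 1) + 1)"
      using poisson_fluctuation_bound[of "2 * (k + 1)"] by blast
    have "(\<lambda>n. Var (indexed (poisson_pmf (real n))) (\<lambda>\<omega>. local_count.unblocked (critical_simplex k (r n)) encloses k {..<fst \<omega>} (snd \<omega>))
       / (real n ^ (k + 1) * r n ^ (DIM('a) * k))) \<longlonglongrightarrow> mu_const f k"
    \<comment> \<open>The Poisson factorial moments make the disjoint pairs cancel exactly, hence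
      \<open>D\<close> is 0; the cost is now in the fluctuation of the sample size.\<close>
    proof (rule variance_limit[where D=0 and E=E])
      show "integrable (measure_pmf (poisson_pmf (real n))) (\<lambda>m. real m ^ p)" if "0 < n" for n p
        using that by (intro integrable_poisson_power) simp
      show "\<exists>C. \<forall>n>0. measure_pmf.expectation (poisson_pmf (real n)) (\<lambda>m. real m ^ p) \<le> C * real n ^ p" for p
      proof -
        obtain C where "\<And>l. 1 \<le> l \<Longrightarrow> measure_pmf.expectation (poisson_pmf l) (\<lambda>m. real m ^ p) \<le> C * l ^ p"
          using poisson_moment_bound[of p] by blast
        then show ?thesis by (intro exI[of _ C]) simp
      qed
      show "measure_pmf.expectation (poisson_pmf (real n)) (\<lambda>m. (real m - real n)\<^sup>2 * (real m + real n) ^ (2 * (k + 1)))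
         \<le> E * real n ^ (2 * k + 3)" if "0 < n" for n
      proof -
        have e: "2 * (k + 1) + 1 = 2 * k + 3" by simp
        have "1 \<le> real n" using that by simp
        from E[OF this, unfolded e] show ?thesis .
      qed
      show "\<bar>measure_pmf.expectation (poisson_pmf (real n)) (\<lambda>m. real (m choose (2 * (k + 1)))) * real (2 * (k + 1) choose (k + 1))
         - (measure_pmf.expectation (poisson_pmf (real n)) (\<lambda>m. real (m choose (k + 1))))\<^sup>2\<bar> \<le> 0 * real n ^ (2 * k + 1)" if "0 < n" for n
      proof -
        have binom: "real (2 * (k + 1) choose (k + 1)) = fact (2 * (k + 1)) / (fact (k + 1) * fact (k + 1))"
          by (subst binomial_fact) auto
        have cancel: "a / c * (c / (d * d)) - (b / d)\<^sup>2 = 0" if "a = b\<^sup>2" "c \<noteq> 0" "d \<noteq> 0" for a b c d :: real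
          using that by (simp add: power2_eq_square)
        have "0 < real n" using that by simp
        have "real n ^ (2 * (k + 1)) / fact (2 * (k + 1)) * (fact (2 * (k + 1)) / (fact (k + 1) * fact (k + 1)))
          - (real n ^ (k + 1) / fact (k + 1))\<^sup>2 = 0"
          by (rule cancel) (rule power_even_eq, rule fact_nonzero, rule fact_nonzero)
        then show ?thesis
          unfolding expectation_poisson_choose[OF \<open>0 < real n\<close>] binom by (simp only: abs_zero mult_zero_left order_refl)
      qed
      show "(\<lambda>n. measure_pmf.expectation (poisson_pmf (real n)) (\<lambda>m. real (m choose (k + 1))) / real n ^ (k + 1)) \<longlonglongrightarrow> 1 / fact (k + 1)"
      proof (rule tendsto_eventually, rule eventually_sequentiallyI[of 1])
        fix n :: nat assume "1 \<le> n"
        then have "0 < real n" by simp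
        then show "measure_pmf.expectation (poisson_pmf (real n)) (\<lambda>m. real (m choose (k + 1))) / real n ^ (k + 1) = 1 / fact (k + 1)"
          unfolding expectation_poisson_choose[OF \<open>0 < real n\<close>] by simp
      qed
    qed (use r_pos r_lim nr_lim k_ge in auto)
    then show "(\<lambda>n. Var (sample_space f n) (\<lambda>\<omega>. crit_count k (r n) (poisson_sample \<omega>))
              / (real n ^ (k + 1) * r n ^ (DIM('a) * k))) \<longlonglongrightarrow> mu_const f k"
      by (simp only: Var_poisson_sample[OF r_pos])
  qed
qed

end
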